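(* For $p\ge 3$ there is an isomorphism of $\mathrm{GL}_p(K)$-modules \[ \mathcal F_p\cong\bigoplus_{n=0}^\infty\ \bigoplus_{\nu=(\nu_1,\nu_2,\nu_3)\vdash n} m_\nu(M_3(K),so_3(K))\,W_p(\nu), \] where $m_{(2k,0,0)}(M_3(K),so_3(K))=1$ for $k\ge 1$, and for every other partition $\nu=(\nu_1,\nu_2,\nu_3)$ (at most three parts) $m_\nu(M_3(K),so_3(K))=m_\nu$ with $m_\nu$ defined by: (i) if $\nu_1\equiv\nu_2\equiv\nu_3\pmod 2$: $m_\nu=3$ if $\nu_1>\nu_2>\nu_3$; $2$ if $\nu_1=\nu_2>\nu_3$; $2$ if $\nu_1>\nu_2=\nu_3$; $1$ if $\nu_1=\nu_2=\nu_3$; (ii) if $\nu_1\equiv\nu_2\not\equiv\nu_3\pmod 2$: $m_\nu=2$ if $\nu_1>\nu_2$, $1$ if $\nu_1=\nu_2$; (iii) if $\nu_1\equiv\nu_3\not\equiv\nu_2\pmod 2$: $m_\nu=2$; (iv) if $\nu_1\not\equiv\nu_2\equiv\nu_3\pmod 2$: $m_\nu=2$ if $\nu_2>\nu_3$, $1$ if $\nu_2=\nu_3$. For $p<3$ the same formula holds after removing the summands labeled by partitions $\nu$ with more than $p$ nonzero parts.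
   Context: $K$ is a field of characteristic $0$. For $p\ge1$, $T_p=\{t^{(k)}_{ij}\mid 1\le i<j\le 3,\ 1\le k\le p\}$ are commuting indeterminates, and $t_k\in M_3(K[T_p])$ is the generic skew-symmetric matrix with zero diagonal, $(i,j)$ entry $t^{(k)}_{ij}$ and $(j,i)$ entry $-t^{(k)}_{ij}$ for $i<j$. $\mathcal F_p$ is the unital $K$-subalgebra of $M_3(K[T_p])$ generated by $t_1,\dots,t_p$. The group $\mathrm{GL}_p(K)$ acts on $K[T_p]$ by graded $K$-algebra automorphisms via $g\cdot t^{(k)}_{ij}=\sum_{l=1}^p g_{lk}t^{(l)}_{ij}$ for $g=(g_{ij})$, and on $M_3(K[T_p])$ entrywise; $\mathcal F_p$ is a $\mathrm{GL}_p(K)$-submodule. $W_p(\nu)$ denotes the irreducible polynomial $\mathrm{GL}_p(K)$-module indexed by the partition $\nu$. *)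

theory Defs
  imports Main "Jordan_Normal_Form.Determinant"
begin

text \<open>Polynomials in the commuting indeterminates are modelled by the polynomial
  functions they induce; since K has characteristic 0 (hence is infinite) this
  identification is faithful.  Variables of K[T_p]: triples (k,i,j) standing for t^(k)_ij.
  Matrices are functions nat => nat => K with indices 1..3 (entries outside are 0).\<close>

type_synonym 'k tpoint = "nat \<times> nat \<times> nat \<Rightarrow> 'k"
type_synonym 'k matfun = "'k tpoint \<Rightarrow> nat \<Rightarrow> nat \<Rightarrow> 'k"

definition gen_skew :: "nat \<Rightarrow> 'k::comm_ring_1 tpoint \<Rightarrow> nat \<Rightarrow> nat \<Rightarrow> 'k" where
  "gen_skew k x = (\<lambda>i j.
     if 1 \<le> i \<and> i < j \<and> j \<le> 3 then x (k, i, j)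
     else if 1 \<le> j \<and> j < i \<and> i \<le> 3 then - x (k, j, i)
     else 0)"

definition mat3_mult :: "(nat \<Rightarrow> nat \<Rightarrow> 'k::comm_ring_1) \<Rightarrow> (nat \<Rightarrow> nat \<Rightarrow> 'k) \<Rightarrow> nat \<Rightarrow> nat \<Rightarrow> 'k" where
  "mat3_mult A B = (\<lambda>i j. \<Sum>l\<in>{1..3}. A i l * B l j)"

definition mat3_one :: "nat \<Rightarrow> nat \<Rightarrow> 'k::comm_ring_1" where
  "mat3_one = (\<lambda>i j. if i = j \<and> 1 \<le> i \<and> i \<le> 3 then 1 else 0)"

inductive_set Fp :: "nat \<Rightarrow> ('k::field_char_0) matfun set" for p :: nat where
  one: "(\<lambda>x. mat3_one) \<in> Fp p"
| gen: "1 \<le> k \<Longrightarrow> k \<le> p \<Longrightarrow> (\<lambda>x. gen_skew k x) \<in> Fp p"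
| add: "F \<in> Fp p \<Longrightarrow> G \<in> Fp p \<Longrightarrow> (\<lambda>x i j. F x i j + G x i j) \<in> Fp p"
| smult: "F \<in> Fp p \<Longrightarrow> (\<lambda>x i j. c * F x i j) \<in> Fp p"
| mult: "F \<in> Fp p \<Longrightarrow> G \<in> Fp p \<Longrightarrow> (\<lambda>x. mat3_mult (F x) (G x)) \<in> Fp p"

definition GLp :: "nat \<Rightarrow> (nat \<Rightarrow> nat \<Rightarrow> 'k::field) set" where
  "GLp p = {g. \<exists>h.
     (\<forall>i\<in>{1..p}. \<forall>j\<in>{1..p}. (\<Sum>l\<in>{1..p}. g i l * h l j) = (if i = j then 1 else 0)) \<and>
     (\<forall>i\<in>{1..p}. \<forall>j\<in>{1..p}. (\<Sum>l\<in>{1..p}. h i l * g l j) = (if i = j then 1 else 0))}"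

text \<open>Action of g on K[T_p]: the algebra automorphism with
  g . t^(k)_ij = sum_l g_lk t^(l)_ij; on polynomial functions this is precomposition
  with the corresponding linear substitution; on matrices it acts entrywise.\<close>
definition act_T :: "nat \<Rightarrow> (nat \<Rightarrow> nat \<Rightarrow> 'k::comm_ring_1) \<Rightarrow> 'k tpoint \<Rightarrow> 'k tpoint" where
  "act_T p g x = (\<lambda>(k, i, j). if 1 \<le> k \<and> k \<le> p then (\<Sum>l\<in>{1..p}. g l k * x (l, i, j)) else x (k, i, j))"

definition gact_F :: "nat \<Rightarrow> (nat \<Rightarrow> nat \<Rightarrow> 'k::comm_ring_1) \<Rightarrow> 'k matfun \<Rightarrow> 'k matfun" where
  "gact_F p g F = (\<lambda>x. F (act_T p g x))"

text \<open>Model of the irreducible polynomial module W_p(nu), nu = (a,b,c) with a >= b >= c: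
  inside the polynomial functions in the entries y(l,j) (1<=l<=p, 1<=j<=3) of a generic
  p x 3 matrix, with GL_p acting by g . y(k,j) = sum_l g_lk y(l,j) (the same rule as on T_p),
  W_p(nu) is the K-span of the GL_p-orbit of the highest weight vector
  D_1^(a-b) D_2^(b-c) D_3^c, where D_r is the leading r x r minor.\<close>

type_synonym 'k ypoint = "nat \<times> nat \<Rightarrow> 'k"
type_synonym 'k yfun = "'k ypoint \<Rightarrow> 'k"

definition act_Y :: "nat \<Rightarrow> (nat \<Rightarrow> nat \<Rightarrow> 'k::comm_ring_1) \<Rightarrow> 'k ypoint \<Rightarrow> 'k ypoint" where
  "act_Y p g y = (\<lambda>(k, j). if 1 \<le> k \<and> k \<le> p then (\<Sum>l\<in>{1..p}. g l k * y (l, j)) else y (k, j))"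

definition gact_Y :: "nat \<Rightarrow> (nat \<Rightarrow> nat \<Rightarrow> 'k::comm_ring_1) \<Rightarrow> 'k yfun \<Rightarrow> 'k yfun" where
  "gact_Y p g f = (\<lambda>y. f (act_Y p g y))"

definition lead_minor :: "nat \<Rightarrow> 'k::comm_ring_1 ypoint \<Rightarrow> 'k" where
  "lead_minor r y = det (mat r r (\<lambda>(a, b). y (a + 1, b + 1)))"

definition hw_vec :: "nat \<times> nat \<times> nat \<Rightarrow> 'k::comm_ring_1 yfun" where
  "hw_vec \<nu> = (case \<nu> of (a, b, c) \<Rightarrow>
     (\<lambda>y. lead_minor 1 y ^ (a - b) * lead_minor 2 y ^ (b - c) * lead_minor 3 y ^ c))"

inductive_set kspan :: "('k::field) yfun set \<Rightarrow> 'k yfun set" for S where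
  zero: "(\<lambda>y. 0) \<in> kspan S"
| base: "f \<in> S \<Longrightarrow> f \<in> kspan S"
| add: "f \<in> kspan S \<Longrightarrow> g \<in> kspan S \<Longrightarrow> (\<lambda>y. f y + g y) \<in> kspan S"
| smult: "f \<in> kspan S \<Longrightarrow> (\<lambda>y. c * f y) \<in> kspan S"

definition Wp :: "nat \<Rightarrow> nat \<times> nat \<times> nat \<Rightarrow> ('k::field_char_0) yfun set" where
  "Wp p \<nu> = kspan {gact_Y p g (hw_vec \<nu>) | g. g \<in> GLp p}"

definition is_part3 :: "nat \<times> nat \<times> nat \<Rightarrow> bool" where
  "is_part3 \<nu> = (case \<nu> of (a, b, c) \<Rightarrow> a \<ge> b \<and> b \<ge> c)"

definition nparts :: "nat \<times> nat \<times> nat \<Rightarrow> nat" where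
  "nparts \<nu> = (case \<nu> of (a, b, c) \<Rightarrow> card {i\<in>{1,2,3::nat}. (if i = 1 then a else if i = 2 then b else c) \<noteq> 0})"

definition m_nu :: "nat \<times> nat \<times> nat \<Rightarrow> nat" where
  "m_nu \<nu> = (case \<nu> of (a, b, c) \<Rightarrow>
     if even a = even b \<and> even b = even c then
       (if a > b \<and> b > c then 3
        else if a = b \<and> b > c then 2
        else if a > b \<and> b = c then 2
        else 1)
     else if even a = even b then (if a > b then 2 else 1)
     else if even a = even c then 2
     else (if b > c then 2 else 1))"

definition mult_so3 :: "nat \<times> nat \<times> nat \<Rightarrow> nat" where
  "mult_so3 \<nu> = (case \<nu> of (a, b, c) \<Rightarrow>
     if even a \<and> a \<ge> 2 \<and> b = 0 \<and> c = 0 then 1 else m_nu \<nu>)"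

definition summand_ok :: "nat \<Rightarrow> (nat \<times> nat \<times> nat) \<times> nat \<Rightarrow> bool" where
  "summand_ok p key = (case key of (\<nu>, i) \<Rightarrow> is_part3 \<nu> \<and> nparts \<nu> \<le> p \<and> i < mult_so3 \<nu>)"

definition DSum :: "nat \<Rightarrow> ((nat \<times> nat \<times> nat) \<times> nat \<Rightarrow> ('k::field_char_0) yfun) set" where
  "DSum p = {\<Phi>. finite {key. \<Phi> key \<noteq> (\<lambda>y. 0)} \<and>
     (\<forall>key. if summand_ok p key then \<Phi> key \<in> Wp p (fst key) else \<Phi> key = (\<lambda>y. 0))}"

definition gact_D :: "nat \<Rightarrow> (nat \<Rightarrow> nat \<Rightarrow> 'k::comm_ring_1) \<Rightarrow>
    ((nat \<times> nat \<times> nat) \<times> nat \<Rightarrow> 'k yfun) \<Rightarrow> ((nat \<times> nat \<times> nat) \<times> nat \<Rightarrow> 'k yfun)" where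
  "gact_D p g \<Phi> = (\<lambda>key. gact_Y p g (\<Phi> key))"

definition GL_iso :: "nat \<Rightarrow> ('k::field_char_0 matfun \<Rightarrow> ((nat \<times> nat \<times> nat) \<times> nat \<Rightarrow> 'k yfun)) \<Rightarrow> bool" where
  "GL_iso p \<Psi> \<longleftrightarrow>
     bij_betw \<Psi> (Fp p) (DSum p) \<and>
     (\<forall>F\<in>Fp p. \<forall>G\<in>Fp p. \<Psi> (\<lambda>x i j. F x i j + G x i j) = (\<lambda>key y. \<Psi> F key y + \<Psi> G key y)) \<and>
     (\<forall>F\<in>Fp p. \<forall>c. \<Psi> (\<lambda>x i j. c * F x i j) = (\<lambda>key y. c * \<Psi> F key y)) \<and>
     (\<forall>g\<in>GLp p. \<forall>F\<in>Fp p. \<Psi> (gact_F p g F) = gact_D p g (\<Psi> F))"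

end

theory Submission
  imports Defs "HOL-Library.Function_Algebras" "HOL-Library.Product_Plus"
    "HOL-Computational_Algebra.Polynomial"
begin

text \<open>
Both sides are compared through their highest weight vectors. For every space of polynomial
functions stable under \<open>GL\<^sub>p\<close>, the Casimir operator shows that a submodule is generated by its
highest weight vectors and that the lowering operators produce no new ones; hence a
weight-preserving bijection between bases of highest weight vectors extends to an isomorphism.
On the direct sum these bases are given by the products of leading minors.

In \<open>\<F>\<^sub>p\<close> the generic skew-symmetric matrix \<open>t\<^sub>k\<close> is the matrix of the cross product with a generic vector
\<open>v\<^sub>k\<close>. Row operations move a generic point to \<open>(a, w \<times> a, w)\<close> with \<open>a = v\<^sub>1\<close> and \<open>w = v\<^sub>1 \<times> v\<^sub>2\<close>; in
this basis the elements of \<open>\<F>\<^sub>p\<close> become matrices of polynomials in \<open>a\<cdot>a\<close> and \<open>w\<cdot>w\<close>, so a highest weight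
vector is determined by its value at the standard basis. That value is a 3 by 3 matrix on which
sign changes of the basis vectors impose parity conditions, and equal parts of the partition
impose invariance under a quarter turn. The words in \<open>t\<^sub>1\<close>, \<open>[t\<^sub>1, t\<^sub>2]\<close> and \<open>[t\<^sub>1, t\<^sub>3]\<close> below realise
every value that survives.
\<close>

section \<open>Joint eigenspaces\<close>

text \<open>Everything about submodules rests on one inequality: among dominant weights the Casimir
  value grows strictly along the dominance order. A vector obtained by proper lowering keeps the
  Casimir value of its generator, which is too large for a highest weight vector of the lower
  weight. Non-negative weights make strings of lowering operators end.

  Equivariance is required for the group, while modules are compared over the Lie algebra. Every
  coefficient of the action of \<open>1 + t X\<close> is a fixed expression in the Lie algebra
  operators, so a linear map commuting with them commutes with \<open>GLp\<close>; conversely,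
  stability under \<open>1 + t E_ij\<close> for infinitely many \<open>t\<close> gives stability
  under \<open>E_ij\<close>.

  As the field may lack square roots, vectors cannot be normalised: rescaling the standard basis
  gives only squares for \<open>a\<cdot>a\<close> and \<open>w\<cdot>w\<close>. Infinitely many
  squares suffice for polynomial entries.

  The exception (2k,0,0) occurs because a vector of that weight only sees \<open>t_1\<close>, and
  the (1,1) entry of every positive power of \<open>t_1\<close> is zero at the standard basis. For
  \<open>p < 3\<close> a vector is regarded as an element of the algebra on three generators, so
  that it can be evaluated at a full basis.\<close>

context vector_space
begin

text \<open>If the index \<open>k1\<close> lies outside the wanted block,
  \<open>T i - lam k1 i\<close> kills its term, maps \<open>V\<close> to itself and multiplies the
  block by the nonzero scalar \<open>l0 i - lam k1 i\<close>. Induction on the number of unwanted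
  indices. The sum runs over indices, not vectors, so repeated or zero eigenvectors do no
  harm.\<close>

lemma eigen_sum_component:
  fixes T :: "'i \<Rightarrow> 'b \<Rightarrow> 'b" and lam :: "'x \<Rightarrow> 'i \<Rightarrow> 'a" and f :: "'x \<Rightarrow> 'b"
  assumes M: "subspace M"
    and Tadd: "\<And>i x y. i \<in> J \<Longrightarrow> x \<in> M \<Longrightarrow> y \<in> M \<Longrightarrow> T i (x + y) = T i x + T i y"
    and Tscale: "\<And>i c x. i \<in> J \<Longrightarrow> x \<in> M \<Longrightarrow> T i (c *s x) = c *s T i x"
    and V: "subspace V" "V \<subseteq> M" "\<And>i x. i \<in> J \<Longrightarrow> x \<in> V \<Longrightarrow> T i x \<in> V"
    and K: "finite K" "\<And>k. k \<in> K \<Longrightarrow> f k \<in> M"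
    and eig: "\<And>k i. k \<in> K \<Longrightarrow> i \<in> J \<Longrightarrow> T i (f k) = lam k i *s f k"
    and sum: "sum f K \<in> V"
  shows "(\<Sum>k | k \<in> K \<and> (\<forall>i\<in>J. lam k i = l0 i). f k) \<in> V"
  using K eig sum
proof (induction "card {k \<in> K. \<exists>i\<in>J. lam k i \<noteq> l0 i}" arbitrary: K f rule: less_induct)
  case less
  let ?bad = "{k \<in> K. \<exists>i\<in>J. lam k i \<noteq> l0 i}"
  have T0: "T i 0 = 0" if "i \<in> J" for i
    using Tscale[OF that subspace_0[OF M], of 0] by simp
  have Tsum: "T i (sum g A) = (\<Sum>k\<in>A. T i (g k))"
    if "i \<in> J" "finite A" "\<And>k. k \<in> A \<Longrightarrow> g k \<in> M" for i A and g :: "'x \<Rightarrow> 'b"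
    using that(2,3) by (induction A rule: finite_induct)
      (simp_all add: T0[OF that(1)] Tadd[OF that(1)] subspace_sum[OF M])
  show ?case
  proof (cases "?bad = {}")
    case True
    then have "{k. k \<in> K \<and> (\<forall>i\<in>J. lam k i = l0 i)} = K" by blast
    then show ?thesis using less.prems(4) by simp
  next
    case False
    then obtain k1 i where k1: "k1 \<in> K" "i \<in> J" "lam k1 i \<noteq> l0 i" by blast
    define K' where "K' = {k \<in> K. lam k i \<noteq> lam k1 i}"
    define g where "g k = (lam k i - lam k1 i) *s f k" for k
    have fK': "finite K'" using less.prems(1) by (simp add: K'_def)
    have gM: "g k \<in> M" if "k \<in> K'" for k
      using that less.prems(2) by (simp add: g_def K'_def subspace_scale[OF M])
    have geig: "T j (g k) = lam k j *s g k" if "k \<in> K'" "j \<in> J" for k j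
      using that less.prems(2,3)[of k] by (simp add: g_def K'_def Tscale mult.commute)
    have "sum g K' = sum g K"
      by (rule sum.mono_neutral_left) (use less.prems(1) in \<open>auto simp: K'_def g_def\<close>)
    also have "\<dots> = T i (sum f K) - lam k1 i *s sum f K"
      using less.prems(1-3) k1(2)
      by (simp add: Tsum g_def scale_left_diff_distrib sum_subtractf scale_sum_right)
    also have "\<dots> \<in> V"
      using V(3)[OF k1(2) less.prems(4)] less.prems(4) V(1) by (simp add: subspace_diff subspace_scale)
    finally have gV: "sum g K' \<in> V" .
    have "{k \<in> K'. \<exists>i\<in>J. lam k i \<noteq> l0 i} \<subset> ?bad"
      using k1 by (auto simp: K'_def)
    then have "card {k \<in> K'. \<exists>i\<in>J. lam k i \<noteq> l0 i} < card ?bad"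
      using less.prems(1) by (intro psubset_card_mono) auto
    from less.hyps[OF this fK' gM geig gV]
    have "(\<Sum>k | k \<in> K' \<and> (\<forall>i\<in>J. lam k i = l0 i). g k) \<in> V" .
    also have "{k. k \<in> K' \<and> (\<forall>i\<in>J. lam k i = l0 i)} = {k. k \<in> K \<and> (\<forall>i\<in>J. lam k i = l0 i)}"
      using k1 by (auto simp: K'_def)
    also have "(\<Sum>k | k \<in> K \<and> (\<forall>i\<in>J. lam k i = l0 i). g k)
        = (l0 i - lam k1 i) *s (\<Sum>k | k \<in> K \<and> (\<forall>i\<in>J. lam k i = l0 i). f k)"
      using k1 by (auto simp: g_def scale_sum_right intro!: sum.cong)
    finally have "inverse (l0 i - lam k1 i) *s ((l0 i - lam k1 i) *s
        (\<Sum>k | k \<in> K \<and> (\<forall>i\<in>J. lam k i = l0 i). f k)) \<in> V"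
      by (rule subspace_scale[OF V(1)])
    then show ?thesis using k1(3) by simp
  qed
qed

text \<open>Write \<open>x\<close> as a combination of \<open>A\<close> and project the relation
  \<open>- x + (combination) = 0\<close> to the block \<open>l0\<close>, taking \<open>{0}\<close>
  as the stable subspace. The index \<open>None\<close> carries \<open>- x\<close>, which lies in
  the block, and \<open>Some a\<close> carries the term of \<open>a\<close>.\<close>

lemma eigen_in_span:
  fixes T :: "'i \<Rightarrow> 'b \<Rightarrow> 'b"
  assumes M: "subspace M"
    and Tadd: "\<And>i x y. i \<in> J \<Longrightarrow> x \<in> M \<Longrightarrow> y \<in> M \<Longrightarrow> T i (x + y) = T i x + T i y"
    and Tscale: "\<And>i c x. i \<in> J \<Longrightarrow> x \<in> M \<Longrightarrow> T i (c *s x) = c *s T i x"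
    and A: "A \<subseteq> M" "\<And>a. a \<in> A \<Longrightarrow> \<exists>l. \<forall>i\<in>J. T i a = l i *s a"
    and x: "x \<in> span A" "\<And>i. i \<in> J \<Longrightarrow> T i x = l0 i *s x"
  shows "x \<in> span {a \<in> A. \<forall>i\<in>J. T i a = l0 i *s a}"
proof -
  from x(1) obtain t r where t: "finite t" "t \<subseteq> A" "x = (\<Sum>a\<in>t. r a *s a)"
    unfolding span_explicit by blast
  from A(2) obtain l where l: "\<And>a i. a \<in> A \<Longrightarrow> i \<in> J \<Longrightarrow> T i a = l a i *s a" by metis
  let ?f = "\<lambda>k. case k of None \<Rightarrow> - x | Some a \<Rightarrow> r a *s a"
  let ?lam = "\<lambda>k. case k of None \<Rightarrow> l0 | Some a \<Rightarrow> l a"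
  let ?K = "insert None (Some ` t)"
  have xM: "x \<in> M" using x(1) A(1) M span_minimal by blast
  have T0: "T i 0 = 0" if "i \<in> J" for i
    using Tscale[OF that subspace_0[OF M], of 0] by simp
  have split: "(\<Sum>k\<in>insert None (Some ` s). ?f k) = - x + (\<Sum>a\<in>s. r a *s a)" if "finite s" for s
    using that by (subst sum.insert) (auto simp: sum.reindex)
  have "(\<Sum>k | k \<in> ?K \<and> (\<forall>i\<in>J. ?lam k i = l0 i). ?f k) \<in> {0}"
  proof (rule eigen_sum_component[where T = T and J = J, OF M Tadd Tscale])
    show "sum ?f ?K \<in> {0}" using split[OF t(1)] t(3) by simp
    show "?f k \<in> M" if "k \<in> ?K" for k
      using that xM t(2) A(1) by (auto intro!: subspace_scale[OF M] subspace_neg[OF M])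
    show "T i (?f k) = ?lam k i *s ?f k" if "k \<in> ?K" "i \<in> J" for k i
    proof (cases k)
      case None
      have "T i (- x) = T i ((-1) *s x)" by simp
      also have "\<dots> = (-1) *s T i x" using Tscale[OF that(2) xM] .
      finally show ?thesis using x(2)[OF that(2)] None by simp
    next
      case (Some a)
      then have "a \<in> A" using that(1) t(2) by auto
      then show ?thesis using Some A(1) Tscale[OF that(2), of a] l[of a i] that(2)
        by (auto simp: mult.commute)
    qed
  qed (use t(1) T0 M subspace_0 in auto)
  moreover have "{k. k \<in> ?K \<and> (\<forall>i\<in>J. ?lam k i = l0 i)} = insert None (Some ` {a \<in> t. \<forall>i\<in>J. l a i = l0 i})"
    by auto
  ultimately have "x = (\<Sum>a\<in>{a \<in> t. \<forall>i\<in>J. l a i = l0 i}. r a *s a)"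
    using split[of "{a \<in> t. \<forall>i\<in>J. l a i = l0 i}"] t(1) by simp
  also have "\<dots> \<in> span {a \<in> A. \<forall>i\<in>J. T i a = l0 i *s a}"
    using t(2) l by (intro span_sum span_scale span_base) auto
  finally show ?thesis .
qed

text \<open>The eigenvectors \<open>A\<close> may lie outside \<open>V\<close>. The block of a
  combination belonging to the eigenvalues of one term \<open>a0\<close> is again in
  \<open>V\<close>, since \<open>V\<close> is stable; splitting it off leaves a shorter
  combination.\<close>

lemma stable_subspace_eigen_span:
  fixes T :: "'i \<Rightarrow> 'b \<Rightarrow> 'b"
  assumes M: "subspace M"
    and Tadd: "\<And>i x y. i \<in> J \<Longrightarrow> x \<in> M \<Longrightarrow> y \<in> M \<Longrightarrow> T i (x + y) = T i x + T i y"
    and Tscale: "\<And>i c x. i \<in> J \<Longrightarrow> x \<in> M \<Longrightarrow> T i (c *s x) = c *s T i x"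
    and A: "A \<subseteq> M" "\<And>a. a \<in> A \<Longrightarrow> \<forall>i\<in>J. T i a = l a i *s a"
    and V: "subspace V" "V \<subseteq> M" "\<And>i x. i \<in> J \<Longrightarrow> x \<in> V \<Longrightarrow> T i x \<in> V"
    and x: "x \<in> span A" "x \<in> V"
  shows "x \<in> span {v \<in> V. \<exists>a\<in>A. \<forall>i\<in>J. T i v = l a i *s v}"
proof -
  let ?B = "{v \<in> V. \<exists>a\<in>A. \<forall>i\<in>J. T i v = l a i *s v}"
  have Tsum: "T i (sum g S) = (\<Sum>k\<in>S. T i (g k))"
    if "i \<in> J" "finite S" "\<And>k. k \<in> S \<Longrightarrow> g k \<in> M" for i S and g :: "'b \<Rightarrow> 'b"
  proof -
    have T0: "T i 0 = 0" using Tscale[OF that(1) subspace_0[OF M], of 0] by simp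
    show ?thesis using that(2,3)
      by (induction S rule: finite_induct) (simp_all add: T0 Tadd[OF that(1)] subspace_sum[OF M])
  qed
  have "(\<Sum>a\<in>t. r a *s a) \<in> span ?B" if "finite t" "t \<subseteq> A" "(\<Sum>a\<in>t. r a *s a) \<in> V" for t r
    using that
  proof (induction "card t" arbitrary: t rule: less_induct)
    case less
    show ?case
    proof (cases "t = {}")
      case False
      then obtain a0 where a0: "a0 \<in> t" by blast
      define s where "s = {a. a \<in> t \<and> (\<forall>i\<in>J. l a i = l a0 i)}"
      have sV: "(\<Sum>a\<in>s. r a *s a) \<in> V" unfolding s_def
      proof (rule eigen_sum_component[where T = T and J = J and M = M, OF M Tadd Tscale V])
        show "T i (r k *s k) = l k i *s (r k *s k)" if "k \<in> t" "i \<in> J" for k i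
        proof -
          have k: "k \<in> A" using that less.prems(2) by blast
          have "T i (r k *s k) = r k *s T i k" using k A(1) by (intro Tscale[OF that(2)]) blast
          also have "T i k = l k i *s k" using A(2)[OF k] that(2) by blast
          finally show ?thesis by (simp only: scale_left_commute)
        qed
        show "r k *s k \<in> M" if "k \<in> t" for k
          using that less.prems(2) A(1) subspace_scale[OF M] by blast
      qed (use less.prems in auto)
      have st: "s \<subseteq> t" "a0 \<in> s" "finite s" using a0 less.prems(1) by (auto simp: s_def)
      have "T i (\<Sum>a\<in>s. r a *s a) = l a0 i *s (\<Sum>a\<in>s. r a *s a)" if i: "i \<in> J" for i
      proof -
        have "T i (\<Sum>a\<in>s. r a *s a) = (\<Sum>a\<in>s. T i (r a *s a))"
          using st less.prems(2) A(1) subspace_scale[OF M] by (intro Tsum[OF i]) blast+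
        also have "\<dots> = (\<Sum>a\<in>s. l a0 i *s (r a *s a))"
        proof (intro sum.cong refl)
          fix a assume a: "a \<in> s"
          then have "a \<in> A" using st less.prems(2) by blast
          then have "T i (r a *s a) = r a *s T i a" "T i a = l a i *s a"
            using A i Tscale[OF i] by blast+
          moreover have "l a i = l a0 i" using a i by (simp add: s_def)
          ultimately show "T i (r a *s a) = l a0 i *s (r a *s a)" by (simp only: scale_left_commute)
        qed
        finally show ?thesis by (simp add: scale_sum_right)
      qed
      then have 1: "(\<Sum>a\<in>s. r a *s a) \<in> span ?B"
        using sV a0 less.prems(2) by (intro span_base) auto
      have sp: "(\<Sum>a\<in>t. r a *s a) = (\<Sum>a\<in>t - s. r a *s a) + (\<Sum>a\<in>s. r a *s a)"
        using st less.prems(1) by (simp add: sum.subset_diff)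
      have "(\<Sum>a\<in>t - s. r a *s a) \<in> V"
        using subspace_diff[OF V(1) less.prems(3) sV] sp by simp
      moreover have "card (t - s) < card t"
        using st a0 less.prems(1) by (intro psubset_card_mono) blast+
      ultimately have "(\<Sum>a\<in>t - s. r a *s a) \<in> span ?B"
        using less.hyps[of "t - s"] less.prems(1,2) by (meson Diff_subset finite_Diff order_trans)
      then show ?thesis unfolding sp by (rule span_add[OF _ 1])
    qed (simp add: span_zero)
  qed
  moreover obtain t r where "finite t" "t \<subseteq> A" "x = (\<Sum>a\<in>t. r a *s a)"
    using x(1) unfolding span_explicit by blast
  ultimately show ?thesis using x(2) by blast
qed

end

section \<open>Weights and Casimir values\<close>

text \<open>The weight \<open>mu\<close> plus the root e_i - e_j, which is the weight of
  \<open>E i j v\<close>.\<close>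

definition shift_wt :: "(nat \<Rightarrow> int) \<Rightarrow> nat \<Rightarrow> nat \<Rightarrow> nat \<Rightarrow> int" where
  "shift_wt mu i j = (\<lambda>k. mu k + of_bool (k = i) - of_bool (k = j))"

definition dominant :: "nat \<Rightarrow> (nat \<Rightarrow> int) \<Rightarrow> bool" where
  "dominant p mu \<longleftrightarrow> (\<forall>i\<in>{1..p}. \<forall>j\<in>{1..p}. i < j \<longrightarrow> mu j \<le> mu i)"

text \<open>The dominance order: \<open>nu - mu\<close> is a non-negative combination of simple
  roots. Weights are functions on all naturals, but only their values on \<open>{1..p}\<close>
  count.\<close>

definition dle :: "nat \<Rightarrow> (nat \<Rightarrow> int) \<Rightarrow> (nat \<Rightarrow> int) \<Rightarrow> bool" where
  "dle p mu nu \<longleftrightarrow> (\<forall>k\<le>p. sum mu {1..k} \<le> sum nu {1..k}) \<and> sum mu {1..p} = sum nu {1..p}"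

definition dless :: "nat \<Rightarrow> (nat \<Rightarrow> int) \<Rightarrow> (nat \<Rightarrow> int) \<Rightarrow> bool" where
  "dless p mu nu \<longleftrightarrow> dle p mu nu \<and> (\<exists>i\<in>{1..p}. mu i \<noteq> nu i)"

text \<open>The eigenvalue of the sum of all \<open>E i j E j i\<close> on a highest weight vector:
  the diagonal terms give the squares, and each pair \<open>i < j\<close> contributes the commutator
  \<open>E i i - E j j\<close>.\<close>

definition casimir_value :: "nat \<Rightarrow> (nat \<Rightarrow> int) \<Rightarrow> int" where
  "casimir_value p mu = (\<Sum>i\<in>{1..p}. (mu i)^2) + (\<Sum>i\<in>{1..p}. \<Sum>j\<in>{1..p}. if i < j then mu i - mu j else 0)"

lemma dle_refl: "dle p mu mu"
  by (simp add: dle_def)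

lemma dle_trans: "dle p mu nu \<Longrightarrow> dle p nu rho \<Longrightarrow> dle p mu rho"
  unfolding dle_def by (rule conjI, meson order_trans, simp)

lemma dle_antisym:
  assumes "dle p mu nu" "dle p nu mu" "i \<in> {1..p}" shows "mu i = nu i"
proof -
  have eq: "sum mu {1..k} = sum nu {1..k}" if "k \<le> p" for k
    using assms(1,2) that unfolding dle_def by (simp add: order_antisym)
  obtain k where k: "i = Suc k" using assms(3) by (cases i) auto
  show ?thesis using eq[of "Suc k"] eq[of k] assms(3) k by simp
qed

lemma dless_iff: "dless p mu nu \<longleftrightarrow> dle p mu nu \<and> \<not> dle p nu mu"
proof -
  have "dle p nu mu" if "\<forall>i\<in>{1..p}. mu i = nu i"
  proof -
    have "sum mu {1..k} = sum nu {1..k}" if "k \<le> p" for k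
      using that \<open>\<forall>i\<in>{1..p}. mu i = nu i\<close> by (intro sum.cong) auto
    then show ?thesis by (simp add: dle_def)
  qed
  moreover have "\<forall>i\<in>{1..p}. mu i = nu i" if "dle p mu nu" "dle p nu mu"
    using dle_antisym[OF that] by blast
  ultimately show ?thesis unfolding dless_def by blast
qed

lemma dless_dle_trans: "dless p mu nu \<Longrightarrow> dle p nu rho \<Longrightarrow> dless p mu rho"
  unfolding dless_iff by (meson dle_trans)

lemma sum_shift_wt: "sum (shift_wt mu i j) {1..k}
    = sum mu {1..k} + of_bool (i \<in> {1..k}) - of_bool (j \<in> {1..k})"
  unfolding shift_wt_def by (simp add: sum.distrib sum_subtractf of_bool_def sum.delta')

lemma dless_shift_wt: "i \<in> {1..p} \<Longrightarrow> j \<in> {1..p} \<Longrightarrow> i < j \<Longrightarrow> dless p mu (shift_wt mu i j)"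
  unfolding dless_def dle_def sum_shift_wt
  by (intro conjI bexI[of _ i]) (simp_all add: shift_wt_def)

lemma shift_wt_dless: "i \<in> {1..p} \<Longrightarrow> j \<in> {1..p} \<Longrightarrow> j < i \<Longrightarrow> dless p (shift_wt mu i j) mu"
  unfolding dless_def dle_def sum_shift_wt
  by (intro conjI bexI[of _ i]) (simp_all add: shift_wt_def)

lemma abel_summation:
  fixes x z :: "nat \<Rightarrow> int"
  shows "(\<Sum>i\<in>{1..n}. x i * z i)
    = sum x {1..n} * z n + (\<Sum>k\<in>{1..<n}. sum x {1..k} * (z k - z (Suc k)))"
proof (induction n)
  case (Suc n)
  show ?case
  proof (cases "n = 0")
    case False
    then have "{1..<Suc n} = insert n {1..<n}" by auto
    then show ?thesis using Suc by (simp add: algebra_simps)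
  qed simp
qed simp

text \<open>The differences give \<open>mu i\<close> the coefficient (p - i) - (i - 1), so this is
  the pairing of mu with mu + 2 rho, where 2 rho has the entries p + 1 - 2 i.\<close>

lemma casimir_value_alt: "casimir_value p mu = (\<Sum>i\<in>{1..p}. mu i * (mu i + int p + 1 - 2 * int i))"
proof -
  have 1: "(\<Sum>j\<in>{1..p}. if i < j then mu i else 0) = (int p - int i) * mu i"
    if "i \<in> {1..p}" for i
  proof -
    have "(\<Sum>j\<in>{1..p}. if i < j then mu i else 0) = (\<Sum>j\<in>{i<..p}. mu i)"
      using that by (intro sum.mono_neutral_cong_right) auto
    then show ?thesis using that by (simp add: of_nat_diff)
  qed
  have 2: "(\<Sum>i\<in>{1..p}. if i < j then mu j else 0) = (int j - 1) * mu j"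
    if "j \<in> {1..p}" for j
  proof -
    have "(\<Sum>i\<in>{1..p}. if i < j then mu j else 0) = (\<Sum>i\<in>{1..<j}. mu j)"
      using that by (intro sum.mono_neutral_cong_right) auto
    then show ?thesis using that by (simp add: of_nat_diff)
  qed
  have "(\<Sum>i\<in>{1..p}. \<Sum>j\<in>{1..p}. if i < j then mu i - mu j else 0)
     = (\<Sum>i\<in>{1..p}. \<Sum>j\<in>{1..p}. (if i < j then mu i else 0) - (if i < j then mu j else 0))"
    by (intro sum.cong refl) auto
  also have "\<dots> = (\<Sum>i\<in>{1..p}. \<Sum>j\<in>{1..p}. if i < j then mu i else 0)
     - (\<Sum>j\<in>{1..p}. \<Sum>i\<in>{1..p}. if i < j then mu j else 0)"
    unfolding sum_subtractf by (subst (2) sum.swap) simp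
  also have "\<dots> = (\<Sum>i\<in>{1..p}. (int p - int i) * mu i) - (\<Sum>j\<in>{1..p}. (int j - 1) * mu j)"
    using 1 2 by simp
  finally show ?thesis unfolding casimir_value_def
    by (simp add: sum.distrib[symmetric] sum_subtractf[symmetric] algebra_simps power2_eq_square)
qed

text \<open>The difference is the pairing of nu - mu with nu + mu + 2 rho. After Abel summation the
  partial sums of nu - mu are non-negative and one is positive, while nu + mu + 2 rho strictly
  decreases because rho does.\<close>

lemma casimir_value_less:
  assumes "dless p mu nu" "dominant p mu" "dominant p nu"
  shows "casimir_value p mu < casimir_value p nu"
proof -
  define x where "x = (\<lambda>i. nu i - mu i)"
  define z where "z = (\<lambda>i. nu i + mu i + int p + 1 - 2 * int i)"
  have "casimir_value p nu - casimir_value p mu = (\<Sum>i\<in>{1..p}. x i * z i)"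
    unfolding casimir_value_alt sum_subtractf[symmetric] x_def z_def
    by (intro sum.cong refl) (simp add: algebra_simps)
  also have "\<dots> = (\<Sum>k\<in>{1..<p}. sum x {1..k} * (z k - z (Suc k)))"
    using assms(1) unfolding abel_summation
    by (simp add: dless_def dle_def x_def sum_subtractf)
  also have "\<dots> > 0"
  proof -
    have X: "sum x {1..k} \<ge> 0" if "k \<le> p" for k
      using assms(1) that by (simp add: dless_def dle_def x_def sum_subtractf)
    have Z: "z k - z (Suc k) > 0" if "k \<in> {1..<p}" for k
    proof -
      have "mu (Suc k) \<le> mu k" "nu (Suc k) \<le> nu k"
        using assms(2,3) that by (auto simp: dominant_def)
      then show ?thesis by (simp add: z_def)
    qed
    have "\<exists>k\<in>{1..<p}. sum x {1..k} \<noteq> 0"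
    proof (rule ccontr)
      assume "\<not> ?thesis"
      then have "sum x {1..k} = 0" if "k \<le> p" for k
        using that assms(1) by (cases "k = 0 \<or> k = p") (auto simp: dless_def dle_def x_def sum_subtractf)
      then have "dle p nu mu" by (simp add: dle_def x_def sum_subtractf)
      then show False using assms(1) unfolding dless_def by (metis dle_antisym)
    qed
    then obtain k where "k \<in> {1..<p}" "sum x {1..k} > 0" using X by (force simp: order.strict_iff_order)
    then show ?thesis using X Z
      by (intro sum_pos2[of _ k]) (auto intro!: mult_nonneg_nonneg less_imp_le[OF Z])
  qed
  finally show ?thesis by simp
qed

section \<open>Modules over the Lie algebra of matrices\<close>

text \<open>The bracket relations of gl_p on a carrier \<open>M\<close> inside a larger type. The
  last assumption says that \<open>M\<close> is spanned by weight vectors with non-negative integral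
  weights. It holds for polynomial functions and is what bounds weight strings in spaces of infinite
  dimension.\<close>

locale gl_space = vector_space scale
  for scale :: "'k::field_char_0 \<Rightarrow> 'v::ab_group_add \<Rightarrow> 'v" (infixr "*s" 75) +
  fixes p :: nat and E :: "nat \<Rightarrow> nat \<Rightarrow> 'v \<Rightarrow> 'v" and M :: "'v set"
  assumes subspace_M: "subspace M"
    and E_M: "i \<in> {1..p} \<Longrightarrow> j \<in> {1..p} \<Longrightarrow> x \<in> M \<Longrightarrow> E i j x \<in> M"
    and E_add: "i \<in> {1..p} \<Longrightarrow> j \<in> {1..p} \<Longrightarrow> x \<in> M \<Longrightarrow> y \<in> M \<Longrightarrow> E i j (x + y) = E i j x + E i j y"
    and E_scale: "i \<in> {1..p} \<Longrightarrow> j \<in> {1..p} \<Longrightarrow> x \<in> M \<Longrightarrow> E i j (c *s x) = c *s E i j x"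
    and E_comm: "i \<in> {1..p} \<Longrightarrow> j \<in> {1..p} \<Longrightarrow> k \<in> {1..p} \<Longrightarrow> l \<in> {1..p} \<Longrightarrow> x \<in> M \<Longrightarrow>
      E i j (E k l x) = E k l (E i j x) + (if j = k then E i l x else 0) - (if i = l then E k j x else 0)"
    and M_span: "M \<subseteq> span {v \<in> M. \<exists>mu. \<forall>i\<in>{1..p}. 0 \<le> mu i \<and> E i i v = of_int (mu i) *s v}"
begin

definition wt :: "(nat \<Rightarrow> int) \<Rightarrow> 'v \<Rightarrow> bool" where
  "wt mu v \<longleftrightarrow> v \<in> M \<and> (\<forall>i\<in>{1..p}. E i i v = of_int (mu i) *s v)"

definition hw :: "(nat \<Rightarrow> int) \<Rightarrow> 'v \<Rightarrow> bool" where
  "hw mu v \<longleftrightarrow> wt mu v \<and> (\<forall>i\<in>{1..p}. \<forall>j\<in>{1..p}. i < j \<longrightarrow> E i j v = 0)"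

definition submod :: "'v set \<Rightarrow> bool" where
  "submod N \<longleftrightarrow> subspace N \<and> N \<subseteq> M \<and> (\<forall>i\<in>{1..p}. \<forall>j\<in>{1..p}. \<forall>x\<in>N. E i j x \<in> N)"

definition Casimir :: "'v \<Rightarrow> 'v" where
  "Casimir x = (\<Sum>i\<in>{1..p}. \<Sum>j\<in>{1..p}. E i j (E j i x))"

text \<open>Closed under the lowering operators only. For highest weight generators this is already
  the generated submodule, as in the triangular decomposition of the enveloping algebra.\<close>

inductive_set low :: "'v set \<Rightarrow> 'v set" for S where
  low_zero: "0 \<in> low S"
| low_base: "x \<in> S \<Longrightarrow> x \<in> low S"
| low_add: "x \<in> low S \<Longrightarrow> y \<in> low S \<Longrightarrow> x + y \<in> low S"
| low_scale: "x \<in> low S \<Longrightarrow> c *s x \<in> low S"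
| low_lower: "i \<in> {1..p} \<Longrightarrow> j \<in> {1..p} \<Longrightarrow> j < i \<Longrightarrow> x \<in> low S \<Longrightarrow> E i j x \<in> low S"

lemma E_zero: "i \<in> {1..p} \<Longrightarrow> j \<in> {1..p} \<Longrightarrow> E i j 0 = 0"
  using E_scale[of i j 0 0] subspace_0[OF subspace_M] by simp

lemma E_diff: "i \<in> {1..p} \<Longrightarrow> j \<in> {1..p} \<Longrightarrow> x \<in> M \<Longrightarrow> y \<in> M \<Longrightarrow> E i j (x - y) = E i j x - E i j y"
  using E_add[of i j "x - y" y] subspace_diff[OF subspace_M] by (simp add: algebra_simps)

lemma E_sum:
  assumes "i \<in> {1..p}" "j \<in> {1..p}" "finite A" "\<And>a. a \<in> A \<Longrightarrow> f a \<in> M"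
  shows "E i j (sum f A) = (\<Sum>a\<in>A. E i j (f a))"
  using assms(3,4)
proof (induction A rule: finite_induct)
  case (insert a A)
  then show ?case using subspace_sum[OF subspace_M, of A f] assms(1,2) by (simp add: E_add)
qed (use E_zero[OF assms(1,2)] in simp)

lemma submod_M: "submod M"
  using subspace_M E_M by (simp add: submod_def)

lemma submod_zero: "submod {0}"
  using subspace_0[OF subspace_M] by (auto simp: submod_def E_zero)

lemma gsubD:
  assumes "submod N"
  shows "subspace N" "N \<subseteq> M" "i \<in> {1..p} \<Longrightarrow> j \<in> {1..p} \<Longrightarrow> x \<in> N \<Longrightarrow> E i j x \<in> N"
  using assms by (auto simp: submod_def)

lemma wtD:
  assumes "wt mu v"
  shows "v \<in> M" "i \<in> {1..p} \<Longrightarrow> E i i v = of_int (mu i) *s v"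
  using assms by (auto simp: wt_def)

lemma hwD:
  assumes "hw mu v"
  shows "wt mu v" "v \<in> M" "i \<in> {1..p} \<Longrightarrow> E i i v = of_int (mu i) *s v"
    "i \<in> {1..p} \<Longrightarrow> j \<in> {1..p} \<Longrightarrow> i < j \<Longrightarrow> E i j v = 0"
  using assms by (auto simp: hw_def wt_def)

lemma wt_E:
  assumes "wt mu v" "i \<in> {1..p}" "j \<in> {1..p}"
  shows "wt (shift_wt mu i j) (E i j v)"
  unfolding wt_def
proof (intro conjI ballI)
  show "E i j v \<in> M" using assms by (simp add: E_M wtD)
  fix k assume k: "k \<in> {1..p}"
  have "E k k (E i j v) = E i j (E k k v) + (if k = i then E k j v else 0) - (if k = j then E i k v else 0)"
    using assms k by (intro E_comm) (auto simp: wtD)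
  also have "E i j (E k k v) = of_int (mu k) *s E i j v"
    using assms k by (simp add: wtD E_scale)
  finally show "E k k (E i j v) = of_int (shift_wt mu i j k) *s E i j v"
    by (auto simp: shift_wt_def scale_left_distrib scale_left_diff_distrib)
qed

text \<open>A nonzero weight vector lies in the span of those generators from \<open>M_span\<close>
  that share its eigenvalues, so one of them is nonzero and lends its non-negative weight.\<close>

lemma wt_nonneg:
  assumes "wt mu v" "v \<noteq> 0" "i \<in> {1..p}"
  shows "0 \<le> mu i"
proof -
  let ?A = "{v \<in> M. \<exists>mu. \<forall>i\<in>{1..p}. 0 \<le> mu i \<and> E i i v = of_int (mu i) *s v}"
  let ?B = "{a \<in> ?A. \<forall>i\<in>{1..p}. E i i a = of_int (mu i) *s a}"
  have v: "v \<in> span ?B"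
  proof (rule eigen_in_span[where T = "\<lambda>i. E i i" and J = "{1..p}" and M = M])
    fix a assume "a \<in> ?A"
    then obtain m where "\<forall>i\<in>{1..p}. E i i a = of_int (m i) *s a" by blast
    then show "\<exists>l. \<forall>i\<in>{1..p}. E i i a = l i *s a" by (intro exI[of _ "\<lambda>i. of_int (m i)"])
  qed (use assms(1) M_span subspace_M E_add E_scale wtD in auto)
  have "\<exists>a\<in>?B. a \<noteq> 0"
  proof (rule ccontr)
    assume "\<not> ?thesis"
    then have "?B \<subseteq> {0}" by blast
    then have "span ?B \<subseteq> {0}" by (rule span_minimal) simp
    then show False using v assms(2) by blast
  qed
  then obtain a m where a: "a \<noteq> 0" "E i i a = of_int (mu i) *s a" "0 \<le> m i" "E i i a = of_int (m i) *s a"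
    using assms(3) by blast
  then have "of_int (mu i) = (of_int (m i) :: 'k)" by (metis scale_right_imp_eq)
  then show ?thesis using a(3) by simp
qed

lemma subspace_wt: "subspace {v. wt mu v}"
  using subspace_M unfolding subspace_def wt_def
  by (simp add: E_add E_scale E_zero scale_right_distrib scale_left_commute)

lemma E_span:
  assumes "A \<subseteq> M" "\<And>a. a \<in> A \<Longrightarrow> E i j a \<in> span B" "i \<in> {1..p}" "j \<in> {1..p}" "x \<in> span A"
  shows "E i j x \<in> span B"
proof -
  have "subspace {x \<in> M. E i j x \<in> span B}"
    using subspace_M assms(3,4) unfolding subspace_def
    by (simp add: E_add E_scale E_zero span_zero span_add span_scale)
  then have "span A \<subseteq> {x \<in> M. E i j x \<in> span B}"
    using assms by (intro span_minimal) auto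
  then show ?thesis using assms(5) by blast
qed

section \<open>The Casimir operator and the \<open>sl_2\<close> argument\<close>

lemma Casimir_M: "x \<in> M \<Longrightarrow> Casimir x \<in> M"
  unfolding Casimir_def by (intro subspace_sum[OF subspace_M] E_M) auto

lemma Casimir_add: "x \<in> M \<Longrightarrow> y \<in> M \<Longrightarrow> Casimir (x + y) = Casimir x + Casimir y"
  unfolding Casimir_def sum.distrib[symmetric] by (intro sum.cong refl) (simp add: E_add E_M)

lemma Casimir_scale: "x \<in> M \<Longrightarrow> Casimir (c *s x) = c *s Casimir x"
  unfolding Casimir_def scale_sum_right by (intro sum.cong refl) (simp add: E_scale E_M)

text \<open>Commuting \<open>E k l\<close> past \<open>E i j E j i\<close> leaves four correction
  terms; summed over \<open>i\<close> and \<open>j\<close> they cancel in pairs.\<close>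

lemma Casimir_E:
  assumes "x \<in> M" "k \<in> {1..p}" "l \<in> {1..p}"
  shows "Casimir (E k l x) = E k l (Casimir x)"
proof -
  have *: "E i j (E j i (E k l x)) = E k l (E i j (E j i x))
      + (if j = k then E i l (E j i x) else 0) - (if i = l then E k j (E j i x) else 0)
      + (if i = k then E i j (E j l x) else 0) - (if j = l then E i j (E k i x) else 0)"
    if ij: "i \<in> {1..p}" "j \<in> {1..p}" for i j
  proof -
    have "E j i (E k l x) = E k l (E j i x) + (if i = k then E j l x else 0) - (if j = l then E k i x else 0)"
      using assms ij by (intro E_comm)
    then have "E i j (E j i (E k l x)) = E i j (E k l (E j i x))
        + (if i = k then E i j (E j l x) else 0) - (if j = l then E i j (E k i x) else 0)"
      using assms ij by (simp add: E_add E_diff E_M E_zero subspace_add[OF subspace_M])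
    also have "E i j (E k l (E j i x)) = E k l (E i j (E j i x))
      + (if j = k then E i l (E j i x) else 0) - (if i = l then E k j (E j i x) else 0)"
      using assms ij by (intro E_comm) (auto simp: E_M)
    finally show ?thesis .
  qed
  have d: "(\<Sum>i\<in>{1..p}. \<Sum>j\<in>{1..p}. if j = k then f i j else 0) = (\<Sum>i\<in>{1..p}. f i k)"
    "(\<Sum>i\<in>{1..p}. \<Sum>j\<in>{1..p}. if i = k then f i j else 0) = (\<Sum>j\<in>{1..p}. f k j)"
    if "k \<in> {1..p}" for f :: "nat \<Rightarrow> nat \<Rightarrow> 'v" and k
  proof -
    have s: "(\<Sum>j\<in>{1..p}. if j = k then g j else 0) = g k" for g :: "nat \<Rightarrow> 'v"
      using that by (simp add: sum.delta)
    show "(\<Sum>i\<in>{1..p}. \<Sum>j\<in>{1..p}. if j = k then f i j else 0) = (\<Sum>i\<in>{1..p}. f i k)"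
      by (simp only: s)
    show "(\<Sum>i\<in>{1..p}. \<Sum>j\<in>{1..p}. if i = k then f i j else 0) = (\<Sum>j\<in>{1..p}. f k j)"
      by (subst sum.swap) (simp only: s)
  qed
  have "Casimir (E k l x) = (\<Sum>i\<in>{1..p}. \<Sum>j\<in>{1..p}. E k l (E i j (E j i x))
      + (if j = k then E i l (E j i x) else 0) - (if i = l then E k j (E j i x) else 0)
      + (if i = k then E i j (E j l x) else 0) - (if j = l then E i j (E k i x) else 0))"
    unfolding Casimir_def by (intro sum.cong refl *)
  also have "\<dots> = (\<Sum>i\<in>{1..p}. \<Sum>j\<in>{1..p}. E k l (E i j (E j i x)))"
    unfolding sum.distrib sum_subtractf d[OF assms(2)] d[OF assms(3)] by simp
  also have "\<dots> = E k l (Casimir x)"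
  proof -
    have "E k l (Casimir x) = (\<Sum>i\<in>{1..p}. E k l (\<Sum>j\<in>{1..p}. E i j (E j i x)))"
      unfolding Casimir_def using assms
      by (intro E_sum subspace_sum[OF subspace_M] E_M) auto
    also have "\<dots> = (\<Sum>i\<in>{1..p}. \<Sum>j\<in>{1..p}. E k l (E i j (E j i x)))"
      using assms by (intro sum.cong refl E_sum E_M) auto
    finally show ?thesis by simp
  qed
  finally show ?thesis .
qed

text \<open>Highest weight vectors act as eigenvectors because \<open>E i j E j i\<close> is
  \<open>E j i E i j + E i i - E j j\<close> for \<open>i < j\<close>. Stated modulo a submodule,
  since it is applied to vectors that are annihilated by raising operators only modulo
  \<open>V\<close>.\<close>

lemma Casimir_wt_mod:
  assumes V: "submod V" and v: "wt mu v"
    and up: "\<And>i j. i \<in> {1..p} \<Longrightarrow> j \<in> {1..p} \<Longrightarrow> i < j \<Longrightarrow> E i j v \<in> V"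
  shows "Casimir v - of_int (casimir_value p mu) *s v \<in> V"
proof -
  note VS = gsubD[OF V]
  have vM: "v \<in> M" using v by (simp add: wtD)
  \<comment> \<open>The scalar by which \<open>E i j E j i\<close> acts on \<open>v\<close> modulo
    \<open>V\<close>.\<close>
  define d where "d i j = (if i = j then (mu i)^2 else if i < j then mu i - mu j else 0)" for i j
  have *: "E i j (E j i v) - of_int (d i j) *s v \<in> V" if ij: "i \<in> {1..p}" "j \<in> {1..p}" for i j
  proof -
    consider "i = j" | "i < j" | "j < i" by linarith
    then show ?thesis
    proof cases
      case 1
      then show ?thesis using v ij vM
        by (simp add: d_def wtD E_scale power2_eq_square subspace_0[OF VS(1)])
    next
      case 2
      have "E i j (E j i v) = E j i (E i j v) + (if j = j then E i i v else 0) - (if i = i then E j j v else 0)"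
        using ij vM by (intro E_comm)
      then have "E i j (E j i v) - of_int (d i j) *s v = E j i (E i j v)"
        using 2 v ij by (simp add: d_def wtD scale_left_diff_distrib)
      then show ?thesis using VS(3) up 2 ij by simp
    next
      case 3
      then show ?thesis using VS(3) up ij by (simp add: d_def)
    qed
  qed
  have "casimir_value p mu = (\<Sum>i\<in>{1..p}. \<Sum>j\<in>{1..p}. d i j)"
  proof -
    have "(\<Sum>j\<in>{1..p}. d i j) = (mu i)^2 + (\<Sum>j\<in>{1..p}. if i < j then mu i - mu j else 0)"
      if "i \<in> {1..p}" for i
    proof -
      have "(\<Sum>j\<in>{1..p}. d i j)
        = (\<Sum>j\<in>{1..p}. (if j = i then (mu i)^2 else 0) + (if i < j then mu i - mu j else 0))"
        by (intro sum.cong) (auto simp: d_def)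
      then show ?thesis using that by (simp add: sum.distrib sum.delta)
    qed
    then show ?thesis by (simp add: casimir_value_def sum.distrib)
  qed
  then have "Casimir v - of_int (casimir_value p mu) *s v
      = (\<Sum>i\<in>{1..p}. \<Sum>j\<in>{1..p}. E i j (E j i v) - of_int (d i j) *s v)"
    by (simp add: Casimir_def sum_subtractf of_int_sum scale_sum_left)
  also have "\<dots> \<in> V" by (intro subspace_sum[OF VS(1)] *)
  finally show ?thesis .
qed

lemma Casimir_hw:
  assumes "hw mu v" shows "Casimir v = of_int (casimir_value p mu) *s v"
  using Casimir_wt_mod[OF submod_zero, of mu v] assms by (auto simp: hw_def)

text \<open>The \<open>sl\<^sub>2\<close> fact behind dominance of highest weights, in a form that applies modulo a submodule.\<close>

lemma nondominant_mem:
  assumes V: "submod V" and v: "wt mu v" and ij: "i \<in> {1..p}" "j \<in> {1..p}" "i \<noteq> j"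
    and up: "E i j v \<in> V" and neg: "mu i < mu j"
  shows "v \<in> V"
proof -
  note VS = gsubD[OF V]
  define F where "F k = (E j i ^^ k) v" for k
  have F_Suc: "F (Suc k) = E j i (F k)" for k by (simp add: F_def)
  define m where "m k = (\<lambda>l. mu l + (if l = j then int k else 0) - (if l = i then int k else 0))" for k
  have wtF: "wt (m k) (F k)" for k
  proof (induction k)
    case 0
    have "m 0 = mu" by (auto simp: m_def)
    then show ?case using v by (simp add: F_def)
  next
    case (Suc k)
    have "shift_wt (m k) j i = m (Suc k)" by (auto simp: m_def shift_wt_def)
    then show ?case using wt_E[OF Suc ij(2,1)] by (simp add: F_Suc)
  qed
  have FM: "F k \<in> M" for k by (rule wtD(1)[OF wtF])
  \<comment> \<open>The \<open>sl_2\<close> string coefficient: modulo \<open>V\<close>,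
    \<open>E i j\<close> sends \<open>F (k + 1)\<close> to \<open>c k\<close> times
    \<open>F k\<close>. As \<open>mu i < mu j\<close>, it never vanishes, so membership in
    \<open>V\<close> descends along the string.\<close>
  define c where "c k = (int k + 1) * (mu i - mu j - int k)" for k
  have step: "E i j (F (Suc k)) - of_int (c k) *s F k \<in> V" for k
  proof (induction k)
    case 0
    have "E i j (E j i v) = E j i (E i j v) + (if j = j then E i i v else 0) - (if i = i then E j j v else 0)"
      using ij v by (intro E_comm) (auto simp: wtD)
    then have "E i j (E j i v) - of_int (c 0) *s v = E j i (E i j v)"
      using v ij by (simp add: c_def wtD scale_left_diff_distrib)
    then show ?case using up VS(3) ij by (simp add: F_def)
  next
    case (Suc k)
    have e: "E i j (E j i (F (Suc k))) = E j i (E i j (F (Suc k)))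
        + (if j = j then E i i (F (Suc k)) else 0) - (if i = i then E j j (F (Suc k)) else 0)"
      using ij FM by (intro E_comm)
    have "E j i (E i j (F (Suc k)) - of_int (c k) *s F k) \<in> V"
      using Suc VS(3) ij by blast
    also have "E j i (E i j (F (Suc k)) - of_int (c k) *s F k) = E j i (E i j (F (Suc k))) - of_int (c k) *s F (Suc k)"
      using ij FM by (simp add: E_diff E_M E_scale subspace_scale[OF subspace_M] F_Suc)
    also have "\<dots> = E i j (F (Suc (Suc k))) - of_int (c (Suc k)) *s F (Suc k)"
    proof -
      have "E i i (F (Suc k)) - E j j (F (Suc k)) = of_int (m (Suc k) i - m (Suc k) j) *s F (Suc k)"
        using wtF[of "Suc k"] ij by (simp only: wtD(2)[OF wtF] of_int_diff scale_left_diff_distrib)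
      then have "E i j (E j i (F (Suc k))) = E j i (E i j (F (Suc k)))
          + of_int (m (Suc k) i - m (Suc k) j) *s F (Suc k)"
        using e by (simp only: refl if_True add_diff_eq[symmetric])
      moreover have "c (Suc k) = c k + (m (Suc k) i - m (Suc k) j)"
        using ij(3) by (simp add: c_def m_def algebra_simps)
      ultimately show ?thesis
        by (simp only: F_Suc[of "Suc k"] of_int_add scale_left_distrib) simp
    qed
    finally show ?case .
  qed
  have down: "F k \<in> V" if "F (Suc k) \<in> V" for k
  proof -
    have "E i j (F (Suc k)) \<in> V" using that VS(3) ij by blast
    then have "of_int (c k) *s F k \<in> V"
      using subspace_diff[OF VS(1) _ step[of k]] by fastforce
    then have "inverse (of_int (c k)) *s (of_int (c k) *s F k) \<in> V"
      by (rule subspace_scale[OF VS(1)])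
    moreover have "c k \<noteq> 0" using neg by (simp add: c_def)
    then have "of_int (c k) \<noteq> (0::'k)" by (simp only: of_int_eq_0_iff not_False_eq_True)
    ultimately show ?thesis by simp
  qed
  \<comment> \<open>One more lowering than \<open>mu i\<close> allows: entry \<open>i\<close> of the
    weight would be negative, hence \<open>F K\<close> is zero.\<close>
  define K where "K = Suc (nat (mu i))"
  have "F K = 0"
  proof (rule ccontr)
    assume "F K \<noteq> 0"
    then have "0 \<le> m K i" using wt_nonneg[OF wtF _ ij(1)] by blast
    then show False using ij(3) by (simp add: m_def K_def split: if_splits)
  qed
  then have "F K \<in> V" by (simp add: subspace_0[OF VS(1)])
  then have "F 0 \<in> V" by (induction K) (use down in auto)
  then show ?thesis by (simp add: F_def)
qed

lemma hw_dominant: "hw mu v \<Longrightarrow> v \<noteq> 0 \<Longrightarrow> dominant p mu"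
  unfolding dominant_def using nondominant_mem[OF submod_zero, of mu v]
  by (metis hwD(1,4) linorder_not_less nat_neq_iff singletonD singletonI)

section \<open>Submodules generated by highest weight vectors\<close>

lemma low_mono: "S \<subseteq> T \<Longrightarrow> low S \<subseteq> low T"
proof
  fix x assume "S \<subseteq> T" "x \<in> low S"
  from this(2,1) show "x \<in> low T" by (induction) (auto intro: low.intros)
qed

lemma low_minimal: "submod N \<Longrightarrow> S \<subseteq> N \<Longrightarrow> low S \<subseteq> N"
proof
  fix x assume N: "submod N" "S \<subseteq> N" and "x \<in> low S"
  from this(3) show "x \<in> N"
    by (induction) (use N gsubD[OF N(1)] in \<open>auto intro: subspace_0 subspace_add subspace_scale\<close>)
qed

lemma subspace_low: "subspace (low S)"
  unfolding subspace_def by (auto intro: low.intros)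

text \<open>Moving any \<open>E k l\<close> past a lowering operator produces, besides
  \<open>E i j (E k l x)\<close>, only images of the earlier vector \<open>x\<close> under other
  operators. The induction therefore treats all \<open>k\<close> and \<open>l\<close> at
  once.\<close>

lemma submod_low:
  assumes "\<And>s. s \<in> S \<Longrightarrow> \<exists>mu. hw mu s"
  shows "submod (low S)"
proof -
  have "S \<subseteq> M" using assms by (meson hwD(2) subsetI)
  then have LM: "low S \<subseteq> M" by (rule low_minimal[OF submod_M])
  have "\<forall>k\<in>{1..p}. \<forall>l\<in>{1..p}. E k l x \<in> low S" if "x \<in> low S" for x
    using that
  proof induction
    case (low_base x)
    show ?case
    proof (intro ballI)
      fix k l assume kl: "k \<in> {1..p}" "l \<in> {1..p}"
      obtain mu where "hw mu x" using assms low_base by blast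
      then consider "E k l x = 0" | "E k l x = of_int (mu k) *s x" | "l < k"
        using kl by (metis hwD(3,4) nat_neq_iff)
      then show "E k l x \<in> low S" using low_base kl by cases (auto intro: low.intros)
    qed
  next
    case (low_lower i j x)
    show ?case
    proof (intro ballI)
      fix k l assume kl: "k \<in> {1..p}" "l \<in> {1..p}"
      have "E k l (E i j x) = E i j (E k l x) + (if l = i then E k j x else 0) - (if k = j then E i l x else 0)"
        using low_lower kl LM by (intro E_comm) auto
      moreover have "E i j (E k l x) \<in> low S" using low_lower kl by (auto intro: low.intros)
      ultimately show "E k l (E i j x) \<in> low S" using low_lower kl
        by (auto intro!: subspace_add[OF subspace_low] subspace_diff[OF subspace_low] subspace_0[OF subspace_low])
    qed
  qed (use LM in \<open>auto simp: E_zero E_add E_scale subset_iff intro: low.intros\<close>)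
  then show ?thesis using LM subspace_low by (simp add: submod_def)
qed

text \<open>\<open>Casimir - c\<close> is invertible on such a span: on an eigenvector with value
  \<open>c'\<close> the inverse is division by \<open>c' - c\<close>.\<close>

lemma span_eigen_solve:
  assumes A: "A \<subseteq> M" "\<And>a. a \<in> A \<Longrightarrow> \<exists>c'. c' \<noteq> c \<and> Casimir a = c' *s a" and Y: "Y \<in> span A"
  shows "\<exists>y \<in> span A. Casimir y - c *s y = Y"
proof -
  have AM: "span A \<subseteq> M" by (rule span_minimal[OF A(1) subspace_M])
  define D where "D = {Y. \<exists>y \<in> span A. Casimir y - c *s y = Y}"
  have "subspace D" unfolding subspace_def
  proof (intro conjI ballI allI)
    show "0 \<in> D" unfolding D_def
      using Casimir_scale[OF subspace_0[OF subspace_M], of 0] by (auto intro!: bexI[of _ 0] simp: span_zero)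
    fix x y assume "x \<in> D" "y \<in> D"
    then obtain a b where ab: "a \<in> span A" "x = Casimir a - c *s a" "b \<in> span A" "y = Casimir b - c *s b"
      unfolding D_def by blast
    have "Casimir (a + b) = Casimir a + Casimir b" using ab AM by (intro Casimir_add) auto
    then show "x + y \<in> D" unfolding D_def using ab
      by (intro CollectI bexI[of _ "a + b"]) (auto simp: span_add scale_right_distrib)
  next
    fix r x assume "x \<in> D"
    then obtain a where a: "a \<in> span A" "x = Casimir a - c *s a" unfolding D_def by blast
    have "Casimir (r *s a) = r *s Casimir a" using a AM by (intro Casimir_scale) auto
    then show "r *s x \<in> D" unfolding D_def using a
      by (intro CollectI bexI[of _ "r *s a"]) (auto simp: span_scale scale_right_diff_distrib mult.commute)
  qed
  moreover have "A \<subseteq> D"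
  proof
    fix a assume a: "a \<in> A"
    then obtain c' where c': "c' \<noteq> c" "Casimir a = c' *s a" using A(2) by blast
    let ?y = "inverse (c' - c) *s a"
    have "Casimir ?y - c *s ?y = inverse (c' - c) *s (c' *s a) - c *s ?y"
      using a A(1) c' by (subst Casimir_scale) auto
    also have "\<dots> = (inverse (c' - c) * (c' - c)) *s a"
      by (simp only: scale_scale scale_left_diff_distrib[symmetric]) (simp add: algebra_simps)
    also have "\<dots> = a" using c' by simp
    finally show "a \<in> D" unfolding D_def
      using span_scale[OF span_base[OF a]] by (intro CollectI bexI[of _ ?y])
  qed
  ultimately have "span A \<subseteq> D" by (rule span_minimal[rotated])
  then show ?thesis using Y unfolding D_def by blast
qed

lemma span_eigen_inj:
  assumes A: "A \<subseteq> M" "\<And>a. a \<in> A \<Longrightarrow> \<exists>c'. c' \<noteq> c \<and> Casimir a = c' *s a"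
    and z: "z \<in> span A" "Casimir z = c *s z"
  shows "z = 0"
proof -
  have "z \<in> span {a \<in> A. \<forall>i\<in>{()}. Casimir a = c *s a}"
  proof (intro eigen_in_span[where M = M and T = "\<lambda>_. Casimir" and J = "{()}" and ?l0.0 = "\<lambda>_. c"])
    show "\<exists>l. \<forall>i\<in>{()}. Casimir a = l i *s a" if a: "a \<in> A" for a
    proof -
      obtain c' where "Casimir a = c' *s a" using A(2)[OF a] by blast
      then show ?thesis by (intro exI[of _ "\<lambda>_. c'"]) simp
    qed
  qed (use A(1) z in \<open>auto simp: subspace_M Casimir_add Casimir_scale\<close>)
  moreover have "{a \<in> A. \<forall>i\<in>{()}. Casimir a = c *s a} \<subseteq> {0}"
    using A(2) scale_right_imp_eq by (auto; metis)
  then have "span {a \<in> A. \<forall>i\<in>{()}. Casimir a = c *s a} \<subseteq> {0}"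
    by (rule span_minimal) simp
  ultimately show ?thesis by blast
qed

text \<open>The submodule \<open>L\<close> generated by highest weight vectors of larger weight contains all \<open>E i j v\<close> with
  \<open>i < j\<close>, and for dominant \<open>mu\<close> no Casimir eigenvalue on \<open>L\<close> equals that of \<open>mu\<close>. Solving for a correction in \<open>L\<close> turns
  \<open>v\<close> into a Casimir eigenvector, which is then a highest weight vector.\<close>

lemma weight_vector_generated:
  assumes N: "submod N" and v: "v \<in> N" "wt mu v"
  shows "v \<in> low {h \<in> N. \<exists>nu. dle p mu nu \<and> hw nu h}"
  using v
\<comment> \<open>Raising with \<open>i < j\<close> lowers this measure by \<open>j - i\<close>, and
  non-negative weights keep it non-negative, so raising must stop.\<close>
proof (induction "nat (\<Sum>i\<in>{1..p}. int i * mu i)" arbitrary: mu v rule: less_induct)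
  case less
  let ?L = "low {h \<in> N. \<exists>nu. dle p mu nu \<and> hw nu h}"
  note NS = gsubD[OF N]
  show ?case
  proof (cases "v = 0")
    case False
    have nonneg: "0 \<le> mu i" if "i \<in> {1..p}" for i
      using wt_nonneg[OF less.prems(2) False that] .
    define H where "H = {h \<in> N. \<exists>nu. dless p mu nu \<and> hw nu h}"
    define L where "L = low H"
    have gL: "submod L" unfolding L_def by (rule submod_low) (auto simp: H_def)
    note LS = gsubD[OF gL]
    have LN: "L \<subseteq> N" unfolding L_def by (rule low_minimal[OF N]) (auto simp: H_def)
    have Hsub: "L \<subseteq> ?L"
      unfolding L_def by (rule low_mono) (auto simp: H_def dless_def)
    have up: "E i j v \<in> L" if ij: "i \<in> {1..p}" "j \<in> {1..p}" "i < j" for i j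
    proof (cases "E i j v = 0")
      case False
      let ?mu = "shift_wt mu i j"
      have w: "wt ?mu (E i j v)" using wt_E[OF less.prems(2) ij(1,2)] .
      have nn: "0 \<le> ?mu k" if "k \<in> {1..p}" for k using wt_nonneg[OF w False that] .
      have "(\<Sum>k\<in>{1..p}. int k * ?mu k)
          = (\<Sum>k\<in>{1..p}. int k * mu k + (if k = i then int i else 0) - (if k = j then int j else 0))"
        by (intro sum.cong) (auto simp: shift_wt_def algebra_simps)
      also have "\<dots> = (\<Sum>k\<in>{1..p}. int k * mu k) + int i - int j"
        using ij by (simp add: sum.distrib sum_subtractf)
      finally have less1: "(\<Sum>k\<in>{1..p}. int k * ?mu k) < (\<Sum>k\<in>{1..p}. int k * mu k)"
        using ij by simp
      have "0 \<le> (\<Sum>k\<in>{1..p}. int k * ?mu k)" by (intro sum_nonneg mult_nonneg_nonneg nn) auto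
      then have "E i j v \<in> low {h \<in> N. \<exists>nu. dle p ?mu nu \<and> hw nu h}"
        using less1 less.hyps[OF _ NS(3)[OF ij(1,2) less.prems(1)] w] by simp
      also have "\<dots> \<subseteq> L" unfolding L_def
        by (rule low_mono) (use dless_dle_trans[OF dless_shift_wt[OF ij]] in \<open>auto simp: H_def\<close>)
      finally show ?thesis .
    qed (simp add: subspace_0[OF LS(1)])
    show ?thesis
    proof (cases "dominant p mu")
      case False
      then obtain i j where ij: "i \<in> {1..p}" "j \<in> {1..p}" "i < j" "mu i < mu j"
        unfolding dominant_def by (auto simp: not_le)
      \<comment> \<open>Modulo \<open>L\<close> the vector is annihilated by raising operators, so a
        weight that is not dominant forces it into \<open>L\<close>.\<close>
      have "v \<in> L" using nondominant_mem[OF gL less.prems(2) ij(1,2) _ up[OF ij(1-3)] ij(4)] ij(3) by simp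
      then show ?thesis using Hsub by blast
    next
      case dom: True
      define c where "c = (of_int (casimir_value p mu) :: 'k)"
      \<comment> \<open>Weight vectors of \<open>L\<close> on which the Casimir operator takes a
        value other than \<open>c\<close>. The set generates \<open>L\<close>: it contains the
        generators, by strictness of the Casimir inequality, and its span is stable since the
        Casimir operator commutes with every \<open>E i j\<close>.\<close>
      define A where "A = {y \<in> L. (\<exists>kap. wt kap y) \<and> (\<exists>c'. c' \<noteq> c \<and> Casimir y = c' *s y)}"
      have AM: "A \<subseteq> M" using LS(2) by (auto simp: A_def)
      have HA: "h \<in> span A" if h: "h \<in> H" for h
      proof (cases "h = 0")
        case False
        obtain nu where nu: "dless p mu nu" "hw nu h" using h by (auto simp: H_def)
        have "casimir_value p mu < casimir_value p nu" using casimir_value_less[OF nu(1) dom hw_dominant[OF nu(2) False]] .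
        then have "of_int (casimir_value p nu) \<noteq> c" by (simp add: c_def)
        moreover have "h \<in> L" unfolding L_def by (rule low_base[OF h])
        ultimately have "h \<in> A" unfolding A_def using nu(2) Casimir_hw[OF nu(2)] hwD(1) by blast
        then show ?thesis by (rule span_base)
      qed (simp add: span_zero)
      have EA: "E i j a \<in> span A" if "i \<in> {1..p}" "j \<in> {1..p}" and aA: "a \<in> A" for i j a
      proof -
        obtain kap c' where a: "wt kap a" "c' \<noteq> c" "Casimir a = c' *s a" "a \<in> L"
          using aA by (auto simp: A_def)
        have "Casimir (E i j a) = c' *s E i j a"
          using a that by (simp add: Casimir_E E_scale wtD(1)[OF a(1)])
        then have "E i j a \<in> A" unfolding A_def using wt_E[OF a(1) that(1,2)] LS(3)[OF that(1,2) a(4)] a(2) by blast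
        then show ?thesis by (rule span_base)
      qed
      have LA: "L \<subseteq> span A"
      proof
        fix x assume "x \<in> L"
        then show "x \<in> span A" unfolding L_def
          by induction (use HA EA in \<open>auto intro: span_zero span_add span_scale E_span[OF AM]\<close>)
      qed
      define Y where "Y = Casimir v - c *s v"
      have YL: "Y \<in> L" unfolding Y_def c_def by (rule Casimir_wt_mod[OF gL less.prems(2) up])
      \<comment> \<open>Restricting to weight \<open>mu\<close> before solving ensures that the
        correction \<open>y\<close> has weight \<open>mu\<close> too.\<close>
      define A' where "A' = {a \<in> A. \<forall>i\<in>{1..p}. E i i a = of_int (mu i) *s a}"
      have vM: "v \<in> M" using less.prems(2) by (rule wtD(1))
      have "Y \<in> span A'" unfolding A'_def
      proof (rule eigen_in_span[where M = M and T = "\<lambda>i. E i i" and J = "{1..p}"])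
        show "\<exists>l. \<forall>i\<in>{1..p}. E i i a = l i *s a" if "a \<in> A" for a
        proof -
          obtain kap where "wt kap a" using \<open>a \<in> A\<close> by (auto simp: A_def)
          then show ?thesis by (intro exI[of _ "\<lambda>i. of_int (kap i)"]) (auto simp: wtD)
        qed
        show "E i i Y = of_int (mu i) *s Y" if i: "i \<in> {1..p}" for i
          using i vM less.prems(2) unfolding Y_def
          by (simp add: E_diff Casimir_M subspace_scale[OF subspace_M] E_scale Casimir_E[symmetric] wtD
              Casimir_scale scale_right_diff_distrib mult.commute)
        show "Y \<in> span A" using YL LA by blast
      qed (use AM in \<open>auto simp: subspace_M E_add E_scale\<close>)
      then obtain y where y: "y \<in> span A'" "Casimir y - c *s y = Y"
        using span_eigen_solve[of A' c Y] AM unfolding A'_def A_def by blast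
      have "A' \<subseteq> {v. wt mu v}" using AM by (auto simp: A'_def wt_def)
      then have ywt: "wt mu y" using y(1) span_minimal[OF _ subspace_wt[of mu]] by blast
      have "A' \<subseteq> L" by (auto simp: A'_def A_def)
      then have yL: "y \<in> L" using y(1) span_minimal[OF _ LS(1)] by blast
      have yM: "y \<in> M" using yL LS(2) by blast
      define v' where "v' = v - y"
      have wv': "wt mu v'"
        using subspace_diff[OF subspace_wt[of mu], of v y] ywt less.prems(2) by (simp add: v'_def)
      have v'M: "v' \<in> M" using wv' by (rule wtD(1))
      have "Casimir v = Casimir (v' + y)" by (simp add: v'_def)
      also have "\<dots> = Casimir v' + Casimir y" by (rule Casimir_add[OF v'M yM])
      finally have Cv': "Casimir v' = c *s v'"
        using y(2) by (simp add: Y_def v'_def scale_right_diff_distrib algebra_simps)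
      \<comment> \<open>\<open>E i j v'\<close> lies in \<open>L\<close> and has Casimir value
        \<open>c\<close>, which no nonzero vector of \<open>L\<close> has.\<close>
      have "E i j v' = 0" if ij: "i \<in> {1..p}" "j \<in> {1..p}" "i < j" for i j
      proof (rule span_eigen_inj[of A c])
        have "E i j v' = E i j v - E i j y" unfolding v'_def using ij vM yM by (intro E_diff)
        then have "E i j v' \<in> L" using up[OF ij] LS(3)[OF ij(1,2) yL] subspace_diff[OF LS(1)] by simp
        then show "E i j v' \<in> span A" using LA by blast
        show "Casimir (E i j v') = c *s E i j v'"
          using ij v'M Cv' by (simp add: Casimir_E E_scale)
      qed (use AM in \<open>auto simp: A_def\<close>)
      then have "hw mu v'" using wv' by (simp add: hw_def)
      moreover have "v' \<in> N" using less.prems(1) yL LN subspace_diff[OF NS(1)] by (auto simp: v'_def)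
      ultimately have "v' \<in> ?L"
        using dle_refl by (intro low_base) blast
      then have "v' + y \<in> ?L"
        using Hsub yL by (intro low_add) auto
      then show ?thesis by (simp add: v'_def)
    qed
  qed (simp add: low_zero)
qed

text \<open>Stability gives \<open>N\<close> enough weight vectors of its own to span it, and each
  of them is generated inside \<open>N\<close>.\<close>

theorem generated_by_hw:
  assumes N: "submod N"
  shows "N \<subseteq> low {h \<in> N. \<exists>nu. hw nu h}"
proof
  fix x assume x: "x \<in> N"
  note NS = gsubD[OF N]
  define A where "A = {v. \<exists>mu. wt mu v}"
  have "\<exists>l. \<forall>a\<in>A. \<forall>i\<in>{1..p}. E i i a = of_int (l a i) *s a"
    unfolding A_def wt_def by (intro bchoice) blast
  then obtain l where l: "\<And>a i. a \<in> A \<Longrightarrow> i \<in> {1..p} \<Longrightarrow> E i i a = of_int (l a i) *s a" by blast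
  have "M \<subseteq> span A" by (rule order_trans[OF M_span span_mono]) (auto simp: A_def wt_def)
  then have "x \<in> span {v \<in> N. \<exists>a\<in>A. \<forall>i\<in>{1..p}. E i i v = of_int (l a i) *s v}"
  proof (intro stable_subspace_eigen_span[where M = M and T = "\<lambda>i. E i i" and J = "{1..p}"])
    show "A \<subseteq> M" by (auto simp: A_def wt_def)
    show "\<forall>i\<in>{1..p}. E i i a = of_int (l a i) *s a" if "a \<in> A" for a using l that by blast
    show "x \<in> span A" using x NS(2) \<open>M \<subseteq> span A\<close> by blast
  qed (use x NS subspace_M E_add E_scale in blast)+
  also have "\<dots> \<subseteq> low {h \<in> N. \<exists>nu. hw nu h}"
  proof (rule span_minimal[OF _ subspace_low], rule subsetI)
    fix v assume "v \<in> {v \<in> N. \<exists>a\<in>A. \<forall>i\<in>{1..p}. E i i v = of_int (l a i) *s v}"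
    then obtain mu where v: "v \<in> N" "wt mu v" using NS(2) unfolding wt_def by blast
    show "v \<in> low {h \<in> N. \<exists>nu. hw nu h}"
      by (rule subsetD[OF low_mono weight_vector_generated[OF N v]]) blast
  qed
  finally show "x \<in> low {h \<in> N. \<exists>nu. hw nu h}" .
qed

text \<open>A properly lowered vector has weight strictly below that of its generator but the same
  Casimir value. A nonzero highest weight vector of that lower weight has a strictly smaller Casimir
  value, so only undeformed generators can contribute to it.\<close>

theorem hw_in_low:
  assumes S: "\<And>s. s \<in> S \<Longrightarrow> \<exists>nu. hw nu s" and x: "x \<in> low S" "hw mu x"
  shows "x \<in> span S"
proof (cases "x = 0")
  case False
  \<comment> \<open>The properly lowered vectors: weight \<open>kap\<close> strictly below a
    dominant \<open>nu\<close>, Casimir value that of \<open>nu\<close>.\<close>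
  define B where "B = {y \<in> M. \<exists>nu kap. dominant p nu \<and> dless p kap nu \<and> wt kap y \<and> Casimir y = of_int (casimir_value p nu) *s y}"
  have SM: "S \<subseteq> M" using S by (meson hwD(2) subsetI)
  have SBM: "S \<union> B \<subseteq> M" using SM by (auto simp: B_def)
  have EB: "E i j a \<in> span (S \<union> B)" if ij: "i \<in> {1..p}" "j \<in> {1..p}" "j < i" and a: "a \<in> S \<union> B" for i j a
  proof (cases "a = 0")
    case False
    obtain nu kap where nk: "dominant p nu" "dle p kap nu" "wt kap a" "Casimir a = of_int (casimir_value p nu) *s a"
    proof (cases "a \<in> B")
      case False
      then obtain nu where "hw nu a" using a S by blast
      then show ?thesis using that hw_dominant[OF \<open>hw nu a\<close> \<open>a \<noteq> 0\<close>] dle_refl Casimir_hw hwD(1) by blast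
    qed (auto simp: B_def dless_def intro: that)
    have "dless p (shift_wt kap i j) nu" using shift_wt_dless[OF ij] nk(2) dless_dle_trans by blast
    moreover have "Casimir (E i j a) = of_int (casimir_value p nu) *s E i j a"
      using nk ij a SBM by (simp add: Casimir_E E_scale wtD(1)[OF nk(3)])
    ultimately have "E i j a \<in> B" unfolding B_def
      using nk(1) wt_E[OF nk(3) ij(1,2)] by (auto simp: wtD)
    then show ?thesis by (intro span_base) simp
  qed (use ij in \<open>simp add: E_zero span_zero\<close>)
  have "low S \<subseteq> span (S \<union> B)"
  proof
    fix y assume "y \<in> low S"
    then show "y \<in> span (S \<union> B)"
      by induction (auto intro: span_zero span_base span_add span_scale E_span[OF SBM EB])
  qed
  \<comment> \<open>Weight and Casimir value are read off together: index 0 is the Casimir operator,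
    the others are the diagonal operators.\<close>
  define T where "T i = (if i = 0 then Casimir else E i i)" for i
  define l0 where "l0 i = (if i = 0 then of_int (casimir_value p mu) else of_int (mu i) :: 'k)" for i
  have "x \<in> span {a \<in> S \<union> B. \<forall>i\<in>{0..p}. T i a = l0 i *s a}"
  proof (rule eigen_in_span[where M = M])
    show "\<exists>l. \<forall>i\<in>{0..p}. T i a = l i *s a" if a: "a \<in> S \<union> B" for a
    proof -
      obtain c kap where "Casimir a = c *s a" "wt kap a"
      proof (cases "a \<in> B")
        case False
        then obtain nu where "hw nu a" using a S by blast
        then show ?thesis using that Casimir_hw hwD(1) by metis
      qed (auto simp: B_def intro: that)
      then show ?thesis
        by (intro exI[of _ "\<lambda>i. if i = 0 then c else of_int (kap i)"]) (auto simp: T_def wtD)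
    qed
    show "x \<in> span (S \<union> B)" using x(1) \<open>low S \<subseteq> span (S \<union> B)\<close> by blast
    show "T i x = l0 i *s x" if "i \<in> {0..p}" for i
      using that x(2) by (auto simp: T_def l0_def Casimir_hw hwD)
  qed (use SBM in \<open>auto simp: subspace_M T_def E_add E_scale Casimir_add Casimir_scale\<close>)
  also have "\<dots> \<subseteq> span S"
  proof (rule span_minimal[OF _ subspace_span], rule subsetI)
    fix a assume "a \<in> {a \<in> S \<union> B. \<forall>i\<in>{0..p}. T i a = l0 i *s a}"
    then have a: "a \<in> S \<union> B" "\<And>i. i \<in> {0..p} \<Longrightarrow> T i a = l0 i *s a" by blast+
    show "a \<in> span S"
    proof (cases "a \<in> S \<or> a = 0")
      case False
      then obtain nu kap where nk: "dominant p nu" "dless p kap nu" "wt kap a" "Casimir a = of_int (casimir_value p nu) *s a"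
        using a by (auto simp: B_def)
      have "mu i = kap i" if "i \<in> {1..p}" for i
      proof -
        have "of_int (kap i) *s a = of_int (mu i) *s a"
          using a(2)[of i] nk(3) that by (simp add: T_def l0_def wtD)
        then have "(of_int (kap i) :: 'k) = of_int (mu i)" using False scale_right_imp_eq by blast
        then show ?thesis by simp
      qed
      moreover from this have "sum mu {1..k} = sum kap {1..k}" if "k \<le> p" for k
        using that by (intro sum.cong) auto
      ultimately have "dless p mu nu" using nk(2) by (simp add: dless_def dle_def)
      then have "casimir_value p mu < casimir_value p nu"
        using casimir_value_less nk(1) hw_dominant[OF x(2) \<open>x \<noteq> 0\<close>] by blast
      moreover have "of_int (casimir_value p nu) *s a = of_int (casimir_value p mu) *s a"
        using a(2)[of 0] nk(4) by (simp add: T_def l0_def)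
      then have "(of_int (casimir_value p nu) :: 'k) = of_int (casimir_value p mu)" using False scale_right_imp_eq by blast
      then have "casimir_value p nu = casimir_value p mu" by simp
      ultimately show ?thesis by simp
    qed (auto intro: span_base span_zero)
  qed
  finally show ?thesis .
qed (simp add: span_zero)

end

section \<open>Group action coefficients in terms of Lie algebra operators\<close>

definition mprod :: "nat \<Rightarrow> (nat \<Rightarrow> nat \<Rightarrow> 'k::comm_ring_1) \<Rightarrow> (nat \<Rightarrow> nat \<Rightarrow> 'k) \<Rightarrow> nat \<Rightarrow> nat \<Rightarrow> 'k" where
  "mprod p X Z = (\<lambda>i j. \<Sum>l\<in>{1..p}. X i l * Z l j)"

context gl_space
begin

definition lie_act :: "(nat \<Rightarrow> nat \<Rightarrow> 'k) \<Rightarrow> 'v \<Rightarrow> 'v" where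
  "lie_act Z x = (\<Sum>i\<in>{1..p}. \<Sum>j\<in>{1..p}. Z i j *s E i j x)"

text \<open>On polynomial functions \<open>cop X n\<close> will be the coefficient of \<open>t\<^sup>n\<close> in the action of
  \<open>1 + t X\<close>; the recursion expresses it through the Lie algebra operators alone.\<close>

primrec bop :: "(nat \<Rightarrow> nat \<Rightarrow> 'k) \<Rightarrow> nat \<Rightarrow> (nat \<Rightarrow> nat \<Rightarrow> 'k) \<Rightarrow> 'v \<Rightarrow> 'v" where
  "bop X 0 = (\<lambda>Z x. lie_act Z x)"
| "bop X (Suc n) = (\<lambda>Z x. inverse (of_nat (Suc n)) *s bop X n X (lie_act Z x) - bop X n (mprod p X Z) x)"

primrec cop :: "(nat \<Rightarrow> nat \<Rightarrow> 'k) \<Rightarrow> nat \<Rightarrow> 'v \<Rightarrow> 'v" where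
  "cop X 0 x = x"
| "cop X (Suc n) x = inverse (of_nat (Suc n)) *s bop X n X x"

lemma lie_act_mem: "submod N \<Longrightarrow> x \<in> N \<Longrightarrow> lie_act Z x \<in> N"
  unfolding lie_act_def by (intro subspace_sum[OF gsubD(1)] subspace_scale[OF gsubD(1)] gsubD(3))

lemma bop_mem: "submod N \<Longrightarrow> x \<in> N \<Longrightarrow> bop X n Z x \<in> N"
proof (induction n arbitrary: Z x)
  case (Suc n)
  then have "lie_act Z x \<in> N" using lie_act_mem by blast
  then show ?case using Suc
    by (auto intro!: subspace_diff[OF gsubD(1)] subspace_scale[OF gsubD(1)])
qed (simp add: lie_act_mem)

lemma cop_mem: "submod N \<Longrightarrow> x \<in> N \<Longrightarrow> cop X n x \<in> N"
  by (cases n) (auto intro: subspace_scale[OF gsubD(1)] bop_mem)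

lemma span_image_sum:
  assumes "x \<in> span (f ` I)"
  shows "\<exists>J c. finite J \<and> J \<subseteq> I \<and> x = (\<Sum>k\<in>J. c k *s f k)"
proof -
  obtain t r where t: "finite t" "t \<subseteq> f ` I" "x = (\<Sum>a\<in>t. r a *s a)"
    using assms unfolding span_explicit by blast
  then obtain J where J: "J \<subseteq> I" "inj_on f J" "t = f ` J" unfolding subset_image_inj by blast
  then have "x = (\<Sum>k\<in>J. r (f k) *s f k)" using t by (simp add: sum.reindex)
  then show ?thesis using t(1) J finite_imageD
    by (intro exI[of _ J] exI[of _ "\<lambda>k. r (f k)"]) blast
qed

lemma submod_Int: "submod N \<Longrightarrow> submod N' \<Longrightarrow> submod (N \<inter> N')"
  unfolding submod_def by (auto simp: subspace_inter)

text \<open>Generation by highest weight vectors turns questions about submodules into questions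
  about these vectors; injectivity of the isomorphism is checked in this form.\<close>

lemma submod_eq_zero:
  assumes "submod N" "\<And>mu h. h \<in> N \<Longrightarrow> hw mu h \<Longrightarrow> h = 0" "x \<in> N"
  shows "x = 0"
proof -
  have "low {h \<in> N. \<exists>nu. hw nu h} \<subseteq> {0}" using assms(2) by (intro low_minimal[OF submod_zero]) blast
  then show ?thesis using generated_by_hw[OF assms(1)] assms(3) by blast
qed

lemma submod_eq_M:
  assumes "submod N" "\<And>mu h. hw mu h \<Longrightarrow> h \<in> N"
  shows "N = M"
proof -
  have "low {h \<in> M. \<exists>nu. hw nu h} \<subseteq> N" using assms by (intro low_minimal) blast+
  then show ?thesis using generated_by_hw[OF submod_M] gsubD(2)[OF assms(1)] by blast
qed

end

section \<open>Isomorphisms from matching highest weight vectors\<close>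

locale gl_pair = A: gl_space s1 p E1 M1 + B: gl_space s2 p E2 M2
  for s1 :: "'k::field_char_0 \<Rightarrow> 'v::ab_group_add \<Rightarrow> 'v" and p E1 M1
    and s2 :: "'k \<Rightarrow> 'w::ab_group_add \<Rightarrow> 'w" and E2 M2
begin

definition sP :: "'k \<Rightarrow> 'v \<times> 'w \<Rightarrow> 'v \<times> 'w" where
  "sP c z = (s1 c (fst z), s2 c (snd z))"

definition EP :: "nat \<Rightarrow> nat \<Rightarrow> 'v \<times> 'w \<Rightarrow> 'v \<times> 'w" where
  "EP i j z = (E1 i j (fst z), E2 i j (snd z))"

sublocale VP: vector_space sP
  by unfold_locales (auto simp: sP_def A.scale_right_distrib B.scale_right_distrib
      A.scale_left_distrib B.scale_left_distrib)

lemma subspace_prod: "A.subspace S \<Longrightarrow> B.subspace T \<Longrightarrow> VP.subspace (S \<times> T)"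
  unfolding A.subspace_def B.subspace_def VP.subspace_def sP_def
  by (auto simp: zero_prod_def)

text \<open>The product satisfies the same axioms, so that the graph of an equivariant map can be
  treated as a submodule.\<close>

sublocale P: gl_space sP p EP "M1 \<times> M2"
proof unfold_locales
  show "VP.subspace (M1 \<times> M2)" by (rule subspace_prod[OF A.subspace_M B.subspace_M])
  let ?W1 = "{v \<in> M1. \<exists>mu. \<forall>i\<in>{1..p}. 0 \<le> mu i \<and> E1 i i v = s1 (of_int (mu i)) v}"
  let ?W2 = "{v \<in> M2. \<exists>mu. \<forall>i\<in>{1..p}. 0 \<le> mu i \<and> E2 i i v = s2 (of_int (mu i)) v}"
  let ?W = "{v \<in> M1 \<times> M2. \<exists>mu. \<forall>i\<in>{1..p}. 0 \<le> mu i \<and> EP i i v = sP (of_int (mu i)) v}"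
  have 1: "(x, 0) \<in> VP.span ?W" if "x \<in> M1" for x
  proof -
    let ?X = "{x. (x, 0) \<in> VP.span ?W}"
    have "A.subspace ?X"
      unfolding A.subspace_def
    proof (intro conjI ballI allI)
      show "0 \<in> ?X" using VP.span_zero[of ?W] by (simp add: zero_prod_def)
      show "x + y \<in> ?X" if "x \<in> ?X" "y \<in> ?X" for x y
        using VP.span_add[of "(x, 0)" ?W "(y, 0)"] that by simp
      show "s1 c x \<in> ?X" if "x \<in> ?X" for c x
        using VP.span_scale[of "(x, 0)" ?W c] that by (simp add: sP_def)
    qed
    moreover have "?W1 \<subseteq> ?X"
      using B.subspace_0[OF B.subspace_M] by (auto intro!: VP.span_base simp: EP_def sP_def B.E_zero)
    ultimately have "A.span ?W1 \<subseteq> ?X" by (rule A.span_minimal[rotated])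
    then show ?thesis using A.M_span that by blast
  qed
  have 2: "(0, x) \<in> VP.span ?W" if "x \<in> M2" for x
  proof -
    let ?Y = "{x. (0, x) \<in> VP.span ?W}"
    have "B.subspace ?Y"
      unfolding B.subspace_def
    proof (intro conjI ballI allI)
      show "0 \<in> ?Y" using VP.span_zero[of ?W] by (simp add: zero_prod_def)
      show "x + y \<in> ?Y" if "x \<in> ?Y" "y \<in> ?Y" for x y
        using VP.span_add[of "(0, x)" ?W "(0, y)"] that by simp
      show "s2 c x \<in> ?Y" if "x \<in> ?Y" for c x
        using VP.span_scale[of "(0, x)" ?W c] that by (simp add: sP_def)
    qed
    moreover have "?W2 \<subseteq> ?Y"
      using A.subspace_0[OF A.subspace_M] by (auto intro!: VP.span_base simp: EP_def sP_def A.E_zero)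
    ultimately have "B.span ?W2 \<subseteq> ?Y" by (rule B.span_minimal[rotated])
    then show ?thesis using B.M_span that by blast
  qed
  show "M1 \<times> M2 \<subseteq> VP.span ?W"
  proof
    fix z assume z: "z \<in> M1 \<times> M2"
    then have "(fst z, 0) + (0, snd z) \<in> VP.span ?W" by (intro VP.span_add 1 2) auto
    then show "z \<in> VP.span ?W" by simp
  qed
  fix i j k l :: nat and x y :: "'v \<times> 'w" and c
  assume ij: "i \<in> {1..p}" "j \<in> {1..p}" and x: "x \<in> M1 \<times> M2"
  show "EP i j x \<in> M1 \<times> M2" using ij x by (auto simp: EP_def A.E_M B.E_M)
  show "EP i j (sP c x) = sP c (EP i j x)" using ij x by (auto simp: EP_def sP_def A.E_scale B.E_scale)
  show "EP i j (x + y) = EP i j x + EP i j y" if "y \<in> M1 \<times> M2"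
    using ij x that by (auto simp: EP_def A.E_add B.E_add)
  show "EP i j (EP k l x) = EP k l (EP i j x) + (if j = k then EP i l x else 0) - (if i = l then EP k j x else 0)"
    if kl: "k \<in> {1..p}" "l \<in> {1..p}"
  proof -
    have "E1 i j (E1 k l (fst x)) = E1 k l (E1 i j (fst x))
        + (if j = k then E1 i l (fst x) else 0) - (if i = l then E1 k j (fst x) else 0)"
      using ij kl x by (intro A.E_comm) auto
    moreover have "E2 i j (E2 k l (snd x)) = E2 k l (E2 i j (snd x))
        + (if j = k then E2 i l (snd x) else 0) - (if i = l then E2 k j (snd x) else 0)"
      using ij kl x by (intro B.E_comm) auto
    ultimately show ?thesis by (simp add: EP_def prod_eq_iff)
  qed
qed

lemma submod_prod: "A.submod S \<Longrightarrow> B.submod T \<Longrightarrow> P.submod (S \<times> T)"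
  unfolding P.submod_def A.submod_def B.submod_def by (auto simp: subspace_prod EP_def)

lemma P_lie_act: "P.lie_act Z z = (A.lie_act Z (fst z), B.lie_act Z (snd z))"
  unfolding P.lie_act_def A.lie_act_def B.lie_act_def by (simp add: prod_eq_iff fst_sum snd_sum sP_def EP_def)

lemma P_bop: "P.bop X n Z z = (A.bop X n Z (fst z), B.bop X n Z (snd z))"
  by (induction n arbitrary: Z z) (simp_all add: P_lie_act sP_def)

lemma P_cop: "P.cop X n z = (A.cop X n (fst z), B.cop X n (snd z))"
  by (cases n) (simp_all add: P_bop sP_def)

lemma P_hw: "A.hw mu x \<Longrightarrow> B.hw mu y \<Longrightarrow> P.hw mu (x, y)"
  unfolding P.hw_def A.hw_def B.hw_def P.wt_def A.wt_def B.wt_def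
  by (simp add: EP_def sP_def zero_prod_def)

text \<open>The isomorphism is the submodule of the product generated by the pairs of matching highest
  weight vectors, read as a graph.\<close>

theorem iso_of_matching_hw:
  assumes a: "\<And>k. k \<in> I \<Longrightarrow> A.hw (w k) (a k)" and b: "\<And>k. k \<in> I \<Longrightarrow> B.hw (w k) (b k)"
    and inda: "\<And>J c. finite J \<Longrightarrow> J \<subseteq> I \<Longrightarrow> (\<Sum>k\<in>J. s1 (c k) (a k)) = 0 \<Longrightarrow> \<forall>k\<in>J. c k = 0"
    and indb: "\<And>J c. finite J \<Longrightarrow> J \<subseteq> I \<Longrightarrow> (\<Sum>k\<in>J. s2 (c k) (b k)) = 0 \<Longrightarrow> \<forall>k\<in>J. c k = 0"
    and spa: "\<And>mu x. A.hw mu x \<Longrightarrow> x \<in> A.span (a ` I)"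
    and spb: "\<And>mu x. B.hw mu x \<Longrightarrow> x \<in> B.span (b ` I)"
  shows "\<exists>\<Theta>. bij_betw \<Theta> M1 M2 \<and> (\<forall>x\<in>M1. \<forall>y\<in>M1. \<Theta> (x + y) = \<Theta> x + \<Theta> y)
    \<and> (\<forall>c. \<forall>x\<in>M1. \<Theta> (s1 c x) = s2 c (\<Theta> x)) \<and> (\<forall>X n. \<forall>x\<in>M1. \<Theta> (A.cop X n x) = B.cop X n (\<Theta> x))"
proof -
  define S where "S = (\<lambda>k. (a k, b k)) ` I"
  define G where "G = P.low S"
  have S: "\<exists>nu. P.hw nu s" if "s \<in> S" for s using that P_hw[OF a b] unfolding S_def by blast
  have gG: "P.submod G" unfolding G_def by (rule P.submod_low[OF S])
  note GS = P.gsubD[OF gG]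
  \<comment> \<open>Lowering creates no new highest weight vectors in the product either, hence both
    coordinates of such a vector of \<open>G\<close> have the same coefficients.\<close>
  have hwG: "\<exists>J c. finite J \<and> J \<subseteq> I \<and> fst h = (\<Sum>k\<in>J. s1 (c k) (a k)) \<and> snd h = (\<Sum>k\<in>J. s2 (c k) (b k))"
    if "h \<in> G" "P.hw mu h" for h mu
  proof -
    have "h \<in> VP.span S" by (rule P.hw_in_low[OF S that(1)[unfolded G_def] that(2)])
    from P.span_image_sum[OF this[unfolded S_def]]
    obtain J c where "finite J" "J \<subseteq> I" "h = (\<Sum>k\<in>J. sP (c k) (a k, b k))"
      by (elim exE conjE)
    then show ?thesis by (intro exI[of _ J] exI[of _ c]) (simp add: fst_sum snd_sum sP_def)
  qed
  \<comment> \<open>Equal coefficients and independence of the \<open>a k\<close> leave no nonzero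
    highest weight vector in \<open>G\<close> over first coordinate 0, so \<open>G\<close> is
    single-valued.\<close>
  have inj1: "z = 0" if z: "z \<in> G" "fst z = 0" for z
  proof (rule P.submod_eq_zero[of "G \<inter> {0} \<times> M2"])
    show "P.submod (G \<inter> {0} \<times> M2)"
      by (intro P.submod_Int gG submod_prod A.submod_zero B.submod_zero A.submod_M B.submod_M)
    show "z \<in> G \<inter> {0} \<times> M2" using z GS(2) by (cases z) auto
    fix mu h assume h: "h \<in> G \<inter> {0} \<times> M2" "P.hw mu h"
    then obtain J c where J: "finite J" "J \<subseteq> I" "fst h = (\<Sum>k\<in>J. s1 (c k) (a k))" "snd h = (\<Sum>k\<in>J. s2 (c k) (b k))"
      using hwG[of h mu] by blast
    then have "\<forall>k\<in>J. c k = 0" using inda[OF J(1,2)] h by auto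
    then show "h = 0" using J h by (simp add: prod_eq_iff)
  qed
  have inj2: "z = 0" if z: "z \<in> G" "snd z = 0" for z
  proof (rule P.submod_eq_zero[of "G \<inter> M1 \<times> {0}"])
    show "P.submod (G \<inter> M1 \<times> {0})"
      by (intro P.submod_Int gG submod_prod A.submod_zero B.submod_zero A.submod_M B.submod_M)
    show "z \<in> G \<inter> M1 \<times> {0}" using z GS(2) by (cases z) auto
    fix mu h assume h: "h \<in> G \<inter> M1 \<times> {0}" "P.hw mu h"
    then obtain J c where J: "finite J" "J \<subseteq> I" "fst h = (\<Sum>k\<in>J. s1 (c k) (a k))" "snd h = (\<Sum>k\<in>J. s2 (c k) (b k))"
      using hwG[of h mu] by blast
    then have "\<forall>k\<in>J. c k = 0" using indb[OF J(1,2)] h by auto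
    then show "h = 0" using J h by (simp add: prod_eq_iff)
  qed
  \<comment> \<open>The projection is a submodule containing every highest weight vector of
    \<open>M1\<close>, thus all of \<open>M1\<close>.\<close>
  have fstG: "fst ` G = M1"
  proof (rule A.submod_eq_M)
    show gf: "A.submod (fst ` G)"
      unfolding A.submod_def A.subspace_def
    proof (intro conjI ballI allI)
      show "0 \<in> fst ` G" using VP.subspace_0[OF GS(1)] by force
      show "fst ` G \<subseteq> M1" using GS(2) by auto
      show "x + y \<in> fst ` G" if "x \<in> fst ` G" "y \<in> fst ` G" for x y
        using that VP.subspace_add[OF GS(1)] by (metis (no_types, lifting) fst_add image_iff)
      show "s1 c x \<in> fst ` G" if "x \<in> fst ` G" for c x
        using that VP.subspace_scale[OF GS(1), of _ c] by (force simp: sP_def)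
      show "E1 i j x \<in> fst ` G" if "i \<in> {1..p}" "j \<in> {1..p}" "x \<in> fst ` G" for i j x
        using that(3) GS(3)[OF that(1,2)] by (force simp: EP_def)
    qed
    have "a ` I \<subseteq> fst ` G" unfolding G_def S_def by (force intro: P.low_base)
    then have "A.span (a ` I) \<subseteq> fst ` G" by (rule A.span_minimal[OF _ A.gsubD(1)[OF gf]])
    then show "h \<in> fst ` G" if "A.hw mu h" for mu h using spa[OF that] by blast
  qed
  have sndG: "snd ` G = M2"
  proof (rule B.submod_eq_M)
    show gf: "B.submod (snd ` G)"
      unfolding B.submod_def B.subspace_def
    proof (intro conjI ballI allI)
      show "0 \<in> snd ` G" using VP.subspace_0[OF GS(1)] by force
      show "snd ` G \<subseteq> M2" using GS(2) by auto
      show "x + y \<in> snd ` G" if "x \<in> snd ` G" "y \<in> snd ` G" for x y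
        using that VP.subspace_add[OF GS(1)] by (metis (no_types, lifting) snd_add image_iff)
      show "s2 c x \<in> snd ` G" if "x \<in> snd ` G" for c x
        using that VP.subspace_scale[OF GS(1), of _ c] by (force simp: sP_def)
      show "E2 i j x \<in> snd ` G" if "i \<in> {1..p}" "j \<in> {1..p}" "x \<in> snd ` G" for i j x
        using that(3) GS(3)[OF that(1,2)] by (force simp: EP_def)
    qed
    have "b ` I \<subseteq> snd ` G" unfolding G_def S_def by (force intro: P.low_base)
    then have "B.span (b ` I) \<subseteq> snd ` G" by (rule B.span_minimal[OF _ B.gsubD(1)[OF gf]])
    then show "h \<in> snd ` G" if "B.hw mu h" for mu h using spb[OF that] by blast
  qed
  have fun1: "y = y'" if "(x, y) \<in> G" "(x, y') \<in> G" for x y y'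
    using inj1[OF VP.subspace_diff[OF GS(1) that]] by (simp add: prod_eq_iff)
  have fun2: "x = x'" if "(x, y) \<in> G" "(x', y) \<in> G" for x x' y
    using inj2[OF VP.subspace_diff[OF GS(1) that]] by (simp add: prod_eq_iff)
  define \<Theta> where "\<Theta> x = (THE y. (x, y) \<in> G)" for x
  have \<Theta>: "\<Theta> x = y" if "(x, y) \<in> G" for x y
    unfolding \<Theta>_def using that fun1 by (intro the_equality) blast+
  have \<Theta>G: "(x, \<Theta> x) \<in> G" if x: "x \<in> M1" for x
  proof -
    obtain y where "(x, y) \<in> G" using x fstG by force
    then show ?thesis using \<Theta> by simp
  qed
  show ?thesis
  proof (intro exI[of _ \<Theta>] conjI ballI allI)
    show "bij_betw \<Theta> M1 M2" unfolding bij_betw_def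
    proof
      show "inj_on \<Theta> M1" by (rule inj_onI) (metis \<Theta>G fun2)
      show "\<Theta> ` M1 = M2"
      proof
        show "\<Theta> ` M1 \<subseteq> M2" using \<Theta>G GS(2) by blast
        show "M2 \<subseteq> \<Theta> ` M1"
        proof
          fix y assume "y \<in> M2"
          then obtain x where x: "(x, y) \<in> G" using sndG by force
          then have "x \<in> M1" using GS(2) by blast
          then show "y \<in> \<Theta> ` M1" using \<Theta>[OF x] by blast
        qed
      qed
    qed
    show "\<Theta> (x + y) = \<Theta> x + \<Theta> y" if "x \<in> M1" "y \<in> M1" for x y
      using VP.subspace_add[OF GS(1) \<Theta>G[OF that(1)] \<Theta>G[OF that(2)]] by (intro \<Theta>) simp
    show "\<Theta> (s1 c x) = s2 c (\<Theta> x)" if "x \<in> M1" for c x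
      using VP.subspace_scale[OF GS(1) \<Theta>G[OF that], of c] by (intro \<Theta>) (simp add: sP_def)
    show "\<Theta> (A.cop X n x) = B.cop X n (\<Theta> x)" if "x \<in> M1" for X n x
      using P.cop_mem[OF gG \<Theta>G[OF that], of X n] by (intro \<Theta>) (simp add: P_cop)
  qed
qed

end

section \<open>Polynomial functions\<close>

text \<open>Comparing the values at \<open>2 k\<close> and \<open>k\<close> eliminates the top
  coefficient and multiplies \<open>c n\<close> by \<open>2 ^ n - 2 ^ Suc d\<close>, which is
  nonzero. Positive integers as sample points suffice, so the matrices \<open>1 + t E_ii\<close>
  with these \<open>t\<close> are invertible where the lemma is used.\<close>

lemma (in vector_space) coefficients_in_subspace:
  fixes c :: "nat \<Rightarrow> 'b"
  assumes N: "subspace N" and char: "\<And>n. n > 0 \<Longrightarrow> (of_nat n :: 'a) \<noteq> 0"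
    and mem: "\<And>k. k \<ge> 1 \<Longrightarrow> (\<Sum>n\<le>d. (of_nat k) ^ n *s c n) \<in> N" and n: "n \<le> d"
  shows "c n \<in> N"
  using mem n
proof (induction d arbitrary: c n)
  case 0
  then show ?case using "0.prems"(1)[of 1] by simp
next
  case (Suc d)
  have main: "c n \<in> N" if "n \<le> d" for n
  proof -
    let ?b = "\<lambda>n. ((2::'a) ^ n - 2 ^ Suc d) *s c n"
    have "(\<Sum>n\<le>d. (of_nat k) ^ n *s ?b n) \<in> N" if k: "k \<ge> 1" for k
    proof -
      have "(\<Sum>n\<le>Suc d. (of_nat (2 * k)) ^ n *s c n) - 2 ^ Suc d *s (\<Sum>n\<le>Suc d. (of_nat k) ^ n *s c n) \<in> N"
        by (intro subspace_diff[OF N] subspace_scale[OF N] Suc.prems(1)) (use k in auto)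
      also have "(\<Sum>n\<le>Suc d. (of_nat (2 * k)) ^ n *s c n) - 2 ^ Suc d *s (\<Sum>n\<le>Suc d. (of_nat k) ^ n *s c n)
         = (\<Sum>n\<le>Suc d. (of_nat k) ^ n *s ?b n)"
        unfolding scale_sum_right sum_subtractf[symmetric]
        by (intro sum.cong refl, simp only: scale_scale scale_left_diff_distrib[symmetric])
          (simp add: power_mult_distrib algebra_simps)
      finally show ?thesis by simp
    qed
    then have "?b n \<in> N" using Suc.IH[of ?b n] that by blast
    then have "inverse ((2::'a) ^ n - 2 ^ Suc d) *s ?b n \<in> N" by (rule subspace_scale[OF N])
    moreover have "(2::'a) ^ n - 2 ^ Suc d \<noteq> 0"
    proof -
      have "(2::'a) ^ n - 2 ^ Suc d = - of_nat (2 ^ Suc d - 2 ^ n)"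
      proof -
        have "(2::nat) ^ n \<le> 2 ^ Suc d" using that by (intro power_increasing) auto
        then show ?thesis by (simp only: of_nat_diff of_nat_power of_nat_numeral minus_diff_eq)
      qed
      moreover have "2 ^ Suc d - 2 ^ n > (0::nat)" using that by (simp del: power_Suc)
      ultimately show ?thesis using char by (metis neg_equal_0_iff_equal)
    qed
    ultimately show ?thesis by simp
  qed
  have "(\<Sum>n\<le>Suc d. c n) \<in> N" using Suc.prems(1)[of 1] by simp
  moreover have "(\<Sum>n\<le>d. c n) \<in> N" using main by (intro subspace_sum[OF N]) auto
  ultimately have "(\<Sum>n\<le>Suc d. c n) - (\<Sum>n\<le>d. c n) \<in> N" by (rule subspace_diff[OF N])
  then have "c (Suc d) \<in> N" by simp
  then show ?case using main Suc.prems(2) by (cases "n = Suc d") auto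
qed

lemma sum_fun_apply: "(\<Sum>i\<in>A. f i) x = (\<Sum>i\<in>A. f i x)"
  by (induction A rule: infinite_finite_induct) auto

text \<open>The matrices of the group mix only the first index. The second is a pair (i, j) for the
  variables of the skew-symmetric matrices and a column for the model of W_p, so both sides share
  one theory.\<close>

type_synonym ('c, 'k) point = "nat \<times> 'c \<Rightarrow> 'k"

inductive_set Pol :: "nat \<Rightarrow> (('c, 'k::field_char_0) point \<Rightarrow> 'k) set" for p where
  const: "(\<lambda>y. c) \<in> Pol p"
| var: "k \<in> {1..p} \<Longrightarrow> (\<lambda>y. y (k, c)) \<in> Pol p"
| add: "f \<in> Pol p \<Longrightarrow> g \<in> Pol p \<Longrightarrow> (\<lambda>y. f y + g y) \<in> Pol p"
| mult: "f \<in> Pol p \<Longrightarrow> g \<in> Pol p \<Longrightarrow> (\<lambda>y. f y * g y) \<in> Pol p"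

lemma Pol_uminus: "f \<in> Pol p \<Longrightarrow> (\<lambda>y. - f y) \<in> Pol p"
  using Pol.mult[OF Pol.const[of "-1"]] by simp

lemma Pol_diff: "f \<in> Pol p \<Longrightarrow> g \<in> Pol p \<Longrightarrow> (\<lambda>y. f y - g y) \<in> Pol p"
  using Pol.add[OF _ Pol_uminus] by simp

lemma Pol_sum: "(\<And>i. i \<in> A \<Longrightarrow> f i \<in> Pol p) \<Longrightarrow> (\<lambda>y. \<Sum>i\<in>A. f i y) \<in> Pol p"
  by (induction A rule: infinite_finite_induct) (auto intro: Pol.intros)

lemma Pol_prod: "(\<And>i. i \<in> A \<Longrightarrow> f i \<in> Pol p) \<Longrightarrow> (\<lambda>y. \<Prod>i\<in>A. f i y) \<in> Pol p"
  by (induction A rule: infinite_finite_induct) (auto intro: Pol.intros)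

lemma Pol_power: "f \<in> Pol p \<Longrightarrow> (\<lambda>y. f y ^ n) \<in> Pol p"
  by (induction n) (auto intro: Pol.intros)

section \<open>Directional derivatives and polarization operators\<close>

definition line_poly :: "(('c, 'k::field_char_0) point \<Rightarrow> 'k) \<Rightarrow> ('c, 'k) point \<Rightarrow> ('c, 'k) point \<Rightarrow> 'k poly" where
  "line_poly f y z = (THE q. \<forall>t. poly q t = f (\<lambda>v. y v + t * z v))"

text \<open>The linear coefficient of the restriction to a line. That restriction is a unique
  polynomial since the field is infinite, so derivatives are defined on functions and do not depend
  on how \<open>f\<close> is written.\<close>

definition dir_deriv :: "(('c, 'k::field_char_0) point \<Rightarrow> 'k) \<Rightarrow> ('c, 'k) point \<Rightarrow> ('c, 'k) point \<Rightarrow> 'k" where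
  "dir_deriv f y z = coeff (line_poly f y z) 1"

lemma line_poly_unique:
  assumes "\<And>t. poly q t = f (\<lambda>v. y v + t * z v)" shows "line_poly f y z = q"
  unfolding line_poly_def
proof (rule the_equality)
  fix r assume "\<forall>t. poly r t = f (\<lambda>v. y v + t * z v)"
  then have "poly r = poly q" using assms by auto
  then show "r = q" by (simp add: poly_eq_poly_eq_iff)
qed (use assms in simp)

lemma poly_line_poly: "f \<in> Pol p \<Longrightarrow> poly (line_poly f y z) t = f (\<lambda>v. y v + t * z v)"
proof -
  assume "f \<in> Pol p"
  then have "\<exists>q. \<forall>t. poly q t = f (\<lambda>v. y v + t * z v)"
  proof induction
    case (const c)
    show ?case by (intro exI[of _ "[:c:]"]) simp
  next
    case (var k c)
    show ?case by (intro exI[of _ "[:y (k, c), z (k, c):]"]) simp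
  next
    case (add f g)
    then obtain q r where "\<forall>t. poly q t = f (\<lambda>v. y v + t * z v)" "\<forall>t. poly r t = g (\<lambda>v. y v + t * z v)" by blast
    then show ?case by (intro exI[of _ "q + r"]) simp
  next
    case (mult f g)
    then obtain q r where "\<forall>t. poly q t = f (\<lambda>v. y v + t * z v)" "\<forall>t. poly r t = g (\<lambda>v. y v + t * z v)" by blast
    then show ?case by (intro exI[of _ "q * r"]) simp
  qed
  then obtain q where "\<forall>t. poly q t = f (\<lambda>v. y v + t * z v)" by blast
  then show ?thesis using line_poly_unique[of q f y z] by simp
qed

lemma line_poly_const: "line_poly (\<lambda>y. c) y z = [:c:]"
  by (rule line_poly_unique) simp

lemma line_poly_var: "line_poly (\<lambda>y. y v) y z = [:y v, z v:]"
  by (rule line_poly_unique) simp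

lemma line_poly_add: "f \<in> Pol p \<Longrightarrow> g \<in> Pol p \<Longrightarrow> line_poly (\<lambda>y. f y + g y) y z = line_poly f y z + line_poly g y z"
  by (rule line_poly_unique) (simp add: poly_line_poly)

lemma line_poly_mult: "f \<in> Pol p \<Longrightarrow> g \<in> Pol p \<Longrightarrow> line_poly (\<lambda>y. f y * g y) y z = line_poly f y z * line_poly g y z"
  by (rule line_poly_unique) (simp add: poly_line_poly)

lemma coeff_0_line_poly: "f \<in> Pol p \<Longrightarrow> coeff (line_poly f y z) 0 = f y"
  using poly_line_poly[of f p y z 0] by (simp add: poly_0_coeff_0)

lemma coeff_1_mult: "coeff (q * r) 1 = coeff q 1 * coeff r 0 + coeff q 0 * coeff r (1::nat)"
  for q r :: "'a::comm_semiring_0 poly"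
  by (simp add: coeff_mult algebra_simps)

lemma dir_deriv_const: "dir_deriv (\<lambda>y. c) y z = 0"
  by (simp add: dir_deriv_def line_poly_const)

lemma dir_deriv_var: "dir_deriv (\<lambda>y. y v) y z = z v"
  by (simp add: dir_deriv_def line_poly_var)

lemma dir_deriv_add: "f \<in> Pol p \<Longrightarrow> g \<in> Pol p \<Longrightarrow> dir_deriv (\<lambda>y. f y + g y) y z = dir_deriv f y z + dir_deriv g y z"
  by (simp add: dir_deriv_def line_poly_add)

lemma dir_deriv_mult: "f \<in> Pol p \<Longrightarrow> g \<in> Pol p \<Longrightarrow> dir_deriv (\<lambda>y. f y * g y) y z = dir_deriv f y z * g y + f y * dir_deriv g y z"
  by (simp add: dir_deriv_def line_poly_mult coeff_1_mult coeff_0_line_poly del: One_nat_def)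

lemma dir_deriv_linear_direction:
  "f \<in> Pol p \<Longrightarrow> dir_deriv f y (\<lambda>v. z v + t * w v) = dir_deriv f y z + t * dir_deriv f y w"
  by (induction rule: Pol.induct) (simp_all add: dir_deriv_const dir_deriv_var dir_deriv_add dir_deriv_mult algebra_simps)

text \<open>The tangent vector at \<open>y\<close> of the row operation that adds multiples of row
  \<open>i\<close> to row \<open>j\<close>.\<close>

definition shift :: "nat \<Rightarrow> nat \<Rightarrow> ('c, 'k::field_char_0) point \<Rightarrow> ('c, 'k) point" where
  "shift i j y = (\<lambda>(k, c). if k = j then y (i, c) else 0)"

text \<open>The polarization operator, the sum over \<open>c\<close> of y(i,c) d/dy(j,c), that is,
  the action of the matrix unit E_ij.\<close>

definition eop :: "nat \<Rightarrow> nat \<Rightarrow> (('c, 'k::field_char_0) point \<Rightarrow> 'k) \<Rightarrow> ('c, 'k) point \<Rightarrow> 'k" where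
  "eop i j f = (\<lambda>y. dir_deriv f y (shift i j y))"

lemma eop_const: "eop i j (\<lambda>y. c) = (\<lambda>y. 0)"
  by (simp add: eop_def dir_deriv_const)

lemma eop_var: "eop i j (\<lambda>y. y (k, c)) = (if k = j then \<lambda>y. y (i, c) else (\<lambda>y. 0))"
  by (auto simp: eop_def dir_deriv_var shift_def)

lemma eop_add: "f \<in> Pol p \<Longrightarrow> g \<in> Pol p \<Longrightarrow> eop i j (\<lambda>y. f y + g y) = (\<lambda>y. eop i j f y + eop i j g y)"
  by (simp add: eop_def dir_deriv_add)

lemma eop_mult: "f \<in> Pol p \<Longrightarrow> g \<in> Pol p \<Longrightarrow>
    eop i j (\<lambda>y. f y * g y) = (\<lambda>y. eop i j f y * g y + f y * eop i j g y)"
  by (simp add: eop_def dir_deriv_mult)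

lemma eop_Pol: "f \<in> Pol p \<Longrightarrow> i \<in> {1..p} \<Longrightarrow> eop i j f \<in> Pol p"
  by (induction rule: Pol.induct) (auto simp: eop_const eop_var eop_add eop_mult intro: Pol.intros)

text \<open>For products the mixed terms of the two second-order expressions agree, so the
  difference is a derivation in \<open>f\<close>, and variables decide.\<close>

lemma eop_comm:
  assumes "f \<in> Pol p" "i \<in> {1..p}" "k \<in> {1..p}"
  shows "eop i j (eop k l f) y
    = eop k l (eop i j f) y + (if j = k then eop i l f y else 0) - (if i = l then eop k j f y else 0)"
  using assms(1)
proof (induction arbitrary: y)
  case (add f g)
  then show ?case using assms by (simp add: eop_add[where p = p] eop_Pol)
next
  case (mult f g)
  have *: "eop i j (eop k l (\<lambda>y. f y * g y)) y = eop i j (eop k l f) y * g y + eop k l f y * eop i j g y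
      + (eop i j f y * eop k l g y + f y * eop i j (eop k l g) y)"
    if "k \<in> {1..p}" for i j k l
  proof -
    have "(\<lambda>y. eop k l f y * g y) \<in> Pol p" "(\<lambda>y. f y * eop k l g y) \<in> Pol p"
      by (intro Pol.mult eop_Pol mult.hyps that)+
    then show ?thesis using mult.hyps that
      by (simp add: eop_add[where p = p] eop_mult[where p = p] eop_Pol)
  qed
  show ?case
    unfolding *[OF assms(2)] *[OF assms(3)] unfolding eop_mult[OF mult.hyps] mult.IH
    by (simp add: algebra_simps)
qed (auto simp: eop_const eop_var)

section \<open>Finite families of polynomial functions as gl_p-modules\<close>

definition fscale :: "'k::field_char_0 \<Rightarrow> ('j \<Rightarrow> 'p \<Rightarrow> 'k) \<Rightarrow> 'j \<Rightarrow> 'p \<Rightarrow> 'k" where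
  "fscale c m = (\<lambda>a y. c * m a y)"

lemma fscale_apply: "fscale c m a y = c * m a y"
  by (simp add: fscale_def)

definition Eop :: "nat \<Rightarrow> nat \<Rightarrow> ('j \<Rightarrow> ('c, 'k::field_char_0) point \<Rightarrow> 'k) \<Rightarrow> 'j \<Rightarrow> ('c, 'k) point \<Rightarrow> 'k" where
  "Eop i j m = (\<lambda>a. eop i j (m a))"

text \<open>The index is a matrix position on one side and a summand label on the other. Finite
  support makes every family a finite sum of homogeneous ones and bounds its degree
  uniformly.\<close>

definition PM :: "nat \<Rightarrow> ('j \<Rightarrow> ('c, 'k::field_char_0) point \<Rightarrow> 'k) set" where
  "PM p = {m. finite {a. m a \<noteq> (\<lambda>y. 0)} \<and> (\<forall>a. m a \<in> Pol p)}"

definition rowscale :: "nat \<Rightarrow> 'k::field_char_0 \<Rightarrow> ('c, 'k) point \<Rightarrow> ('c, 'k) point" where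
  "rowscale i t y = (\<lambda>(k, c). if k = i then t * y (k, c) else y (k, c))"

definition homog :: "nat \<Rightarrow> (nat \<Rightarrow> nat) \<Rightarrow> (('c, 'k::field_char_0) point \<Rightarrow> 'k) \<Rightarrow> bool" where
  "homog p mu f \<longleftrightarrow> (\<forall>i\<in>{1..p}. \<forall>t y. f (rowscale i t y) = t ^ mu i * f y)"

lemma coeff_1_pderiv: "coeff q (Suc 0) = poly (pderiv q) 0"
  by (simp add: poly_0_coeff_0 coeff_pderiv)

text \<open>Euler's identity: the line through \<open>y\<close> in direction
  \<open>shift i i y\<close> consists of the rescalings by \<open>1 + t\<close>, and (1 + t)^n has
  derivative n at 0.\<close>

lemma eop_rowscale:
  assumes "\<And>t. f (rowscale i t y) = t ^ n * f y"
  shows "eop i i f y = of_nat n * f y"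
proof -
  have "line_poly f y (shift i i y) = smult (f y) ([:1, 1:] ^ n)"
  proof (rule line_poly_unique)
    fix t
    have "(\<lambda>v. y v + t * shift i i y v) = rowscale i (1 + t) y"
      by (auto simp: shift_def rowscale_def algebra_simps)
    then show "poly (smult (f y) ([:1, 1:] ^ n)) t = f (\<lambda>v. y v + t * shift i i y v)"
      using assms[of "1 + t"] by (simp add: poly_power mult.commute)
  qed
  then show ?thesis
    by (simp add: eop_def dir_deriv_def coeff_1_pderiv pderiv_smult pderiv_power poly_power pderiv_pCons mult.commute)
qed

lemma eop_invariant:
  assumes "\<And>t. f (\<lambda>v. y v + t * shift i j y v) = f y"
  shows "eop i j f y = 0"
proof -
  have "line_poly f y (shift i j y) = [:f y:]" using assms by (intro line_poly_unique) simp
  then show ?thesis by (simp add: eop_def dir_deriv_def)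
qed

lemma poly_pderiv_line_poly:
  assumes "f \<in> Pol p"
  shows "poly (pderiv (line_poly f y z)) t = dir_deriv f (\<lambda>v. y v + t * z v) z"
proof -
  have "line_poly f (\<lambda>v. y v + t * z v) z = pcompose (line_poly f y z) [:t, 1:]"
    by (rule line_poly_unique) (simp add: poly_pcompose poly_line_poly[OF assms] algebra_simps)
  then show ?thesis
    by (simp add: dir_deriv_def coeff_1_pderiv pderiv_pcompose poly_pcompose pderiv_pCons)
qed

text \<open>For \<open>i \<noteq> j\<close> the direction is constant along the line, so the
  derivative of the line polynomial vanishes at every \<open>t\<close>; in characteristic 0 it is
  constant.\<close>

lemma invariant_of_eop:
  assumes f: "f \<in> Pol p" and "i \<noteq> j" and z: "\<And>y. eop i j f y = 0"
  shows "f (\<lambda>v. y v + t * shift i j y v) = f y"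
proof -
  have "shift i j (\<lambda>v. y v + t * shift i j y v) = shift i j y" for t
    using assms(2) by (auto simp: shift_def)
  then have "poly (pderiv (line_poly f y (shift i j y))) t = 0" for t
    using z[of "\<lambda>v. y v + t * shift i j y v"] by (simp add: poly_pderiv_line_poly[OF f] eop_def)
  then have "pderiv (line_poly f y (shift i j y)) = 0" by (simp add: poly_all_0_iff_0[symmetric])
  then obtain c where c: "line_poly f y (shift i j y) = [:c:]"
    using pderiv_eq_0_iff degree_eq_zeroE by metis
  have "f (\<lambda>v. y v + t * shift i j y v) = c" for t
    using poly_line_poly[OF f, of y "shift i j y" t] c by simp
  from this[of t] this[of 0] show ?thesis by simp
qed

interpretation FS: vector_space fscale
  by unfold_locales (auto simp: fscale_def fun_eq_iff algebra_simps)

interpretation FS1: vector_space "\<lambda>(c::'k::field_char_0) (f :: 'p \<Rightarrow> 'k) y. c * f y"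
  by unfold_locales (auto simp: fun_eq_iff algebra_simps)

lemma subspace_PM: "FS.subspace (PM p :: ('j \<Rightarrow> ('c, 'k::field_char_0) point \<Rightarrow> 'k) set)"
  unfolding FS.subspace_def
proof (intro conjI ballI allI)
  show "(0 :: 'j \<Rightarrow> ('c, 'k) point \<Rightarrow> 'k) \<in> PM p" by (simp add: PM_def zero_fun_def Pol.const)
  fix x y :: "'j \<Rightarrow> ('c, 'k::field_char_0) point \<Rightarrow> 'k" and c
  assume x: "x \<in> PM p"
  show "x + y \<in> PM p" if y: "y \<in> PM p"
  proof -
    have "{a. (x + y) a \<noteq> (\<lambda>y. 0)} \<subseteq> {a. x a \<noteq> (\<lambda>y. 0)} \<union> {a. y a \<noteq> (\<lambda>y. 0)}"
      by (auto simp: fun_eq_iff)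
    then show ?thesis using x y unfolding PM_def plus_fun_def
      by (auto intro: Pol.add finite_subset)
  qed
  have "{a. fscale c x a \<noteq> (\<lambda>y. 0)} \<subseteq> {a. x a \<noteq> (\<lambda>y. 0)}" by (auto simp: fun_eq_iff fscale_def)
  then show "fscale c x \<in> PM p" using x unfolding PM_def fscale_def
    by (auto intro: Pol.mult Pol.const finite_subset)
qed

text \<open>Constants and variables are homogeneous in each row, and so are products of homogeneous
  functions. The product case extends this to spans by linearity in one factor at a time.\<close>

lemma Pol_homog_span:
  fixes f :: "('c, 'k::field_char_0) point \<Rightarrow> 'k"
  assumes "f \<in> Pol p" shows "f \<in> FS1.span {h \<in> Pol p. \<exists>mu. homog p mu h}"
  using assms
proof (induction rule: Pol.induct)
  case (const c)
  have "homog p (\<lambda>_. 0) (\<lambda>y. c)" by (simp add: homog_def)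
  then show ?case by (intro FS1.span_base) (auto intro: Pol.const)
next
  case (var k c)
  have "homog p (\<lambda>i. if i = k then 1 else 0) (\<lambda>y. y (k, c))" by (simp add: homog_def rowscale_def)
  then show ?case using var by (intro FS1.span_base) (auto intro: Pol.var)
next
  case (add f g)
  then show ?case using FS1.span_add[of f _ g] by (simp add: plus_fun_def)
next
  case (mult f g)
  let ?H = "{h \<in> Pol p. \<exists>mu. homog p mu h} :: (('c, 'k) point \<Rightarrow> 'k) set"
  have 1: "(\<lambda>y. h y * g y) \<in> FS1.span ?H" if h: "h \<in> ?H" for h :: "('c, 'k) point \<Rightarrow> 'k"
  proof -
    let ?G = "{g. (\<lambda>y. h y * g y) \<in> FS1.span ?H}"
    have "FS1.subspace ?G"
      unfolding FS1.subspace_def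
    proof (intro conjI ballI allI)
      show "0 \<in> ?G"
        using FS1.span_zero[of ?H] by (simp add: zero_fun_def)
      show "a + b \<in> ?G" if "a \<in> ?G" "b \<in> ?G" for a b
        using FS1.span_add[of "\<lambda>y. h y * a y" ?H "\<lambda>y. h y * b y"] that
        by (simp add: plus_fun_def distrib_left)
      show "(\<lambda>y. c * a y) \<in> ?G" if "a \<in> ?G" for c a
        using FS1.span_scale[of "\<lambda>y. h y * a y" ?H c] that by (simp add: mult.left_commute)
    qed
    moreover have "?H \<subseteq> ?G"
    proof
      fix g assume g: "g \<in> ?H"
      obtain mu nu where "homog p mu h" "homog p nu g" using g h by blast
      then have "homog p (\<lambda>i. mu i + nu i) (\<lambda>y. h y * g y)"
        by (simp add: homog_def power_add mult_ac)
      then show "g \<in> ?G"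
        using g h by (auto intro!: FS1.span_base Pol.mult)
    qed
    ultimately have "FS1.span ?H \<subseteq> ?G" by (rule FS1.span_minimal[rotated])
    then show ?thesis using mult by blast
  qed
  let ?F = "{f. (\<lambda>y. f y * g y) \<in> FS1.span ?H}"
  have "FS1.subspace ?F"
    unfolding FS1.subspace_def
  proof (intro conjI ballI allI)
    show "0 \<in> ?F"
      using FS1.span_zero[of ?H] by (simp add: zero_fun_def)
    show "a + b \<in> ?F" if "a \<in> ?F" "b \<in> ?F" for a b
      using FS1.span_add[of "\<lambda>y. a y * g y" ?H "\<lambda>y. b y * g y"] that
      by (simp add: plus_fun_def distrib_right)
    show "(\<lambda>y. c * a y) \<in> ?F" if "a \<in> ?F" for c a
      using FS1.span_scale[of "\<lambda>y. a y * g y" ?H c] that by (simp add: mult.assoc)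
  qed
  then have "FS1.span ?H \<subseteq> ?F"
    using 1 by (intro FS1.span_minimal) auto
  then show ?case using mult by blast
qed

definition homvec :: "nat \<Rightarrow> ('j \<Rightarrow> ('c, 'k::field_char_0) point \<Rightarrow> 'k) set" where
  "homvec p = {m \<in> PM p. \<exists>mu. \<forall>a. homog p mu (m a)}"

lemma Eop_homog:
  assumes "\<forall>a. homog p mu (m a)" "i \<in> {1..p}"
  shows "Eop i i m = fscale (of_nat (mu i)) m"
  using assms unfolding homog_def Eop_def fscale_def by (auto intro!: ext eop_rowscale)

definition single :: "'j \<Rightarrow> ('p \<Rightarrow> 'k::zero) \<Rightarrow> 'j \<Rightarrow> 'p \<Rightarrow> 'k" where
  "single a f = (\<lambda>b. if b = a then f else (\<lambda>y. 0))"

lemma PM_homvec_span: "PM p \<subseteq> FS.span (homvec p :: ('j \<Rightarrow> ('c, 'k::field_char_0) point \<Rightarrow> 'k) set)"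
proof
  fix m :: "'j \<Rightarrow> ('c, 'k) point \<Rightarrow> 'k" assume m: "m \<in> PM p"
  have single: "single a f \<in> FS.span (homvec p)" if f: "f \<in> Pol p" for a :: 'j and f :: "('c, 'k) point \<Rightarrow> 'k"
  proof -
    let ?S = "{f :: ('c, 'k) point \<Rightarrow> 'k. single a f \<in> FS.span (homvec p)}"
    have "FS1.subspace ?S"
      unfolding FS1.subspace_def
    proof (intro conjI ballI allI)
      have "single a (0 :: ('c, 'k) point \<Rightarrow> 'k) = 0" by (auto simp: single_def fun_eq_iff)
      then show "0 \<in> ?S" by (simp add: FS.span_zero)
      show "f + g \<in> ?S" if "f \<in> ?S" "g \<in> ?S" for f g
      proof -
        have "single a (f + g) = single a f + single a g" by (auto simp: single_def fun_eq_iff)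
        then show ?thesis using that by (simp add: FS.span_add)
      qed
      show "(\<lambda>y. c * f y) \<in> ?S" if "f \<in> ?S" for c f
      proof -
        have "single a (\<lambda>y. c * f y) = fscale c (single a f)" by (auto simp: single_def fun_eq_iff fscale_def)
        then show ?thesis using that by (simp add: FS.span_scale)
      qed
    qed
    moreover have "{h \<in> Pol p. \<exists>mu. homog p mu h} \<subseteq> ?S"
    proof
      fix h :: "('c, 'k) point \<Rightarrow> 'k" assume "h \<in> {h \<in> Pol p. \<exists>mu. homog p mu h}"
      then obtain mu where h: "h \<in> Pol p" "homog p mu h" by blast
      have "finite {b. single a h b \<noteq> (\<lambda>y. 0)}" by (rule finite_subset[of _ "{a}"]) (auto simp: single_def)
      moreover have "\<forall>b. homog p mu (single a h b)" using h by (auto simp: single_def homog_def)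
      ultimately have "single a h \<in> homvec p"
        unfolding homvec_def PM_def using h
        by (intro CollectI conjI exI[of _ mu]) (auto simp: single_def Pol.const)
      then show "h \<in> ?S" by (simp add: FS.span_base)
    qed
    ultimately have "FS1.span {h \<in> Pol p. \<exists>mu. homog p mu h} \<subseteq> ?S"
      by (rule FS1.span_minimal[rotated])
    then show ?thesis using Pol_homog_span[OF f] by blast
  qed
  let ?A = "{a. m a \<noteq> (\<lambda>y. 0)}"
  have fin: "finite ?A" using m by (simp add: PM_def)
  have "m = (\<Sum>a\<in>?A. single a (m a))"
  proof
    fix b
    have "(\<Sum>a\<in>?A. single a (m a)) b = (\<Sum>a\<in>?A. if a = b then m a else 0)"
      by (subst sum_fun_apply, intro sum.cong) (auto simp: single_def zero_fun_def)
    also have "\<dots> = m b" using fin by (auto simp: sum.delta zero_fun_def)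
    finally show "m b = (\<Sum>a\<in>?A. single a (m a)) b" by simp
  qed
  also have "\<dots> \<in> FS.span (homvec p)" using m by (intro FS.span_sum single) (simp add: PM_def)
  finally show "m \<in> FS.span (homvec p)" .
qed

lemma Eop_PM: "i \<in> {1..p} \<Longrightarrow> m \<in> PM p \<Longrightarrow> Eop i j m \<in> PM p"
proof -
  assume "i \<in> {1..p}" "m \<in> PM p"
  moreover have "{a. Eop i j m a \<noteq> (\<lambda>y. 0)} \<subseteq> {a. m a \<noteq> (\<lambda>y. 0)}"
    by (auto simp: Eop_def eop_const)
  ultimately show ?thesis unfolding PM_def by (auto simp: Eop_def intro: eop_Pol finite_subset)
qed

lemma PM_D: "m \<in> PM p \<Longrightarrow> m a \<in> Pol p"
  by (simp add: PM_def)

text \<open>Homogeneous families span \<open>PM p\<close> but need not lie in \<open>N\<close>;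
  stability under the diagonal operators supplies eigenvectors with the same natural eigenvalues
  inside \<open>N\<close>.\<close>

lemma gl_space_subspace:
  fixes N :: "('j \<Rightarrow> ('c, 'k::field_char_0) point \<Rightarrow> 'k) set"
  assumes N: "FS.subspace N" "N \<subseteq> PM p"
    and E: "\<And>i j m. i \<in> {1..p} \<Longrightarrow> j \<in> {1..p} \<Longrightarrow> m \<in> N \<Longrightarrow> Eop i j m \<in> N"
  shows "gl_space fscale p Eop N"
proof unfold_locales
  fix i j k l :: nat and x y :: "'j \<Rightarrow> ('c, 'k) point \<Rightarrow> 'k" and c
  assume ij: "i \<in> {1..p}" "j \<in> {1..p}" and x: "x \<in> N"
  then show "Eop i j x \<in> N" by (rule E)
  have xP: "x a \<in> Pol p" for a using x N by (auto simp: PM_def)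
  show "Eop i j (x + y) = Eop i j x + Eop i j y" if "y \<in> N"
  proof -
    have yP: "y a \<in> Pol p" for a using that N by (auto simp: PM_def)
    show ?thesis by (auto simp: Eop_def plus_fun_def fun_eq_iff eop_add[OF xP yP])
  qed
  show "Eop i j (fscale c x) = fscale c (Eop i j x)"
    by (auto simp: Eop_def fscale_def fun_eq_iff eop_mult[OF Pol.const xP] eop_const)
  show "Eop i j (Eop k l x) = Eop k l (Eop i j x) + (if j = k then Eop i l x else 0) - (if i = l then Eop k j x else 0)"
    if "k \<in> {1..p}" "l \<in> {1..p}"
    using eop_comm[OF xP ij(1) that(1)] by (auto simp: Eop_def fun_eq_iff)
next
  let ?W = "{v \<in> N. \<exists>mu. \<forall>i\<in>{1..p}. 0 \<le> mu i \<and> Eop i i v = fscale (of_int (mu i)) v}"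
  define l where "l m = (SOME mu. \<forall>a. homog p mu (m a))" for m :: "'j \<Rightarrow> ('c, 'k) point \<Rightarrow> 'k"
  have l: "\<forall>a. homog p (l m) (m a)" if "m \<in> homvec p" for m
    using that someI_ex[of "\<lambda>mu. \<forall>a. homog p mu (m a)"] unfolding homvec_def l_def by blast
  show "N \<subseteq> FS.span ?W"
  proof
    fix x assume x: "x \<in> N"
    have "x \<in> FS.span {v \<in> N. \<exists>a\<in>homvec p. \<forall>i\<in>{1..p}. Eop i i v = fscale (of_nat (l a i)) v}"
    proof (rule FS.stable_subspace_eigen_span[OF subspace_PM, where T = "\<lambda>i. Eop i i" and J = "{1..p}"])
      show "x \<in> FS.span (homvec p)" using x N(2) PM_homvec_span by blast
      show "\<forall>i\<in>{1..p}. Eop i i a = fscale (of_nat (l a i)) a" if "a \<in> homvec p" for a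
        using Eop_homog[OF l[OF that]] by blast
      show "Eop i i (x + y) = Eop i i x + Eop i i y" if "x \<in> PM p" "y \<in> PM p" for i and x y :: "'j \<Rightarrow> ('c, 'k) point \<Rightarrow> 'k"
        using that by (auto simp: Eop_def plus_fun_def fun_eq_iff eop_add[OF PM_D PM_D])
      show "Eop i i (fscale c x) = fscale c (Eop i i x)" if "x \<in> PM p" for i c and x :: "'j \<Rightarrow> ('c, 'k) point \<Rightarrow> 'k"
        using that by (auto simp: Eop_def fscale_def fun_eq_iff eop_mult[OF Pol.const PM_D] eop_const)
    qed (use x N E in \<open>auto simp: homvec_def\<close>)
    also have "\<dots> \<subseteq> FS.span ?W"
    proof (rule FS.span_mono, rule subsetI)
      fix v assume "v \<in> {v \<in> N. \<exists>a\<in>homvec p. \<forall>i\<in>{1..p}. Eop i i v = fscale (of_nat (l a i)) v}"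
      then obtain a where "v \<in> N" "\<forall>i\<in>{1..p}. Eop i i v = fscale (of_nat (l a i)) v" by blast
      then show "v \<in> ?W" by (intro CollectI conjI exI[of _ "\<lambda>i. int (l a i)"]) auto
    qed
    finally show "x \<in> FS.span ?W" .
  qed
qed (use N in auto)

lemma gl_space_PM: "gl_space fscale p Eop (PM p)"
  by (intro gl_space_subspace subspace_PM Eop_PM) auto

section \<open>From the Lie algebra to the group and back\<close>

definition mulp :: "nat \<Rightarrow> (nat \<Rightarrow> nat \<Rightarrow> 'k::field_char_0) \<Rightarrow> ('c, 'k) point \<Rightarrow> ('c, 'k) point" where
  "mulp p X y = (\<lambda>(k, c). if k \<in> {1..p} then \<Sum>l\<in>{1..p}. X l k * y (l, c) else 0)"

definition actp :: "nat \<Rightarrow> (nat \<Rightarrow> nat \<Rightarrow> 'k::field_char_0) \<Rightarrow> ('c, 'k) point \<Rightarrow> ('c, 'k) point" where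
  "actp p g y = (\<lambda>(k, c). if 1 \<le> k \<and> k \<le> p then \<Sum>l\<in>{1..p}. g l k * y (l, c) else y (k, c))"

definition gactp :: "nat \<Rightarrow> (nat \<Rightarrow> nat \<Rightarrow> 'k::field_char_0) \<Rightarrow> ('j \<Rightarrow> ('c, 'k) point \<Rightarrow> 'k) \<Rightarrow> 'j \<Rightarrow> ('c, 'k) point \<Rightarrow> 'k" where
  "gactp p g m = (\<lambda>a y. m a (actp p g y))"

text \<open>With \<open>g = 1 + X\<close> the action is a straight line in \<open>X\<close> at
  \<open>t = 1\<close>. Rows outside \<open>{1..p}\<close> are fixed by \<open>actp\<close>, which
  is why the tangent direction \<open>mulp\<close> is zero there.\<close>

lemma actp_mulp:
  "actp p g y = (\<lambda>v. y v + 1 * mulp p (\<lambda>i j. g i j - (if i = j then 1 else 0)) y v)"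
proof
  fix v :: "nat \<times> 'a"
  obtain k c where v: "v = (k, c)" by (cases v)
  have "(\<Sum>l\<in>{1..p}. (g l k - (if l = k then 1 else 0)) * y (l, c)) = (\<Sum>l\<in>{1..p}. g l k * y (l, c)) - y (k, c)"
    if "k \<in> {1..p}"
  proof -
    have "(\<Sum>l\<in>{1..p}. (g l k - (if l = k then 1 else 0)) * y (l, c))
       = (\<Sum>l\<in>{1..p}. g l k * y (l, c) - (if l = k then y (k, c) else 0))"
      by (intro sum.cong) (auto simp: algebra_simps)
    then show ?thesis using that by (simp add: sum_subtractf)
  qed
  then show "actp p g y v = y v + 1 * mulp p (\<lambda>i j. g i j - (if i = j then 1 else 0)) y v"
    by (simp add: v actp_def mulp_def)
qed

text \<open>Substitution uses the transposed index, so composition reverses the order of the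
  factors; hence \<open>mprod p X Z\<close> in the recursion for \<open>bop\<close>.\<close>

lemma mulp_mulp: "mulp p Z (mulp p X y) = mulp p (mprod p X Z) y"
proof
  fix v :: "nat \<times> 'a"
  obtain k c where v: "v = (k, c)" by (cases v)
  have "(\<Sum>l\<in>{1..p}. Z l k * (\<Sum>m\<in>{1..p}. X m l * y (m, c))) = (\<Sum>m\<in>{1..p}. (\<Sum>l\<in>{1..p}. X m l * Z l k) * y (m, c))"
    unfolding sum_distrib_left sum_distrib_right by (subst sum.swap) (simp add: mult_ac)
  then show "mulp p Z (mulp p X y) v = mulp p (mprod p X Z) y v"
    by (simp add: v mulp_def mprod_def)
qed

lemma mulp_add: "mulp p Z (\<lambda>v. y v + t * z v) = (\<lambda>v. mulp p Z y v + t * mulp p Z z v)"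
  by (auto simp: mulp_def fun_eq_iff sum.distrib sum_distrib_left algebra_simps)

lemma dir_deriv_mulp:
  assumes "f \<in> Pol p"
  shows "dir_deriv f y (mulp p Z x) = (\<Sum>i\<in>{1..p}. \<Sum>j\<in>{1..p}. Z i j * dir_deriv f y (shift i j x))"
  using assms
proof induction
  case (var k c)
  have "(\<Sum>j\<in>{1..p}. Z i j * shift i j x (k, c)) = Z i k * x (i, c)" for i
  proof -
    have "(\<Sum>j\<in>{1..p}. Z i j * shift i j x (k, c)) = (\<Sum>j\<in>{1..p}. if k = j then Z i k * x (i, c) else 0)"
      by (intro sum.cong) (auto simp: shift_def)
    then show ?thesis using var by simp
  qed
  then show ?case using var by (simp only: dir_deriv_var) (simp add: mulp_def)
next
  case (add f g)
  then show ?case by (simp add: dir_deriv_add sum.distrib algebra_simps)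
next
  case (mult f g)
  then show ?case by (simp add: dir_deriv_mult sum.distrib sum_distrib_left sum_distrib_right algebra_simps)
qed (simp add: dir_deriv_const)

text \<open>Here the direction \<open>w\<close> stays fixed while the base point moves along the
  line in direction \<open>z\<close>.\<close>

definition dir_deriv_poly :: "(('c, 'k::field_char_0) point \<Rightarrow> 'k) \<Rightarrow> ('c, 'k) point \<Rightarrow> ('c, 'k) point \<Rightarrow> ('c, 'k) point \<Rightarrow> 'k poly" where
  "dir_deriv_poly f y z w = (THE q. \<forall>t. poly q t = dir_deriv f (\<lambda>v. y v + t * z v) w)"

lemma dir_deriv_poly_unique:
  assumes "\<And>t. poly q t = dir_deriv f (\<lambda>v. y v + t * z v) w" shows "dir_deriv_poly f y z w = q"
  unfolding dir_deriv_poly_def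
proof (rule the_equality)
  fix r assume "\<forall>t. poly r t = dir_deriv f (\<lambda>v. y v + t * z v) w"
  then have "poly r = poly q" using assms by auto
  then show "r = q" by (simp add: poly_eq_poly_eq_iff)
qed (use assms in simp)

lemma poly_dir_deriv_poly:
  assumes "f \<in> Pol p"
  shows "poly (dir_deriv_poly f y z w) t = dir_deriv f (\<lambda>v. y v + t * z v) w"
proof -
  have "\<exists>q. \<forall>t. poly q t = dir_deriv f (\<lambda>v. y v + t * z v) w"
    using assms
  proof induction
    case (const c)
    show ?case by (intro exI[of _ 0]) (simp add: dir_deriv_const)
  next
    case (var k c)
    show ?case by (intro exI[of _ "[:w (k, c):]"]) (simp add: dir_deriv_var)
  next
    case (add f g)
    then obtain q r where "\<forall>t. poly q t = dir_deriv f (\<lambda>v. y v + t * z v) w" "\<forall>t. poly r t = dir_deriv g (\<lambda>v. y v + t * z v) w" by blast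
    then show ?case using add.hyps by (intro exI[of _ "q + r"]) (simp add: dir_deriv_add)
  next
    case (mult f g)
    then obtain q r where "\<forall>t. poly q t = dir_deriv f (\<lambda>v. y v + t * z v) w" "\<forall>t. poly r t = dir_deriv g (\<lambda>v. y v + t * z v) w" by blast
    then show ?case using mult.hyps
      by (intro exI[of _ "q * line_poly g y z + line_poly f y z * r"]) (simp add: dir_deriv_mult poly_line_poly)
  qed
  then obtain q where "\<forall>t. poly q t = dir_deriv f (\<lambda>v. y v + t * z v) w" by blast
  then show ?thesis using dir_deriv_poly_unique[of q f y z w] by simp
qed

lemma pderiv_line_poly: "f \<in> Pol p \<Longrightarrow> pderiv (line_poly f y z) = dir_deriv_poly f y z z"
  by (rule dir_deriv_poly_unique[symmetric]) (rule poly_pderiv_line_poly)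

interpretation PMG: gl_space fscale p Eop "PM p" for p
  by (rule gl_space_PM)

lemma lie_act_apply:
  assumes "m \<in> PM p" shows "PMG.lie_act p Z m a y = dir_deriv (m a) y (mulp p Z y)"
  unfolding PMG.lie_act_def dir_deriv_mulp[OF PM_D[OF assms]] sum_fun_apply fscale_def
  by (simp add: Eop_def eop_def)

lemma lie_act_PM: "m \<in> PM p \<Longrightarrow> PMG.lie_act p Z m \<in> PM p"
  by (rule PMG.lie_act_mem[OF PMG.submod_M])

text \<open>This is the meaning of \<open>bop\<close>: the base point is y + t X y, the direction is
  Z y. The vector field of \<open>Z\<close> at that point is Z y + t (X Z) y, so the fixed direction
  costs a correction of one order lower; the remaining coefficient of \<open>lie_act p Z m\<close>
  along the line comes from its derivative, divided by n + 1.\<close>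

lemma coeff_dir_deriv_poly:
  assumes "m \<in> PM p"
  shows "coeff (dir_deriv_poly (m a) y (mulp p X y) (mulp p Z y)) n = PMG.bop p X n Z m a y"
  using assms
proof (induction n arbitrary: m Z)
  case 0
  have "poly (dir_deriv_poly (m a) y (mulp p X y) (mulp p Z y)) 0 = dir_deriv (m a) y (mulp p Z y)"
    using poly_dir_deriv_poly[OF PM_D[OF 0]] by simp
  then show ?case using lie_act_apply[OF 0] by (simp add: poly_0_coeff_0)
next
  case (Suc n)
  let ?z = "mulp p X y"
  have mP: "m a \<in> Pol p" and DP: "PMG.lie_act p Z m a \<in> Pol p"
    by (rule PM_D[OF Suc.prems], rule PM_D[OF lie_act_PM[OF Suc.prems]])
  have "line_poly (PMG.lie_act p Z m a) y ?z
      = dir_deriv_poly (m a) y ?z (mulp p Z y) + [:0, 1:] * dir_deriv_poly (m a) y ?z (mulp p (mprod p X Z) y)"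
  proof (rule line_poly_unique)
    fix t
    show "poly (dir_deriv_poly (m a) y ?z (mulp p Z y) + [:0, 1:] * dir_deriv_poly (m a) y ?z (mulp p (mprod p X Z) y)) t
        = PMG.lie_act p Z m a (\<lambda>v. y v + t * ?z v)"
      by (simp add: lie_act_apply[OF Suc.prems] poly_dir_deriv_poly[OF mP] mulp_add mulp_mulp dir_deriv_linear_direction[OF mP])
  qed
  then have "coeff (line_poly (PMG.lie_act p Z m a) y ?z) (Suc n)
      = coeff (dir_deriv_poly (m a) y ?z (mulp p Z y)) (Suc n) + coeff (dir_deriv_poly (m a) y ?z (mulp p (mprod p X Z) y)) n"
    by simp
  moreover have "of_nat (Suc n) * coeff (line_poly (PMG.lie_act p Z m a) y ?z) (Suc n) = coeff (dir_deriv_poly (PMG.lie_act p Z m a) y ?z ?z) n"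
    unfolding pderiv_line_poly[OF DP, symmetric] coeff_pderiv ..
  then have "coeff (line_poly (PMG.lie_act p Z m a) y ?z) (Suc n) = inverse (of_nat (Suc n)) * coeff (dir_deriv_poly (PMG.lie_act p Z m a) y ?z ?z) n"
    by (simp add: field_simps del: of_nat_Suc)
  moreover have "PMG.bop p X (Suc n) Z m a y
      = inverse (of_nat (Suc n)) * PMG.bop p X n X (PMG.lie_act p Z m) a y - PMG.bop p X n (mprod p X Z) m a y"
    unfolding PMG.bop.simps(2) minus_apply by (subst fscale_apply) (rule refl)
  ultimately show ?case
    unfolding Suc.IH[OF lie_act_PM[OF Suc.prems]] Suc.IH[OF Suc.prems]
    by (simp del: PMG.bop.simps of_nat_Suc)
qed

lemma coeff_line_poly:
  assumes "m \<in> PM p"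
  shows "coeff (line_poly (m a) y (mulp p X y)) n = PMG.cop p X n m a y"
proof (cases n)
  case 0
  then show ?thesis using coeff_0_line_poly[OF PM_D[OF assms]] by simp
next
  case (Suc k)
  have "of_nat (Suc k) * coeff (line_poly (m a) y (mulp p X y)) (Suc k) = coeff (dir_deriv_poly (m a) y (mulp p X y) (mulp p X y)) k"
    unfolding pderiv_line_poly[OF PM_D[OF assms], symmetric] coeff_pderiv ..
  then show ?thesis unfolding coeff_dir_deriv_poly[OF assms] using Suc
    by (simp add: fscale_apply field_simps del: of_nat_Suc)
qed

text \<open>The bound is uniform in the point and the direction, so a single finite sum of
  coefficient operators expresses the group action on the whole function.\<close>

lemma degree_line_poly_bounded:
  assumes "f \<in> Pol p" shows "\<exists>d. \<forall>y z. degree (line_poly f y z) \<le> d"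
  using assms
proof induction
  case (var k c)
  have "degree [:y (k, c), z (k, c):] \<le> 1" for y z :: "('a, 'b) point" by simp
  then show ?case by (metis line_poly_var)
next
  case (add f g)
  then obtain d e where "\<And>y z. degree (line_poly f y z) \<le> d" "\<And>y z. degree (line_poly g y z) \<le> e" by blast
  then show ?case using add.hyps
    by (intro exI[of _ "max d e"])
      (auto simp: line_poly_add intro!: degree_add_le intro: max.coboundedI1 max.coboundedI2)
next
  case (mult f g)
  then obtain d e where "\<And>y z. degree (line_poly f y z) \<le> d" "\<And>y z. degree (line_poly g y z) \<le> e" by blast
  then show ?case using mult.hyps
    by (intro exI[of _ "d + e"]) (auto simp: line_poly_mult intro: order_trans[OF degree_mult_le add_mono])
qed (auto simp: line_poly_const)

lemma PM_degree_bounded: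
  assumes "m \<in> PM p" shows "\<exists>d. \<forall>a y z. degree (line_poly (m a) y z) \<le> d"
proof -
  let ?A = "{a. m a \<noteq> (\<lambda>y. 0)}"
  have "finite ?A" using assms by (simp add: PM_def)
  have "\<exists>D. \<forall>a. \<forall>y z. degree (line_poly (m a) y z) \<le> D a"
    by (intro choice allI) (rule degree_line_poly_bounded[OF PM_D[OF assms]])
  then obtain D where D: "\<And>a y z. degree (line_poly (m a) y z) \<le> D a" by blast
  have "degree (line_poly (m a) y z) \<le> sum D ?A" for a y z
  proof (cases "a \<in> ?A")
    case True
    then have "D a \<le> sum D ?A" using \<open>finite ?A\<close> by (intro member_le_sum) auto
    then show ?thesis using D[of a y z] by simp
  next
    case False
    then show ?thesis by (simp add: line_poly_const)
  qed
  then show ?thesis by blast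
qed

lemma poly_upto: "degree q \<le> D \<Longrightarrow> poly q t = (\<Sum>n\<le>D. coeff q n * t ^ n)"
  for t :: "'a::comm_ring_1"
  unfolding poly_altdef by (intro sum.mono_neutral_left) (auto simp: coeff_eq_0)

text \<open>Every sufficiently large cut-off works, so that the expansions of a vector and of its
  image can later be taken to the same length.\<close>

lemma gactp_cop:
  assumes "m \<in> PM p"
  shows "\<exists>d. \<forall>D\<ge>d. gactp p g m = (\<Sum>n\<le>D. PMG.cop p (\<lambda>i j. g i j - (if i = j then 1 else 0)) n m)"
proof -
  obtain d where d: "\<And>a y z. degree (line_poly (m a) y z) \<le> d" using PM_degree_bounded[OF assms] by blast
  let ?X = "\<lambda>i j. g i j - (if i = j then 1 else 0)"
  have "gactp p g m a y = (\<Sum>n\<le>D. PMG.cop p ?X n m a y)" if "D \<ge> d" for D a y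
  proof -
    have "gactp p g m a y = poly (line_poly (m a) y (mulp p ?X y)) 1"
      unfolding gactp_def poly_line_poly[OF PM_D[OF assms]] actp_mulp ..
    also have "\<dots> = (\<Sum>n\<le>D. coeff (line_poly (m a) y (mulp p ?X y)) n * 1 ^ n)"
      using d that order_trans by (intro poly_upto) blast
    finally show ?thesis by (simp add: coeff_line_poly[OF assms])
  qed
  then show ?thesis by (intro exI[of _ d]) (simp add: fun_eq_iff sum_fun_apply)
qed

lemma gactp_mem_submod:
  assumes "PMG.submod p N" "m \<in> N" shows "gactp p g m \<in> N"
proof -
  have "m \<in> PM p" using assms PMG.gsubD(2) by blast
  then obtain D where "gactp p g m = (\<Sum>n\<le>D. PMG.cop p (\<lambda>i j. g i j - (if i = j then 1 else 0)) n m)"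
    using gactp_cop by blast
  then show ?thesis using assms
    by (auto intro!: FS.subspace_sum PMG.gsubD(1) PMG.cop_mem)
qed

text \<open>The matrices 1 + t E_ij act polynomially in \<open>t\<close>, and the linear coefficient
  is \<open>Eop i j m\<close>. Knowing the values at positive integers \<open>t\<close> lie in
  \<open>N\<close> puts each coefficient into \<open>N\<close>.\<close>

lemma submod_of_GL_stable:
  fixes N :: "('j \<Rightarrow> ('c, 'k::field_char_0) point \<Rightarrow> 'k) set"
  assumes N: "FS.subspace N" "N \<subseteq> PM p"
    and stable: "\<And>g m. g \<in> GLp p \<Longrightarrow> m \<in> N \<Longrightarrow> gactp p g m \<in> N"
  shows "PMG.submod p N"
  unfolding PMG.submod_def
proof (intro conjI N ballI)
  fix i j :: nat and m
  assume ij: "i \<in> {1..p}" "j \<in> {1..p}" and m: "m \<in> N"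
  have mP: "m \<in> PM p" using m N(2) by blast
  obtain d where d: "\<And>a y z. degree (line_poly (m a) y z) \<le> d" using PM_degree_bounded[OF mP] by blast
  define c where "c n = (\<lambda>a y. coeff (line_poly (m a) y (shift i j y)) n)" for n
  define G :: "'k \<Rightarrow> nat \<Rightarrow> nat \<Rightarrow> 'k" where
    "G t = (\<lambda>a b. (if a = b then 1 else 0) + (if a = i \<and> b = j then t else 0))" for t
  have GG: "(\<Sum>l\<in>{1..p}. G t a l * G s l b) = (if a = b then 1 else 0)"
    if ab: "a \<in> {1..p}" "b \<in> {1..p}" and ts: "t + s + (if i = j then t * s else 0) = 0" for t s a b
  proof -
    have "(\<Sum>l\<in>{1..p}. G t a l * G s l b) = (\<Sum>l\<in>{1..p}. (if l = a then (if a = b then 1 else 0) else 0)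
       + (if l = a then (if a = i \<and> b = j then s else 0) else 0)
       + (if l = b then (if a = i \<and> b = j then t else 0) else 0)
       + (if l = i then (if a = i \<and> b = j \<and> i = j then t * s else 0) else 0))"
      by (intro sum.cong refl) (auto simp: G_def algebra_simps)
    also have "\<dots> = (if a = b then 1 else 0) + (if a = i \<and> b = j then s else 0)
       + (if a = i \<and> b = j then t else 0) + (if a = i \<and> b = j \<and> i = j then t * s else 0)"
      using ab ij by (simp add: sum.distrib)
    also have "\<dots> = (if a = b then 1 else 0)"
      using ts by (auto simp: algebra_simps)
    finally show ?thesis .
  qed
  have act: "actp p (G t) y = (\<lambda>v. y v + t * shift i j y v)" for t and y :: "('c, 'k) point"
  proof
    fix v :: "nat \<times> 'c"
    obtain k x where v: "v = (k, x)" by (cases v)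
    have "(\<Sum>l\<in>{1..p}. G t l k * y (l, x)) = y (k, x) + (if k = j then t * y (i, x) else 0)" if "k \<in> {1..p}"
    proof -
      have "(\<Sum>l\<in>{1..p}. G t l k * y (l, x))
         = (\<Sum>l\<in>{1..p}. (if l = k then y (k, x) else 0) + (if l = i then (if k = j then t * y (i, x) else 0) else 0))"
        by (intro sum.cong refl) (auto simp: G_def algebra_simps)
      then show ?thesis using that ij by (simp add: sum.distrib)
    qed
    then show "actp p (G t) y v = y v + t * shift i j y v"
      using ij by (auto simp: v actp_def shift_def)
  qed
  \<comment> \<open>The maximum with 1 keeps the linear coefficient in range even for constant
    families.\<close>
  have "(\<Sum>n\<le>max 1 d. fscale (of_nat k ^ n) (c n)) \<in> N" if k: "k \<ge> 1" for k
  proof -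
    let ?t = "of_nat k :: 'k"
    \<comment> \<open>The inverse of 1 + t E_ij is 1 + s E_ij, with s = - t off the diagonal and s =
      - t / (1 + t) on it; a positive integer \<open>t\<close> keeps the denominator
      nonzero.\<close>
    define s where "s = - ?t / (1 + (if i = j then ?t else 0))"
    have "1 + ?t \<noteq> 0" using of_nat_eq_0_iff[of "Suc k", where ?'a = 'k] by (simp add: add.commute)
    then have ts: "?t + s + (if i = j then ?t * s else 0) = 0"
      by (auto simp: s_def field_simps)
    then have st: "s + ?t + (if i = j then s * ?t else 0) = 0" by (simp add: algebra_simps split: if_splits)
    have "G ?t \<in> GLp p" unfolding GLp_def by (intro CollectI exI[of _ "G s"] conjI ballI GG ts st)
    then have "gactp p (G ?t) m \<in> N" by (rule stable[OF _ m])
    also have "gactp p (G ?t) m = (\<Sum>n\<le>max 1 d. fscale (?t ^ n) (c n))"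
    proof (intro ext)
      fix a y
      have "gactp p (G ?t) m a y = poly (line_poly (m a) y (shift i j y)) ?t"
        unfolding gactp_def act poly_line_poly[OF PM_D[OF mP]] ..
      also have "\<dots> = (\<Sum>n\<le>max 1 d. coeff (line_poly (m a) y (shift i j y)) n * ?t ^ n)"
        using d by (intro poly_upto) (simp add: le_max_iff_disj)
      finally show "gactp p (G ?t) m a y = (\<Sum>n\<le>max 1 d. fscale (?t ^ n) (c n)) a y"
        by (simp add: sum_fun_apply fscale_def c_def mult.commute)
    qed
    finally show ?thesis .
  qed
  note coeffs = this
  have "c 1 \<in> N"
  proof (rule FS.coefficients_in_subspace[OF N(1)])
    show "(\<Sum>n\<le>max 1 d. fscale (of_nat k ^ n) (c n)) \<in> N" if "k \<ge> 1" for k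
      by (rule coeffs[OF that])
    show "(of_nat n :: 'k) \<noteq> 0" if "n > 0" for n using that by simp
  qed simp
  also have "c 1 = Eop i j m" by (simp add: c_def Eop_def eop_def dir_deriv_def fun_eq_iff)
  finally show "Eop i j m \<in> N" .
qed

text \<open>The infinitesimal weight condition integrates to honest homogeneity: \<open>m\<close> is
  a combination of homogeneous families with the same eigenvalues, whose degrees must then be
  \<open>mu i\<close>. Only zero families escape this comparison, and for them the claim is
  trivial.\<close>

lemma wt_homog:
  fixes m :: "'j \<Rightarrow> ('c, 'k::field_char_0) point \<Rightarrow> 'k"
  assumes "PMG.wt p mu m" "i \<in> {1..p}"
  shows "m a (rowscale i t y) = t ^ nat (mu i) * m a y"
proof -
  let ?H = "{m. \<forall>a y. m a (rowscale i t y) = t ^ nat (mu i) * m a y} :: ('j \<Rightarrow> ('c, 'k) point \<Rightarrow> 'k) set"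
  have "m \<in> FS.span {a \<in> homvec p. \<forall>i\<in>{1..p}. Eop i i a = fscale (of_int (mu i)) a}"
  proof (rule FS.eigen_in_span[OF subspace_PM, where T = "\<lambda>i. Eop i i" and J = "{1..p}"])
    show "m \<in> FS.span (homvec p)" using PMG.wtD(1)[OF assms(1)] PM_homvec_span by blast
    show "\<exists>l. \<forall>i\<in>{1..p}. Eop i i a = fscale (l i) a" if "a \<in> homvec p" for a :: "'j \<Rightarrow> ('c, 'k) point \<Rightarrow> 'k"
    proof -
      obtain nu where "\<forall>b. homog p nu (a b)" using \<open>a \<in> homvec p\<close> by (auto simp: homvec_def)
      then show ?thesis using Eop_homog by (intro exI[of _ "\<lambda>i. of_nat (nu i)"]) blast
    qed
    show "Eop i i m = fscale (of_int (mu i)) m" if "i \<in> {1..p}" for i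
      by (rule PMG.wtD(2)[OF assms(1) that])
  qed (blast intro: PMG.E_add[of _ p] PMG.E_scale[of _ p], blast intro: PMG.E_add[of _ p] PMG.E_scale[of _ p],
    simp add: homvec_def)
  also have "\<dots> \<subseteq> ?H"
  proof (rule FS.span_minimal)
    show "FS.subspace ?H"
      unfolding FS.subspace_def by (auto simp: fscale_def algebra_simps)
    show "{a \<in> homvec p. \<forall>i\<in>{1..p}. Eop i i a = fscale (of_int (mu i)) a}
        \<subseteq> ?H"
    proof (intro subsetI CollectI allI)
      fix h :: "'j \<Rightarrow> ('c, 'k) point \<Rightarrow> 'k" and a y
      assume "h \<in> {a \<in> homvec p. \<forall>i\<in>{1..p}. Eop i i a = fscale (of_int (mu i)) a}"
      then obtain nu where h: "\<forall>b. homog p nu (h b)" "Eop i i h = fscale (of_int (mu i)) h"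
        using assms(2) by (auto simp: homvec_def)
      show "h a (rowscale i t y) = t ^ nat (mu i) * h a y"
      proof (cases "h = 0")
        case False
        have "fscale (of_nat (nu i)) h = fscale (of_int (mu i)) h"
          by (rule trans[OF Eop_homog[OF h(1) assms(2), symmetric] h(2)])
        then have "(of_nat (nu i) :: 'k) = of_int (mu i)" using False FS.scale_right_imp_eq by blast
        then have "(of_int (int (nu i)) :: 'k) = of_int (mu i)" by simp
        then have "int (nu i) = mu i" by (simp only: of_int_eq_iff)
        then have "nat (mu i) = nu i" by auto
        then show ?thesis using h(1) assms(2) by (simp add: homog_def)
      qed simp
    qed
  qed
  finally show ?thesis by blast
qed

section \<open>The direct sum side\<close>

definition part_wt :: "nat \<times> nat \<times> nat \<Rightarrow> nat \<Rightarrow> nat" where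
  "part_wt \<nu> = (case \<nu> of (a, b, c) \<Rightarrow> (\<lambda>i. if i = 1 then a else if i = 2 then b else if i = 3 then c else 0))"

lemma nparts_eq:
  assumes "is_part3 (a, b, c)"
  shows "nparts (a, b, c) = (if c \<noteq> 0 then 3 else if b \<noteq> 0 then 2 else if a \<noteq> 0 then 1 else 0)"
proof -
  have "{i\<in>{1,2,3::nat}. (if i = 1 then a else if i = 2 then b else c) \<noteq> 0}
     = (if c \<noteq> 0 then {1,2,3} else if b \<noteq> 0 then {1,2} else if a \<noteq> 0 then {1} else {})"
    using assms by (auto simp: is_part3_def)
  then show ?thesis by (simp add: nparts_def)
qed

lemma lead_minor_Pol: "r \<le> p \<Longrightarrow> lead_minor r \<in> Pol p"
proof -
  assume "r \<le> p"
  let ?g = "\<lambda>(y :: (nat, 'a) point). \<Sum>\<pi>\<in>{\<pi>. \<pi> permutes {0..<r}}. signof \<pi> * (\<Prod>i\<in>{0..<r}. y (i + 1, \<pi> i + 1))"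
  have "lead_minor r = ?g"
    unfolding lead_minor_def
    by (subst det_def'[of _ r]) (auto intro!: sum.cong prod.cong ext dest: permutes_in_image)
  also have "?g \<in> Pol p"
    using \<open>r \<le> p\<close> by (intro Pol_sum Pol.mult Pol.const Pol_prod Pol.var) auto
  finally show ?thesis .
qed

lemma lead_minor_shift:
  assumes "1 \<le> i" "i < j"
  shows "lead_minor r (\<lambda>v. y v + t * shift i j y v) = lead_minor r y"
proof (cases "j \<le> r")
  case True
  let ?A = "mat r r (\<lambda>(a, b). y (a + 1, b + 1))"
  have "mat r r (\<lambda>(a, b). y (a + 1, b + 1) + t * shift i j y (a + 1, b + 1)) = addrow t (j - 1) (i - 1) ?A"
    using assms True by (intro eq_matI) (auto simp: shift_def mat_addrow_def)
  then show ?thesis unfolding lead_minor_def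
    using assms True by (simp add: det_addrow[of _ r])
next
  case False
  have "mat r r (\<lambda>(a, b). y (a + 1, b + 1) + t * shift i j y (a + 1, b + 1)) = mat r r (\<lambda>(a, b). y (a + 1, b + 1))"
    using False by (intro eq_matI) (auto simp: shift_def)
  then show ?thesis by (simp add: lead_minor_def)
qed

lemma lead_minor_rowscale:
  assumes "1 \<le> i"
  shows "lead_minor r (rowscale i t y) = (if i \<le> r then t else 1) * lead_minor r y"
proof (cases "i \<le> r")
  case True
  let ?A = "mat r r (\<lambda>(a, b). y (a + 1, b + 1))"
  have "mat r r (\<lambda>(a, b). rowscale i t y (a + 1, b + 1)) = multrow (i - 1) t ?A"
    using assms True by (intro eq_matI) (auto simp: rowscale_def mat_multrow_def)
  then show ?thesis unfolding lead_minor_def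
    using assms True by (simp add: det_multrow[of _ r])
next
  case False
  have "mat r r (\<lambda>(a, b). rowscale i t y (a + 1, b + 1)) = mat r r (\<lambda>(a, b). y (a + 1, b + 1))"
    using False by (intro eq_matI) (auto simp: rowscale_def)
  then show ?thesis using False by (simp add: lead_minor_def)
qed

lemma lead_minor_id: "lead_minor r (\<lambda>(k, j). if k = j then 1 else 0) = 1"
proof -
  have "mat r r (\<lambda>(a, b). if a + 1 = b + 1 then 1 else (0 :: 'a)) = 1\<^sub>m r"
    by (intro eq_matI) auto
  then show ?thesis by (simp add: lead_minor_def)
qed

text \<open>The bound on the number of parts gives exponent 0 to every minor that would involve a
  row beyond \<open>p\<close>.\<close>

lemma hw_vec_Pol:
  assumes "is_part3 \<nu>" "nparts \<nu> \<le> p"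
  shows "hw_vec \<nu> \<in> Pol p"
proof -
  obtain a b c where nu: "\<nu> = (a, b, c)" by (cases \<nu>)
  have *: "(\<lambda>y. lead_minor r y ^ e) \<in> Pol p" if "e = 0 \<or> r \<le> p" for r e
    using that Pol_power[OF lead_minor_Pol] by (auto intro: Pol.const)
  have ord: "b \<le> a" "c \<le> b" using assms(1) by (auto simp: nu is_part3_def)
  have "(if c \<noteq> 0 then 3 else if b \<noteq> 0 then 2 else if a \<noteq> 0 then 1 else 0) \<le> p"
    using assms by (simp only: nu nparts_eq)
  then show ?thesis
    unfolding nu hw_vec_def prod.case using ord
    by (intro Pol.mult *) (auto split: if_splits)
qed

lemma hw_vec_shift: "1 \<le> i \<Longrightarrow> i < j \<Longrightarrow> hw_vec \<nu> (\<lambda>v. y v + t * shift i j y v) = hw_vec \<nu> y"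
  by (cases \<nu>) (simp only: hw_vec_def prod.case lead_minor_shift)

lemma hw_vec_rowscale:
  assumes "is_part3 \<nu>" "1 \<le> i"
  shows "hw_vec \<nu> (rowscale i t y) = t ^ part_wt \<nu> i * hw_vec \<nu> y"
proof -
  obtain a b c where nu: "\<nu> = (a, b, c)" by (cases \<nu>)
  have ord: "b \<le> a" "c \<le> b" using assms(1) by (auto simp: nu is_part3_def)
  have e: "t ^ a = t ^ (a - b) * (t ^ (b - c) * t ^ c)" "t ^ b = t ^ (b - c) * t ^ c"
    using ord by (simp_all add: power_add[symmetric])
  consider "i = 1" | "i = 2" | "i = 3" | "i > 3" using assms(2) by linarith
  then show ?thesis
    by cases (simp_all add: nu hw_vec_def lead_minor_rowscale part_wt_def power_mult_distrib e)
qed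

lemma hw_vec_nonzero: "hw_vec \<nu> (\<lambda>(k, j). if k = j then 1 else 0) = 1"
  by (cases \<nu>) (simp only: hw_vec_def prod.case lead_minor_id power_one mult_1)

lemma single_PM: "f \<in> Pol p \<Longrightarrow> single a f \<in> PM p"
  unfolding PM_def
  by (auto simp: single_def Pol.const intro: finite_subset[of _ "{a}"])

lemma PM_hwI:
  assumes "m \<in> PM p"
    and "\<And>a i j t y. i \<in> {1..p} \<Longrightarrow> j \<in> {1..p} \<Longrightarrow> i < j \<Longrightarrow> m a (\<lambda>v. y v + t * shift i j y v) = m a y"
    and "\<And>a i t y. i \<in> {1..p} \<Longrightarrow> m a (rowscale i t y) = t ^ mu i * m a y"
  shows "PMG.hw p (\<lambda>i. int (mu i)) m"
  unfolding PMG.hw_def PMG.wt_def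
proof (intro conjI ballI impI)
  show "Eop i i m = fscale (of_int (int (mu i))) m" if "i \<in> {1..p}" for i
    unfolding Eop_def fscale_def using assms(3)[OF that] by (intro ext) (simp add: eop_rowscale)
  show "Eop i j m = 0" if "i \<in> {1..p}" "j \<in> {1..p}" "i < j" for i j
    unfolding Eop_def zero_fun_def using assms(2)[OF that] by (intro ext eop_invariant)
qed (rule assms(1))

lemma hw_subspace_iff:
  assumes "gl_space fscale p Eop N" "N \<subseteq> PM p"
  shows "gl_space.hw fscale p Eop N mu m \<longleftrightarrow> m \<in> N \<and> PMG.hw p mu m"
  unfolding gl_space.hw_def[OF assms(1)] gl_space.wt_def[OF assms(1)] PMG.hw_def PMG.wt_def
  using assms(2) by blast

definition hw_summand :: "(nat \<times> nat \<times> nat) \<times> nat \<Rightarrow> (nat \<times> nat \<times> nat) \<times> nat \<Rightarrow> 'k::field_char_0 yfun" where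
  "hw_summand key = single key (hw_vec (fst key))"

lemma summand_okD:
  assumes "summand_ok p key"
  shows "is_part3 (fst key)" "nparts (fst key) \<le> p" "snd key < mult_so3 (fst key)"
  using assms by (cases key; simp add: summand_ok_def)+

lemma hw_summand_hw:
  assumes "summand_ok p key"
  shows "PMG.hw p (\<lambda>i. int (part_wt (fst key) i)) (hw_summand key)"
  unfolding hw_summand_def
proof (rule PM_hwI)
  show "single key (hw_vec (fst key)) \<in> PM p"
    using summand_okD[OF assms] by (intro single_PM hw_vec_Pol)
qed (use summand_okD(1)[OF assms] in \<open>auto simp: single_def hw_vec_shift hw_vec_rowscale\<close>)

lemma gact_Y_eq: "gact_Y p g f = (\<lambda>y. f (actp p g y))"
proof -
  have "act_Y p g y = actp p g y" for y by (auto simp: act_Y_def actp_def)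
  then show ?thesis by (simp add: gact_Y_def)
qed

lemma gact_D_eq: "gact_D p g \<Phi> = gactp p g \<Phi>"
  by (simp add: gact_D_def gactp_def gact_Y_eq)

text \<open>The group orbit stays in the submodule generated from one highest weight vector by
  lowering. Thus a summand has, up to scalars, only that highest weight vector.\<close>

lemma Wp_single_low:
  assumes "summand_ok p key" "f \<in> Wp p (fst key)"
  shows "single key f \<in> PMG.low p {hw_summand key}"
proof -
  have gs: "PMG.submod p (PMG.low p {hw_summand key})"
    using hw_summand_hw[OF assms(1)] by (intro PMG.submod_low) auto
  note S = PMG.gsubD(1)[OF gs]
  show ?thesis using assms(2) unfolding Wp_def
  proof induction
    case zero
    have "single key (\<lambda>y. 0) = (0 :: _ \<Rightarrow> 'a yfun)" by (auto simp: single_def fun_eq_iff)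
    then show ?case using FS.subspace_0[OF S] by metis
  next
    case (base f)
    then obtain g where "f = gact_Y p g (hw_vec (fst key))" by blast
    then have "single key f = gactp p g (hw_summand key)"
      by (auto simp: single_def hw_summand_def gactp_def gact_Y_eq)
    moreover have "hw_summand key \<in> PMG.low p {hw_summand key}" by (rule PMG.low_base) simp
    ultimately show ?case using gactp_mem_submod[OF gs, of "hw_summand key" g] by metis
  next
    case (add f g)
    have "single key (\<lambda>y. f y + g y) = single key f + single key g" by (auto simp: single_def fun_eq_iff)
    then show ?case using FS.subspace_add[OF S add.IH] by metis
  next
    case (smult f c)
    have "single key (\<lambda>y. c * f y) = fscale c (single key f)" by (auto simp: single_def fun_eq_iff fscale_def)
    then show ?case using FS.subspace_scale[OF S smult.IH] by metis
  qed
qed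

lemma Wp_Pol:
  assumes "summand_ok p key" "f \<in> Wp p (fst key)"
  shows "f \<in> Pol p"
proof -
  have "PMG.low p {hw_summand key} \<subseteq> PM p"
    using hw_summand_hw[OF assms(1)] by (intro PMG.gsubD(2) PMG.submod_low) auto
  then have "single key f \<in> PM p" using Wp_single_low[OF assms] by blast
  from PM_D[OF this, of key] show ?thesis by (simp add: single_def)
qed

lemma Wp_closed:
  "(\<lambda>y. 0) \<in> Wp p \<nu>" "f \<in> Wp p \<nu> \<Longrightarrow> g \<in> Wp p \<nu> \<Longrightarrow> (\<lambda>y. f y + g y) \<in> Wp p \<nu>"
  "f \<in> Wp p \<nu> \<Longrightarrow> (\<lambda>y. c * f y) \<in> Wp p \<nu>"
  unfolding Wp_def by (auto intro: kspan.intros)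

lemma actp_actp: "actp p h (actp p g y) = actp p (mprod p g h) y"
proof
  fix v :: "nat \<times> 'a"
  obtain k c where v: "v = (k, c)" by (cases v)
  have "(\<Sum>l\<in>{1..p}. h l k * (\<Sum>m\<in>{1..p}. g m l * y (m, c))) = (\<Sum>m\<in>{1..p}. (\<Sum>l\<in>{1..p}. g m l * h l k) * y (m, c))"
    unfolding sum_distrib_left sum_distrib_right by (subst sum.swap) (simp add: mult_ac)
  then show "actp p h (actp p g y) v = actp p (mprod p g h) y v"
    by (auto simp: v actp_def mprod_def intro!: sum.cong)
qed

lemma mprod_GLp:
  assumes "g \<in> GLp p" "h \<in> GLp p" shows "mprod p g h \<in> GLp p"
proof -
  obtain g' where g': "\<forall>i\<in>{1..p}. \<forall>j\<in>{1..p}. (\<Sum>l\<in>{1..p}. g i l * g' l j) = (if i = j then 1 else 0)"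
    "\<forall>i\<in>{1..p}. \<forall>j\<in>{1..p}. (\<Sum>l\<in>{1..p}. g' i l * g l j) = (if i = j then 1 else 0)"
    using assms(1) unfolding GLp_def by blast
  obtain h' where h': "\<forall>i\<in>{1..p}. \<forall>j\<in>{1..p}. (\<Sum>l\<in>{1..p}. h i l * h' l j) = (if i = j then 1 else 0)"
    "\<forall>i\<in>{1..p}. \<forall>j\<in>{1..p}. (\<Sum>l\<in>{1..p}. h' i l * h l j) = (if i = j then 1 else 0)"
    using assms(2) unfolding GLp_def by blast
  have assoc: "(\<Sum>l\<in>{1..p}. mprod p a b i l * mprod p c d l j)
      = (\<Sum>m\<in>{1..p}. a i m * (\<Sum>n\<in>{1..p}. (\<Sum>l\<in>{1..p}. b m l * c l n) * d n j))"
    for a b c d :: "nat \<Rightarrow> nat \<Rightarrow> 'a" and i j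
  proof -
    have "(\<Sum>l\<in>{1..p}. mprod p a b i l * mprod p c d l j)
       = (\<Sum>l\<in>{1..p}. \<Sum>m\<in>{1..p}. \<Sum>n\<in>{1..p}. a i m * b m l * (c l n * d n j))"
      by (simp add: mprod_def sum_product)
    also have "\<dots> = (\<Sum>m\<in>{1..p}. \<Sum>l\<in>{1..p}. \<Sum>n\<in>{1..p}. a i m * b m l * (c l n * d n j))"
      by (rule sum.swap)
    also have "\<dots> = (\<Sum>m\<in>{1..p}. \<Sum>n\<in>{1..p}. \<Sum>l\<in>{1..p}. a i m * b m l * (c l n * d n j))"
      by (intro sum.cong refl sum.swap)
    also have "\<dots> = (\<Sum>m\<in>{1..p}. a i m * (\<Sum>n\<in>{1..p}. (\<Sum>l\<in>{1..p}. b m l * c l n) * d n j))"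
      by (simp add: sum_distrib_left sum_distrib_right mult_ac)
    finally show ?thesis .
  qed
  have inv: "(\<Sum>l\<in>{1..p}. mprod p a b i l * mprod p c d l j) = (if i = j then 1 else 0)"
    if bc: "\<forall>i\<in>{1..p}. \<forall>j\<in>{1..p}. (\<Sum>l\<in>{1..p}. b i l * c l j) = (if i = j then 1 else 0)"
      and ad: "\<forall>i\<in>{1..p}. \<forall>j\<in>{1..p}. (\<Sum>l\<in>{1..p}. a i l * d l j) = (if i = j then 1 else 0)"
      and ij: "i \<in> {1..p}" "j \<in> {1..p}"
    for a b c d :: "nat \<Rightarrow> nat \<Rightarrow> 'a" and i j
  proof -
    have "(\<Sum>n\<in>{1..p}. (\<Sum>l\<in>{1..p}. b m l * c l n) * d n j) = d m j" if m: "m \<in> {1..p}" for m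
    proof -
      have "(\<Sum>n\<in>{1..p}. (\<Sum>l\<in>{1..p}. b m l * c l n) * d n j) = (\<Sum>n\<in>{1..p}. if n = m then d n j else 0)"
        using bc m by (intro sum.cong) auto
      then show ?thesis using m by simp
    qed
    then show ?thesis unfolding assoc using ad ij by simp
  qed
  show ?thesis unfolding GLp_def
    by (intro CollectI exI[of _ "mprod p h' g'"] conjI ballI inv)
      (use g' h' in blast)+
qed

lemma Wp_stable: "g \<in> GLp p \<Longrightarrow> f \<in> Wp p \<nu> \<Longrightarrow> gact_Y p g f \<in> Wp p \<nu>"
proof -
  assume g: "g \<in> GLp p" and "f \<in> Wp p \<nu>"
  from this(2) show ?thesis unfolding Wp_def
  proof induction
    case (base f)
    then obtain h where h: "h \<in> GLp p" "f = gact_Y p h (hw_vec \<nu>)" by blast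
    have "gact_Y p g f = gact_Y p (mprod p g h) (hw_vec \<nu>)"
      using h(2) by (simp add: gact_Y_eq actp_actp)
    then show ?case using mprod_GLp[OF g h(1)] by (intro kspan.base) blast
  qed (auto simp: gact_Y_def intro: kspan.intros)
qed

lemma DSumI:
  assumes "finite {key. D key \<noteq> (\<lambda>y. 0)}" "\<And>key. summand_ok p key \<Longrightarrow> D key \<in> Wp p (fst key)"
    "\<And>key. \<not> summand_ok p key \<Longrightarrow> D key = (\<lambda>y. 0)"
  shows "D \<in> DSum p"
  unfolding DSum_def
proof (intro CollectI conjI allI assms(1))
  show "if summand_ok p key then D key \<in> Wp p (fst key) else D key = (\<lambda>y. 0)" for key
    using assms(2,3)[of key] by presburger
qed

lemma DSumD:
  assumes "D \<in> DSum p"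
  shows "finite {key. D key \<noteq> (\<lambda>y. 0)}" "summand_ok p key \<Longrightarrow> D key \<in> Wp p (fst key)"
    "\<not> summand_ok p key \<Longrightarrow> D key = (\<lambda>y. 0)"
proof -
  show "finite {key. D key \<noteq> (\<lambda>y. 0)}" using assms by (simp add: DSum_def)
  have "if summand_ok p key then D key \<in> Wp p (fst key) else D key = (\<lambda>y. 0)"
    using assms unfolding DSum_def by blast
  then show "summand_ok p key \<Longrightarrow> D key \<in> Wp p (fst key)" "\<not> summand_ok p key \<Longrightarrow> D key = (\<lambda>y. 0)"
    by simp_all
qed

lemma DSum_PM: "DSum p \<subseteq> PM p"
proof
  fix D :: "_ \<Rightarrow> 'a yfun" assume D: "D \<in> DSum p"
  have "D key \<in> Pol p" for key
  proof (cases "summand_ok p key")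
    case True
    then show ?thesis using Wp_Pol DSumD(2)[OF D] by blast
  next
    case False
    then show ?thesis using DSumD(3)[OF D] Pol.const by metis
  qed
  then show "D \<in> PM p" using DSumD(1)[OF D] by (simp add: PM_def)
qed

lemma subspace_DSum: "FS.subspace (DSum p :: ((nat \<times> nat \<times> nat) \<times> nat \<Rightarrow> 'k::field_char_0 yfun) set)"
  unfolding FS.subspace_def
proof (intro conjI ballI allI)
  show "(0 :: _ \<Rightarrow> 'k yfun) \<in> DSum p"
    by (rule DSumI) (simp_all add: zero_fun_def Wp_closed)
  fix D D' :: "_ \<Rightarrow> 'k yfun" and c
  assume D: "D \<in> DSum p"
  show "D + D' \<in> DSum p" if D': "D' \<in> DSum p"
  proof (rule DSumI)
    show "finite {key. (D + D') key \<noteq> (\<lambda>y. 0)}"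
      by (rule finite_subset[OF _ finite_UnI[OF DSumD(1)[OF D] DSumD(1)[OF D']]]) auto
  qed (use DSumD[OF D] DSumD[OF D'] in \<open>auto simp: plus_fun_def intro: Wp_closed\<close>)
  show "fscale c D \<in> DSum p"
  proof (rule DSumI)
    show "finite {key. fscale c D key \<noteq> (\<lambda>y. 0)}"
      by (rule finite_subset[OF _ DSumD(1)[OF D]]) (auto simp: fscale_def)
  qed (use DSumD[OF D] in \<open>auto simp: fscale_def intro: Wp_closed\<close>)
qed

lemma DSum_stable: "g \<in> GLp p \<Longrightarrow> D \<in> DSum p \<Longrightarrow> gactp p g D \<in> DSum p"
proof (rule DSumI)
  assume g: "g \<in> GLp p" and D: "D \<in> DSum p"
  show "finite {key. gactp p g D key \<noteq> (\<lambda>y. 0)}"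
    by (rule finite_subset[OF _ DSumD(1)[OF D]]) (auto simp: gactp_def)
  show "gactp p g D key \<in> Wp p (fst key)" if "summand_ok p key" for key
    using Wp_stable[OF g DSumD(2)[OF D that]] by (simp add: gactp_def gact_Y_eq)
  show "gactp p g D key = (\<lambda>y. 0)" if "\<not> summand_ok p key" for key
    using DSumD(3)[OF D that] by (simp add: gactp_def)
qed

lemma gl_space_of_stable:
  assumes "FS.subspace N" "N \<subseteq> PM p" "\<And>g m. g \<in> GLp p \<Longrightarrow> m \<in> N \<Longrightarrow> gactp p g m \<in> N"
  shows "gl_space fscale p Eop N"
proof (rule gl_space_subspace[OF assms(1,2)])
  have "PMG.submod p N" by (rule submod_of_GL_stable[OF assms])
  then show "Eop i j m \<in> N" if "i \<in> {1..p}" "j \<in> {1..p}" "m \<in> N" for i j m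
    using that by (rule PMG.gsubD(3))
qed

lemma gl_space_DSum: "gl_space fscale p Eop (DSum p)"
  by (intro gl_space_of_stable subspace_DSum DSum_PM DSum_stable)

lemma one_GLp: "(\<lambda>i j. if i = j then 1 else (0 :: 'a::field)) \<in> GLp p"
proof -
  have "(\<Sum>l\<in>{1..p}. (if i = l then 1 else 0) * (if l = j then 1 else 0)) = (if i = j then (1 :: 'a) else 0)"
    if "i \<in> {1..p}" for i j
  proof -
    have "(\<Sum>l\<in>{1..p}. (if i = l then 1 else 0) * (if l = j then 1 else 0))
        = (\<Sum>l\<in>{1..p}. if l = i then (if i = j then (1 :: 'a) else 0) else 0)"
      by (intro sum.cong) auto
    then show ?thesis using that by simp
  qed
  then show ?thesis unfolding GLp_def
    by (intro CollectI exI[of _ "\<lambda>i j. if i = j then 1 else 0"] conjI ballI)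
qed

lemma hw_vec_Wp: "hw_vec \<nu> \<in> Wp p \<nu>"
proof -
  let ?g = "\<lambda>i j. if i = j then (1::'a) else 0"
  have "actp p ?g y = y" for y :: "(nat, 'a) point"
    by (auto simp: actp_def fun_eq_iff if_distrib[of "\<lambda>x. x * _"] cong: if_cong)
  then have "hw_vec \<nu> = gact_Y p ?g (hw_vec \<nu>)" by (simp add: gact_Y_eq)
  then show ?thesis unfolding Wp_def using one_GLp by (intro kspan.base) blast
qed

lemma hw_summand_DSum: "summand_ok p key \<Longrightarrow> hw_summand key \<in> DSum p"
  unfolding hw_summand_def
  by (rule DSumI) (auto simp: single_def hw_vec_Wp Wp_closed intro: finite_subset[of _ "{key}"])

text \<open>Distinct labels have disjoint supports, and at the identity matrix all leading minors
  are 1.\<close>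

lemma hw_summand_independent:
  assumes "finite J" "(\<Sum>k\<in>J. fscale (c k) (hw_summand k)) = 0"
  shows "\<forall>k\<in>J. c k = 0"
proof
  fix k0 assume k0: "k0 \<in> J"
  let ?y = "\<lambda>(k, j). if k = j then (1::'a) else 0"
  have "0 = (\<Sum>k\<in>J. fscale (c k) (hw_summand k)) k0 ?y" using assms(2) by simp
  also have "\<dots> = (\<Sum>k\<in>J. if k = k0 then c k else 0)"
    unfolding sum_fun_apply
    by (intro sum.cong refl) (auto simp: fscale_def hw_summand_def single_def hw_vec_nonzero)
  also have "\<dots> = c k0" using k0 assms(1) by simp
  finally show "c k0 = 0" by simp
qed

lemma DSum_hw_span:
  assumes D: "D \<in> DSum p" "PMG.hw p mu D"
  shows "D \<in> FS.span (hw_summand ` {key. summand_ok p key})"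
proof -
  let ?S = "FS.span (hw_summand ` {key. summand_ok p key})"
  let ?A = "{key. D key \<noteq> (\<lambda>y. 0)}"
  have comp: "single key (D key) \<in> ?S" if "D key \<noteq> (\<lambda>y. 0)" for key
  proof -
    have ok: "summand_ok p key" using that DSumD(3)[OF D(1)] by blast
    have E: "Eop i j (single key (D key)) = single key (Eop i j D key)" for i j
      by (auto simp: Eop_def single_def eop_const)
    have "PMG.hw p mu (single key (D key))"
      unfolding PMG.hw_def PMG.wt_def
    proof (intro conjI ballI impI)
      show "single key (D key) \<in> PM p" by (rule single_PM[OF PM_D[OF subsetD[OF DSum_PM D(1)]]])
      show "Eop i i (single key (D key)) = fscale (of_int (mu i)) (single key (D key))" if "i \<in> {1..p}" for i
        unfolding E PMG.hwD(3)[OF D(2) that] by (auto simp: single_def fscale_def)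
      show "Eop i j (single key (D key)) = 0" if "i \<in> {1..p}" "j \<in> {1..p}" "i < j" for i j
        unfolding E PMG.hwD(4)[OF D(2) that] by (auto simp: single_def fun_eq_iff)
    qed
    moreover have "\<exists>nu. PMG.hw p nu s" if "s \<in> {hw_summand key}" for s using hw_summand_hw[OF ok] that by blast
    ultimately have "single key (D key) \<in> FS.span {hw_summand key}"
      by (intro PMG.hw_in_low[OF _ Wp_single_low[OF ok DSumD(2)[OF D(1) ok]]])
    also have "\<dots> \<subseteq> ?S" using ok by (intro FS.span_mono) auto
    finally show ?thesis .
  qed
  have "D = (\<Sum>key\<in>?A. single key (D key))"
  proof (intro ext)
    fix b y
    have "(\<Sum>key\<in>?A. single key (D key)) b y = (\<Sum>key\<in>?A. if key = b then D b y else 0)"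
      unfolding sum_fun_apply by (intro sum.cong) (auto simp: single_def)
    also have "\<dots> = D b y" using DSumD(1)[OF D(1)] by (cases "D b = (\<lambda>y. 0)") auto
    finally show "D b y = (\<Sum>key\<in>?A. single key (D key)) b y" by simp
  qed
  also have "\<dots> \<in> ?S" by (intro FS.span_sum comp) simp
  finally show ?thesis .
qed

section \<open>The algebra generated by generic skew-symmetric matrices\<close>

declare One_nat_def [simp del]

text \<open>Equal entries mean \<open>sl_2\<close> weight 0. Then \<open>E j i v\<close> is
  annihilated by \<open>E i j\<close>, while its weight is smaller at \<open>i\<close> than at
  \<open>j\<close>, which only the zero vector allows.\<close>

lemma (in gl_space) hw_flat:
  assumes v: "hw mu v" and ij: "i \<in> {1..p}" "j \<in> {1..p}" "i < j" and eq: "mu i = mu j"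
  shows "E j i v = 0"
proof -
  have "E i j (E j i v) = E j i (E i j v) + (if j = j then E i i v else 0) - (if i = i then E j j v else 0)"
    using ij hwD(2)[OF v] by (intro E_comm)
  also have "\<dots> = 0" using hwD(3,4)[OF v] ij eq E_zero by simp
  finally have "E i j (E j i v) \<in> {0}" by simp
  moreover have "shift_wt mu j i i < shift_wt mu j i j" using ij eq by (simp add: shift_wt_def)
  ultimately have "E j i v \<in> {0}"
    using nondominant_mem[OF submod_zero wt_E[OF hwD(1)[OF v] ij(2,1)] ij(1,2)] ij(3) by blast
  then show ?thesis by simp
qed

text \<open>Matrices are total functions on indices; \<open>supp3\<close> holds when the entries outside \<open>1..3\<close> vanish, so
  that \<open>mat3_one\<close> is neutral.\<close>

definition supp3 :: "(nat \<Rightarrow> nat \<Rightarrow> 'k::comm_ring_1) \<Rightarrow> bool" where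
  "supp3 A \<longleftrightarrow> (\<forall>i j. i \<notin> {1..3} \<or> j \<notin> {1..3} \<longrightarrow> A i j = 0)"

lemma set13: "{1..3::nat} = {1, 2, 3}"
  by auto

lemma mat3_mult_expand: "mat3_mult A B i j = A i 1 * B 1 j + A i 2 * B 2 j + A i 3 * B 3 j"
  by (simp add: mat3_mult_def set13 add.assoc del: One_nat_def)

lemma mat3_mult_assoc: "mat3_mult (mat3_mult A B) C = mat3_mult A (mat3_mult B C)"
  by (intro ext) (simp add: mat3_mult_expand algebra_simps)

lemma supp3_mult: "supp3 A \<Longrightarrow> supp3 B \<Longrightarrow> supp3 (mat3_mult A B)"
  unfolding supp3_def mat3_mult_expand by auto

lemma supp3_one: "supp3 mat3_one"
  by (auto simp: supp3_def mat3_one_def)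

lemma supp3_eqI:
  assumes "supp3 A" "supp3 B" "\<And>i j. i \<in> {1, 2, 3} \<Longrightarrow> j \<in> {1, 2, 3} \<Longrightarrow> A i j = B i j"
  shows "A = B"
proof (intro ext)
  fix i j show "A i j = B i j"
    using assms unfolding supp3_def set13 by (cases "i \<in> {1, 2, 3} \<and> j \<in> {1, 2, 3}") metis+
qed

lemma supp3_entries_eqI:
  assumes "supp3 A" "supp3 B" "A 1 1 = B 1 1" "A 1 2 = B 1 2" "A 1 3 = B 1 3" "A 2 1 = B 2 1" "A 2 2 = B 2 2"
    "A 2 3 = B 2 3" "A 3 1 = B 3 1" "A 3 2 = B 3 2" "A 3 3 = B 3 3"
  shows "A = B"
proof (rule supp3_eqI[OF assms(1,2)])
  fix i j :: nat assume "i \<in> {1, 2, 3}" "j \<in> {1, 2, 3}"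
  then show "A i j = B i j" by (elim insertE emptyE) (simp_all only: assms)
qed

lemma mat3_one_left: "supp3 A \<Longrightarrow> mat3_mult mat3_one A = A"
  by (rule supp3_eqI[OF supp3_mult[OF supp3_one]]) (auto simp: mat3_mult_expand mat3_one_def)

lemma mat3_one_right: "supp3 A \<Longrightarrow> mat3_mult A mat3_one = A"
  by (rule supp3_eqI[OF supp3_mult[OF _ supp3_one]]) (auto simp: mat3_mult_expand mat3_one_def)

lemma mat3_mult_add_left: "mat3_mult (\<lambda>i j. A i j + B i j) C = (\<lambda>i j. mat3_mult A C i j + mat3_mult B C i j)"
  by (intro ext) (simp add: mat3_mult_expand algebra_simps)

lemma mat3_mult_add_right: "mat3_mult C (\<lambda>i j. A i j + B i j) = (\<lambda>i j. mat3_mult C A i j + mat3_mult C B i j)"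
  by (intro ext) (simp add: mat3_mult_expand algebra_simps)

lemma mat3_mult_scale_left: "mat3_mult (\<lambda>i j. c * A i j) C = (\<lambda>i j. c * mat3_mult A C i j)"
  by (intro ext) (simp add: mat3_mult_expand algebra_simps)

lemma mat3_mult_scale_right: "mat3_mult C (\<lambda>i j. c * A i j) = (\<lambda>i j. c * mat3_mult C A i j)"
  by (intro ext) (simp add: mat3_mult_expand algebra_simps)

lemma supp3_gen_skew: "supp3 (gen_skew k x)"
  by (auto simp: supp3_def gen_skew_def)

lemma Fp_supp3: "F \<in> Fp p \<Longrightarrow> supp3 (F x)"
proof (induction rule: Fp.induct)
  case (mult F G)
  then show ?case by (simp add: supp3_mult)
qed (simp_all add: supp3_one supp3_gen_skew, simp_all add: supp3_def)

lemma Fp_Pol: "F \<in> Fp p \<Longrightarrow> (\<lambda>x. F x i j) \<in> Pol p"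
proof (induction arbitrary: i j rule: Fp.induct)
  case (gen k)
  consider "1 \<le> i \<and> i < j \<and> j \<le> 3" | "\<not> (1 \<le> i \<and> i < j \<and> j \<le> 3) \<and> (1 \<le> j \<and> j < i \<and> i \<le> 3)"
    | "\<not> (1 \<le> i \<and> i < j \<and> j \<le> 3) \<and> \<not> (1 \<le> j \<and> j < i \<and> i \<le> 3)" by blast
  then show ?case
    by cases (use gen in \<open>simp_all only: gen_skew_def if_True if_False simp_thms,
        auto intro!: Pol.var Pol_uminus Pol.const\<close>)
qed (auto simp: mat3_mult_expand intro!: Pol.intros)

section \<open>The algebra \<open>Fp\<close> as a module\<close>

definition entry_fun :: "'k matfun \<Rightarrow> nat \<times> nat \<Rightarrow> 'k tpoint \<Rightarrow> 'k" where
  "entry_fun F = (\<lambda>(i, j) x. F x i j)"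

text \<open>Matrix functions recast as families indexed by positions, the form to which the theory
  of \<open>PM\<close> applies.\<close>

definition FM :: "nat \<Rightarrow> (nat \<times> nat \<Rightarrow> 'k::field_char_0 tpoint \<Rightarrow> 'k) set" where
  "FM p = entry_fun ` Fp p"

lemma entry_fun_apply: "entry_fun F (i, j) = (\<lambda>x. F x i j)"
  by (simp add: entry_fun_def)

lemma inj_entry_fun: "inj entry_fun"
  by (rule injI) (simp add: entry_fun_def fun_eq_iff)

lemma entry_fun_PM:
  fixes F :: "'k::field_char_0 matfun"
  assumes "F \<in> Fp p" shows "entry_fun F \<in> PM p"
proof -
  have "{a. entry_fun F a \<noteq> (\<lambda>y. 0)} \<subseteq> {1..3} \<times> {1..3}"
    using Fp_supp3[OF assms] by (fastforce simp: entry_fun_def supp3_def fun_eq_iff)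
  then have "finite {a. entry_fun F a \<noteq> (\<lambda>y. 0)}" by (rule finite_subset) simp
  then show ?thesis using Fp_Pol[OF assms] by (auto simp: PM_def entry_fun_def)
qed

lemma Fp_zero: "(\<lambda>x i j. 0) \<in> Fp p"
  using Fp.smult[OF Fp.one, where c = 0] by simp

lemma Fp_sum: "(\<And>a. a \<in> A \<Longrightarrow> F a \<in> Fp p) \<Longrightarrow> (\<lambda>x i j. \<Sum>a\<in>A. F a x i j) \<in> Fp p"
  by (induction A rule: infinite_finite_induct) (auto intro: Fp_zero Fp.add)

lemma Fp_diff: "F \<in> Fp p \<Longrightarrow> G \<in> Fp p \<Longrightarrow> (\<lambda>x i j. F x i j - G x i j) \<in> Fp p"
  using Fp.add[OF _ Fp.smult[where F = G and c = "-1"]] by simp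

lemma Fp_mono: "F \<in> Fp p \<Longrightarrow> p \<le> p' \<Longrightarrow> F \<in> Fp p'"
  by (induction rule: Fp.induct) (auto intro: Fp.intros)

lemma act_T_actp: "act_T p g x = actp p g x"
  by (auto simp: act_T_def actp_def)

lemma gact_F_Fp: "F \<in> Fp p \<Longrightarrow> gact_F p g F \<in> Fp p"
proof (induction rule: Fp.induct)
  case one
  then show ?case by (simp add: gact_F_def Fp.one)
next
  case (gen k)
  have "gact_F p g (\<lambda>x. gen_skew k x) = (\<lambda>x i j. \<Sum>l\<in>{1..p}. g l k * gen_skew l x i j)"
    using gen by (auto simp: gact_F_def gen_skew_def act_T_def fun_eq_iff sum_negf)
  also have "\<dots> \<in> Fp p" by (intro Fp_sum Fp.smult Fp.gen) auto
  finally show ?case .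
qed (simp_all add: gact_F_def Fp.intros)

lemma gactp_entry_fun: "gactp p g (entry_fun F) = entry_fun (gact_F p g F)"
  by (auto simp: gactp_def entry_fun_def gact_F_def act_T_actp)

lemma subspace_FM: "FS.subspace (FM p :: (nat \<times> nat \<Rightarrow> 'k::field_char_0 tpoint \<Rightarrow> 'k) set)"
  unfolding FS.subspace_def
proof (intro conjI ballI allI)
  have "0 = entry_fun (\<lambda>x i j. 0 :: 'k)" by (auto simp: entry_fun_def fun_eq_iff)
  then show "(0 :: nat \<times> nat \<Rightarrow> 'k tpoint \<Rightarrow> 'k) \<in> FM p" unfolding FM_def using Fp_zero by blast
  fix x y :: "nat \<times> nat \<Rightarrow> 'k tpoint \<Rightarrow> 'k" and c
  assume "x \<in> FM p"
  then obtain F where F: "x = entry_fun F" "F \<in> Fp p" unfolding FM_def by blast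
  show "x + y \<in> FM p" if y: "y \<in> FM p"
  proof -
    obtain G where G: "y = entry_fun G" "G \<in> Fp p" using y unfolding FM_def by blast
    have "x + y = entry_fun (\<lambda>x i j. F x i j + G x i j)"
    proof (intro ext)
      fix a z show "(x + y) a z = entry_fun (\<lambda>x i j. F x i j + G x i j) a z"
        by (cases a) (simp add: F G entry_fun_apply)
    qed
    then show ?thesis unfolding FM_def using Fp.add[OF F(2) G(2)] by blast
  qed
  have "fscale c x = entry_fun (\<lambda>x i j. c * F x i j)"
  proof (intro ext)
    fix a z show "fscale c x a z = entry_fun (\<lambda>x i j. c * F x i j) a z"
      by (cases a) (simp add: F entry_fun_apply fscale_apply)
  qed
  then show "fscale c x \<in> FM p" unfolding FM_def using Fp.smult[OF F(2)] by blast
qed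

lemma FM_PM: "FM p \<subseteq> PM p"
  unfolding FM_def using entry_fun_PM by blast

lemma gl_space_FM: "gl_space fscale p Eop (FM p :: (nat \<times> nat \<Rightarrow> 'k::field_char_0 tpoint \<Rightarrow> 'k) set)"
proof (intro gl_space_of_stable subspace_FM FM_PM)
  fix g :: "nat \<Rightarrow> nat \<Rightarrow> 'k" and m :: "nat \<times> nat \<Rightarrow> 'k tpoint \<Rightarrow> 'k" assume "m \<in> FM p"
  then obtain F where F: "m = entry_fun F" "F \<in> Fp p" unfolding FM_def by blast
  show "gactp p g m \<in> FM p" unfolding FM_def F(1) gactp_entry_fun using gact_F_Fp[OF F(2)] by (rule imageI)
qed

lemma Fp_cong:
  assumes "F \<in> Fp p" "\<And>k. k \<in> {1..p} \<Longrightarrow> gen_skew k x = gen_skew k x'"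
  shows "F x = F x'"
  using assms by (induction rule: Fp.induct) auto

text \<open>The functions satisfying R F(x) = F(x') R form an algebra, so generators suffice. This
  transports rotations of the vectors to conjugations of the value.\<close>

lemma Fp_intertwine:
  assumes "F \<in> Fp p" "supp3 R" "\<And>k. k \<in> {1..p} \<Longrightarrow> mat3_mult R (gen_skew k x) = mat3_mult (gen_skew k x') R"
  shows "mat3_mult R (F x) = mat3_mult (F x') R"
  using assms(1)
proof (induction rule: Fp.induct)
  case (mult F G)
  have "mat3_mult R (mat3_mult (F x) (G x)) = mat3_mult (mat3_mult R (F x)) (G x)" by (simp add: mat3_mult_assoc)
  also have "\<dots> = mat3_mult (F x') (mat3_mult R (G x))" by (simp add: mult.IH mat3_mult_assoc)
  finally show ?case by (simp add: mult.IH mat3_mult_assoc)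
qed (simp_all add: mat3_one_left mat3_one_right assms mat3_mult_add_left mat3_mult_add_right
    mat3_mult_scale_left mat3_mult_scale_right)

text \<open>The integrated form of a highest weight condition: adding an earlier row to a later one
  changes nothing, and rescaling row \<open>i\<close> multiplies by a power.\<close>

definition hw_fun :: "nat \<Rightarrow> (nat \<Rightarrow> nat) \<Rightarrow> 'k::field_char_0 matfun \<Rightarrow> bool" where
  "hw_fun p mu F \<longleftrightarrow> F \<in> Fp p
    \<and> (\<forall>i\<in>{1..p}. \<forall>j\<in>{1..p}. i < j \<longrightarrow> (\<forall>t x. F (\<lambda>v. x v + t * shift i j x v) = F x))
    \<and> (\<forall>i\<in>{1..p}. \<forall>t x a b. F (rowscale i t x) a b = t ^ mu i * F x a b)"

lemma hw_fun_D:
  assumes "hw_fun p mu F"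
  shows "F \<in> Fp p" "i \<in> {1..p} \<Longrightarrow> j \<in> {1..p} \<Longrightarrow> i < j \<Longrightarrow> F (\<lambda>v. x v + t * shift i j x v) = F x"
    "i \<in> {1..p} \<Longrightarrow> F (rowscale i t x) a b = t ^ mu i * F x a b"
  using assms by (auto simp: hw_fun_def)

lemma hw_of_hw_fun: "hw_fun p mu F \<Longrightarrow> PMG.hw p (\<lambda>i. int (mu i)) (entry_fun F)"
proof (rule PM_hwI)
  assume F: "hw_fun p mu F"
  show "entry_fun F \<in> PM p" by (rule entry_fun_PM[OF hw_fun_D(1)[OF F]])
qed (auto simp: entry_fun_def hw_fun_D)

lemma hw_fun_of_hw:
  assumes "F \<in> Fp p" "PMG.hw p mu (entry_fun F)"
  shows "hw_fun p (\<lambda>i. nat (mu i)) F"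
  unfolding hw_fun_def
proof (intro conjI ballI impI allI assms(1))
  fix i j t x assume ij: "i \<in> {1..p}" "j \<in> {1..p}" "i < j"
  have "eop i j (\<lambda>x. F x a b) y = 0" for a b y
  proof -
    have "Eop i j (entry_fun F) (a, b) y = 0" by (simp only: PMG.hwD(4)[OF assms(2) ij] zero_fun_apply)
    then show ?thesis by (simp add: Eop_def entry_fun_apply)
  qed
  then show "F (\<lambda>v. x v + t * shift i j x v) = F x"
    using invariant_of_eop[OF Fp_Pol[OF assms(1)]] ij(3) by (intro ext) simp
next
  fix i t x a b assume i: "i \<in> {1..p}"
  show "F (rowscale i t x) a b = t ^ nat (mu i) * F x a b"
    using wt_homog[OF PMG.hwD(1)[OF assms(2)] i, of "(a, b)" t x] by (simp add: entry_fun_apply)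
qed

lemma hw_fun_flat:
  assumes F: "hw_fun p mu F" and ij: "i \<in> {1..p}" "j \<in> {1..p}" "i < j" "mu i = mu j"
  shows "F (\<lambda>v. x v + t * shift j i x v) = F x"
proof -
  have "Eop j i (entry_fun F) = 0" by (rule PMG.hw_flat[OF hw_of_hw_fun[OF F] ij(1-3)]) (simp add: ij)
  then have "Eop j i (entry_fun F) (a, b) y = 0" for a b y by (simp only: zero_fun_apply)
  then have "eop j i (\<lambda>x. F x a b) y = 0" for a b y by (simp add: Eop_def entry_fun_apply)
  then show ?thesis
    using invariant_of_eop[OF Fp_Pol[OF hw_fun_D(1)[OF F]]] ij(3) by (intro ext) simp
qed

lemma hw_fun_dominant:
  assumes F: "hw_fun p mu F" and "F \<noteq> (\<lambda>x i j. 0)" and ij: "i \<in> {1..p}" "j \<in> {1..p}" "i < j"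
  shows "mu j \<le> mu i"
proof -
  have "entry_fun F \<noteq> 0"
  proof
    assume "entry_fun F = 0"
    then have "entry_fun F (a, b) x = 0" for a b x by (simp only: zero_fun_apply)
    then show False using assms(2) by (simp add: entry_fun_apply fun_eq_iff)
  qed
  then have "dominant p (\<lambda>i. int (mu i))" using PMG.hw_dominant[OF hw_of_hw_fun[OF F]] by blast
  then show ?thesis using ij by (auto simp: dominant_def)
qed

text \<open>Elements of \<open>Fp p\<close> ignore rows beyond \<open>p\<close>, so those rows get
  weight 0. This is the passage from \<open>p < 3\<close> to three vectors.\<close>

lemma hw_fun_extend:
  assumes F: "hw_fun p mu F" and "p \<le> P"
  shows "hw_fun P (\<lambda>i. if i \<le> p then mu i else 0) F"
  unfolding hw_fun_def
proof (intro conjI ballI impI allI)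
  note Fp = hw_fun_D(1)[OF F]
  show "F \<in> Fp P" by (rule Fp_mono[OF Fp assms(2)])
  fix i t x assume i: "i \<in> {1..P}"
  show "F (\<lambda>v. x v + t * shift i j x v) = F x" if "j \<in> {1..P}" "i < j" for j
  proof (cases "j \<le> p")
    case True
    then show ?thesis using hw_fun_D(2)[OF F] i that by simp
  next
    case False
    then show ?thesis
      by (intro Fp_cong[OF Fp]) (auto simp: gen_skew_def shift_def fun_eq_iff)
  qed
  fix a b
  show "F (rowscale i t x) a b = t ^ (if i \<le> p then mu i else 0) * F x a b"
  proof (cases "i \<le> p")
    case True
    then show ?thesis using hw_fun_D(3)[OF F] i by simp
  next
    case False
    then have "F (rowscale i t x) = F x"
      by (intro Fp_cong[OF Fp]) (auto simp: gen_skew_def rowscale_def fun_eq_iff)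
    then show ?thesis using False by simp
  qed
qed

section \<open>Vector coordinates and clearing of redundant rows\<close>

definition of_rows :: "(nat \<Rightarrow> nat \<Rightarrow> 'k::field_char_0) \<Rightarrow> 'k tpoint" where
  "of_rows u = (\<lambda>(k, i, j). if i = 2 \<and> j = 3 then - u k 1 else if i = 1 \<and> j = 3 then u k 2
     else if i = 1 \<and> j = 2 then - u k 3 else 0)"

text \<open>The vector (- t_23, t_13, - t_12), with signs chosen so that the generic matrix maps x
  to the cross product of this vector with x.\<close>

definition rows :: "'k::field_char_0 tpoint \<Rightarrow> nat \<Rightarrow> nat \<Rightarrow> 'k" where
  "rows x k c = (if c = 1 then - x (k, 2, 3) else if c = 2 then x (k, 1, 3) else - x (k, 1, 2))"

definition skew :: "(nat \<Rightarrow> 'k::field_char_0) \<Rightarrow> nat \<Rightarrow> nat \<Rightarrow> 'k" where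
  "skew v = (\<lambda>i j. if i = 1 \<and> j = 2 then - v 3 else if i = 2 \<and> j = 1 then v 3
     else if i = 1 \<and> j = 3 then v 2 else if i = 3 \<and> j = 1 then - v 2
     else if i = 2 \<and> j = 3 then - v 1 else if i = 3 \<and> j = 2 then v 1 else 0)"

lemma supp3_skew: "supp3 (skew v)"
  by (auto simp: supp3_def skew_def)

lemma gen_skew_of_rows: "gen_skew k (of_rows u) = skew (u k)"
  by (rule supp3_entries_eqI[OF supp3_gen_skew supp3_skew]) (simp_all add: gen_skew_def of_rows_def skew_def)

lemma gen_skew_rows: "gen_skew k x = skew (rows x k)"
  by (rule supp3_entries_eqI[OF supp3_gen_skew supp3_skew]) (simp_all add: gen_skew_def rows_def skew_def)

lemma Fp_of_rows_rows: "F \<in> Fp p \<Longrightarrow> F (of_rows (rows x)) = F x"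
  by (rule Fp_cong) (simp_all only: gen_skew_of_rows gen_skew_rows[of _ x])

lemma skew_cong:
  assumes "\<And>c. c \<in> {1, 2, 3} \<Longrightarrow> v c = w c" shows "skew v = skew w"
proof -
  have *: "v 1 = w 1" "v 2 = w 2" "v 3 = w 3" using assms by blast+
  show ?thesis unfolding skew_def * ..
qed

lemma Fp_of_rows_cong:
  assumes "F \<in> Fp p" "\<And>k c. k \<in> {1..p} \<Longrightarrow> c \<in> {1, 2, 3} \<Longrightarrow> u k c = u' k c"
  shows "F (of_rows u) = F (of_rows u')"
  using assms(2) by (intro Fp_cong[OF assms(1)]) (auto simp: gen_skew_of_rows intro!: skew_cong)

lemma of_rows_addrow: "of_rows (u(j := \<lambda>c. u j c + t * u i c)) = (\<lambda>v. of_rows u v + t * shift i j (of_rows u) v)"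
  by (auto simp: of_rows_def shift_def fun_eq_iff)

lemma of_rows_scalerow: "of_rows (u(i := \<lambda>c. t * u i c)) = rowscale i t (of_rows u)"
  by (auto simp: of_rows_def rowscale_def fun_eq_iff)

definition cross3 :: "(nat \<Rightarrow> 'k::comm_ring_1) \<Rightarrow> (nat \<Rightarrow> 'k) \<Rightarrow> nat \<Rightarrow> 'k" where
  "cross3 v w = (\<lambda>c. if c = 1 then v 2 * w 3 - v 3 * w 2 else if c = 2 then v 3 * w 1 - v 1 * w 3
     else v 1 * w 2 - v 2 * w 1)"

definition dot3 :: "(nat \<Rightarrow> 'k::comm_ring_1) \<Rightarrow> (nat \<Rightarrow> 'k) \<Rightarrow> 'k" where
  "dot3 v w = v 1 * w 1 + v 2 * w 2 + v 3 * w 3"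

lemma cross3_simps: "cross3 v w 1 = v 2 * w 3 - v 3 * w 2" "cross3 v w 2 = v 3 * w 1 - v 1 * w 3"
  "cross3 v w 3 = v 1 * w 2 - v 2 * w 1"
  by (simp_all add: cross3_def)

lemma skew_mult:
  "i \<in> {1, 2, 3} \<Longrightarrow> skew v i 1 * x 1 + skew v i 2 * x 2 + skew v i 3 * x 3 = cross3 v x i"
  by (elim insertE emptyE) (simp_all add: skew_def cross3_def)

lemma cross3_identities:
  assumes "c \<in> {1, 2, 3}"
  shows "cross3 a a c = 0" "cross3 a (\<lambda>_. 0) c = 0" "cross3 (\<lambda>_. 0) a c = 0" "cross3 a w c = - cross3 w a c"
    "cross3 a (cross3 w a) c = dot3 a a * w c - dot3 a w * a c"
    "cross3 (cross3 w a) a c = dot3 a w * a c - dot3 a a * w c"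
    "cross3 (cross3 w a) w c = dot3 w w * a c - dot3 a w * w c"
    "cross3 w (cross3 w a) c = dot3 a w * w c - dot3 w w * a c"
  using assms by (elim insertE emptyE; simp add: dot3_def cross3_simps algebra_simps)+

lemma hw_fun_of_rows_add:
  assumes "hw_fun p mu F" "i \<in> {1..p}" "j \<in> {1..p}" "i < j"
  shows "F (of_rows (u(j := \<lambda>c. u j c + t * u i c))) = F (of_rows u)"
  using hw_fun_D(2)[OF assms] by (simp add: of_rows_addrow)

lemma hw_fun_of_rows_scale:
  assumes "hw_fun p mu F" "i \<in> {1..p}"
  shows "F (of_rows (u(i := \<lambda>c. t * u i c))) a b = t ^ mu i * F (of_rows u) a b"
  using hw_fun_D(3)[OF assms] by (simp add: of_rows_scalerow)

lemma hw_fun_of_rows_add3: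
  assumes F: "hw_fun p mu F" and j: "j \<in> {1..p}" "3 < j"
  shows "F (of_rows (u(j := \<lambda>c. u j c + (t1 * u 1 c + t2 * u 2 c + t3 * u 3 c)))) = F (of_rows u)"
proof -
  let ?u1 = "u(j := \<lambda>c. u j c + t1 * u 1 c)"
  let ?u2 = "?u1(j := \<lambda>c. ?u1 j c + t2 * ?u1 2 c)"
  let ?u3 = "?u2(j := \<lambda>c. ?u2 j c + t3 * ?u2 3 c)"
  have "?u3 = u(j := \<lambda>c. u j c + (t1 * u 1 c + t2 * u 2 c + t3 * u 3 c))"
    using j by (auto simp: fun_eq_iff algebra_simps)
  moreover have "F (of_rows ?u3) = F (of_rows ?u2)" using j by (intro hw_fun_of_rows_add[OF F]) auto
  moreover have "F (of_rows ?u2) = F (of_rows ?u1)" using j by (intro hw_fun_of_rows_add[OF F]) auto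
  moreover have "F (of_rows ?u1) = F (of_rows u)" using j by (intro hw_fun_of_rows_add[OF F]) auto
  ultimately show ?thesis by simp
qed

lemma cramer:
  fixes a b z y :: "nat \<Rightarrow> 'k::field"
  assumes "c \<in> {1, 2, 3}"
  shows "dot3 (cross3 a b) z * y c = dot3 y (cross3 b z) * a c + dot3 y (cross3 z a) * b c + dot3 y (cross3 a b) * z c"
  using assms by (auto simp: dot3_def cross3_simps algebra_simps cross3_def)

text \<open>Once the first three vectors form a basis, each later vector is a combination of them
  and can be cleared by adding earlier rows, which leaves \<open>F\<close> unchanged.\<close>

lemma hw_fun_truncate:
  assumes F: "hw_fun p mu F" and p: "3 \<le> p" and d: "dot3 (cross3 (u 1) (u 2)) (u 3) \<noteq> 0"
  shows "F (of_rows u) = F (of_rows (\<lambda>k. if 3 < k then (\<lambda>_. 0) else u k))"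
proof -
  note Fp = hw_fun_D(1)[OF F]
  define G where "G n = (\<lambda>k. if 3 < k \<and> k \<le> n then (\<lambda>_. 0) else u k)" for n :: nat
  have "F (of_rows (G n)) = F (of_rows u)" if "3 \<le> n" "n \<le> p" for n
    using that
  proof (induction n rule: dec_induct)
    case base
    have "G 3 = u"
    proof
      fix k show "G 3 k = u k" by (cases "3 < k") (auto simp: G_def)
    qed
    then show ?case by simp
  next
    case (step n)
    let ?v = "G n"
    let ?d = "dot3 (cross3 (u 1) (u 2)) (u 3)"
    let ?y = "u (Suc n)"
    \<comment> \<open>Negated Cramer coefficients of the vector being cleared.\<close>
    define t1 where "t1 = - dot3 ?y (cross3 (u 2) (u 3)) / ?d"
    define t2 where "t2 = - dot3 ?y (cross3 (u 3) (u 1)) / ?d"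
    define t3 where "t3 = - dot3 ?y (cross3 (u 1) (u 2)) / ?d"
    have v: "?v 1 = u 1" "?v 2 = u 2" "?v 3 = u 3" "?v (Suc n) = ?y" by (auto simp: G_def)
    have "F (of_rows (G (Suc n))) = F (of_rows (?v(Suc n := \<lambda>c. ?v (Suc n) c + (t1 * ?v 1 c + t2 * ?v 2 c + t3 * ?v 3 c))))"
    proof (rule Fp_of_rows_cong[OF Fp])
      fix k c :: nat assume c: "c \<in> {1, 2, 3}"
      have "?y c + (t1 * u 1 c + t2 * u 2 c + t3 * u 3 c) = 0"
      proof -
        have "?d * (?y c + (t1 * u 1 c + t2 * u 2 c + t3 * u 3 c)) = 0"
        proof -
          have t: "?d * t1 = - dot3 ?y (cross3 (u 2) (u 3))" "?d * t2 = - dot3 ?y (cross3 (u 3) (u 1))"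
            "?d * t3 = - dot3 ?y (cross3 (u 1) (u 2))"
            using d by (simp_all add: t1_def t2_def t3_def)
          show ?thesis
            by (simp only: distrib_left mult.assoc[symmetric] t cramer[OF c, of "u 1" "u 2" "u 3" ?y]) simp
        qed
        then show ?thesis using d by simp
      qed
      then show "G (Suc n) k c = (?v(Suc n := \<lambda>c. ?v (Suc n) c + (t1 * ?v 1 c + t2 * ?v 2 c + t3 * ?v 3 c))) k c"
        unfolding v using step.hyps by (auto simp: G_def)
    qed
    also have "\<dots> = F (of_rows ?v)" using step by (intro hw_fun_of_rows_add3[OF F]) auto
    also have "\<dots> = F (of_rows u)" using step by simp
    finally show ?case .
  qed
  from this[of p] have "F (of_rows u) = F (of_rows (G p))" using p by simp
  also have "\<dots> = F (of_rows (\<lambda>k. if 3 < k then (\<lambda>_. 0) else u k))"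
    by (rule Fp_of_rows_cong[OF Fp]) (auto simp: G_def)
  finally show ?thesis .
qed

section \<open>Highest weight vectors are determined at the standard frame\<close>

text \<open>For \<open>w = cross3 a b\<close> the middle vector equals (a\<cdot>a) b - (a\<cdot>b)
  a, so it is reached from \<open>b\<close> by a scaling and the addition of an earlier row.\<close>

definition orth_frame :: "(nat \<Rightarrow> 'k::comm_ring_1) \<Rightarrow> (nat \<Rightarrow> 'k) \<Rightarrow> nat \<Rightarrow> nat \<Rightarrow> 'k" where
  "orth_frame a w = (\<lambda>k. if k = 1 then a else if k = 2 then cross3 w a else if k = 3 then w else (\<lambda>_. 0))"

definition frame_cols :: "(nat \<Rightarrow> 'k::comm_ring_1) \<Rightarrow> (nat \<Rightarrow> 'k) \<Rightarrow> nat \<Rightarrow> nat \<Rightarrow> 'k" where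
  "frame_cols a w = (\<lambda>i j. if i \<in> {1..3} \<and> j \<in> {1..3} then orth_frame a w j i else 0)"

text \<open>Polynomial in each argument separately; this is stable under sums and products and
  allows zero tests one variable at a time.\<close>

definition bipoly :: "('k::comm_ring_1 \<Rightarrow> 'k \<Rightarrow> 'k) \<Rightarrow> bool" where
  "bipoly g \<longleftrightarrow> (\<forall>r. \<exists>Q. \<forall>q. g q r = poly Q q) \<and> (\<forall>q. \<exists>R. \<forall>r. g q r = poly R r)"

lemma bipoly_const: "bipoly (\<lambda>q r. c)"
  unfolding bipoly_def by (auto intro!: exI[of _ "[:c:]"])

lemma bipoly_fst: "bipoly (\<lambda>(q :: 'k::comm_ring_1) r. q)"
  unfolding bipoly_def
proof (intro conjI allI)
  show "\<exists>Q. \<forall>q::'k. q = poly Q q" by (intro exI[of _ "[:0, 1:]"]) simp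
  show "\<exists>R. \<forall>r. q = poly R r" for q :: 'k by (intro exI[of _ "[:q:]"]) simp
qed

lemma bipoly_snd: "bipoly (\<lambda>q (r :: 'k::comm_ring_1). r)"
  unfolding bipoly_def
proof (intro conjI allI)
  show "\<exists>Q. \<forall>q::'k. q = poly Q q" by (intro exI[of _ "[:0, 1:]"]) simp
  show "\<exists>R. \<forall>r. q = poly R r" for q :: 'k by (intro exI[of _ "[:q:]"]) simp
qed

lemma bipoly_add:
  assumes "bipoly g" "bipoly h" shows "bipoly (\<lambda>q r. g q r + h q r)"
  unfolding bipoly_def
proof (intro conjI allI)
  fix r obtain Q Q' where "\<forall>q. g q r = poly Q q" "\<forall>q. h q r = poly Q' q" using assms unfolding bipoly_def by meson
  then show "\<exists>Q. \<forall>q. g q r + h q r = poly Q q" by (intro exI[of _ "Q + Q'"]) simp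
next
  fix q obtain Q Q' where "\<forall>r. g q r = poly Q r" "\<forall>r. h q r = poly Q' r" using assms unfolding bipoly_def by meson
  then show "\<exists>Q. \<forall>r. g q r + h q r = poly Q r" by (intro exI[of _ "Q + Q'"]) simp
qed

lemma bipoly_mult:
  assumes "bipoly g" "bipoly h" shows "bipoly (\<lambda>q r. g q r * h q r)"
  unfolding bipoly_def
proof (intro conjI allI)
  fix r obtain Q Q' where "\<forall>q. g q r = poly Q q" "\<forall>q. h q r = poly Q' q" using assms unfolding bipoly_def by meson
  then show "\<exists>Q. \<forall>q. g q r * h q r = poly Q q" by (intro exI[of _ "Q * Q'"]) simp
next
  fix q obtain Q Q' where "\<forall>r. g q r = poly Q r" "\<forall>r. h q r = poly Q' r" using assms unfolding bipoly_def by meson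
  then show "\<exists>Q. \<forall>r. g q r * h q r = poly Q r" by (intro exI[of _ "Q * Q'"]) simp
qed

lemma bipoly_uminus: "bipoly g \<Longrightarrow> bipoly (\<lambda>q r. - g q r)"
  using bipoly_mult[OF bipoly_const[of "-1"], of g] by simp

lemma bipoly_if: "bipoly g \<Longrightarrow> bipoly h \<Longrightarrow> bipoly (\<lambda>q r. if P then g q r else h q r)"
  by (cases P) simp_all

lemma infinite_squares: "infinite {x ^ 2 | x :: 'k::field_char_0. x \<noteq> 0}"
proof -
  have "inj (\<lambda>n::nat. (of_nat (Suc n) :: 'k) ^ 2)"
  proof (rule injI)
    fix m n :: nat assume "(of_nat (Suc m) :: 'k) ^ 2 = of_nat (Suc n) ^ 2"
    then have "(of_nat (Suc m ^ 2) :: 'k) = of_nat (Suc n ^ 2)" by (simp only: of_nat_power)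
    then have "Suc m ^ 2 = Suc n ^ 2" by (simp only: of_nat_eq_iff)
    then show "m = n" by (simp add: power2_eq_iff_nonneg)
  qed
  then have "infinite (range (\<lambda>n::nat. (of_nat (Suc n) :: 'k) ^ 2))" by (rule range_inj_infinite)
  moreover have "range (\<lambda>n::nat. (of_nat (Suc n) :: 'k) ^ 2) \<subseteq> {x ^ 2 | x. x \<noteq> 0}"
    using of_nat_eq_0_iff[where ?'a = 'k] by (auto simp del: of_nat_Suc)
  ultimately show ?thesis using finite_subset by blast
qed

lemma poly_zero_on_squares:
  fixes Q :: "'k::field_char_0 poly"
  assumes "\<And>x. x \<noteq> 0 \<Longrightarrow> poly Q (x ^ 2) = 0"
  shows "Q = 0"
proof (rule ccontr)
  assume "Q \<noteq> 0"
  then have "finite {x. poly Q x = 0}" by (rule poly_roots_finite)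
  moreover have "{x ^ 2 | x. x \<noteq> 0} \<subseteq> {x. poly Q x = 0}" using assms by blast
  ultimately show False using infinite_squares finite_subset by blast
qed

text \<open>Frames \<open>x\<close> e1, \<open>y\<close> e3 only realise squares as norms. Distinct
  positive integers have distinct squares, so the test set is infinite in each variable.\<close>

lemma bipoly_zero_on_squares:
  fixes g :: "'k::field_char_0 \<Rightarrow> 'k \<Rightarrow> 'k"
  assumes "bipoly g" "\<And>x y. x \<noteq> 0 \<Longrightarrow> y \<noteq> 0 \<Longrightarrow> g (x ^ 2) (y ^ 2) = 0"
  shows "g q r = 0"
proof -
  have 1: "g q (y ^ 2) = 0" if y: "y \<noteq> 0" for q y
  proof -
    obtain Q where Q: "\<And>q. g q (y ^ 2) = poly Q q" using assms(1) unfolding bipoly_def by meson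
    have "Q = 0" using assms(2) y by (intro poly_zero_on_squares) (simp add: Q[symmetric])
    then show ?thesis by (simp add: Q)
  qed
  obtain R where R: "\<And>r. g q r = poly R r" using assms(1) unfolding bipoly_def by meson
  have "R = 0" using 1 by (intro poly_zero_on_squares) (simp add: R[symmetric])
  then show ?thesis by (simp add: R)
qed

lemma supp3_frame_cols: "supp3 (frame_cols a w)"
  by (auto simp: supp3_def frame_cols_def)

text \<open>In the basis \<open>a, w \<times> a, w\<close> (with \<open>a \<bottom> w\<close>) the three cross product matrices of the
  basis vectors have entries depending only on \<open>a\<cdot>a\<close> and \<open>w\<cdot>w\<close>.\<close>

lemma Fp_frame:
  fixes F :: "'k::field_char_0 matfun"
  assumes "F \<in> Fp p"
  shows "\<exists>\<gamma>. (\<forall>i j. bipoly (\<gamma> i j)) \<and> (\<forall>a w. dot3 a w = 0 \<longrightarrow>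
    mat3_mult (F (of_rows (orth_frame a w))) (frame_cols a w) = mat3_mult (frame_cols a w) (\<lambda>i j. \<gamma> i j (dot3 a a) (dot3 w w)))"
  using assms
proof (induction rule: Fp.induct)
  case one
  have "mat3_mult mat3_one (frame_cols a w) = mat3_mult (frame_cols a w) mat3_one" for a w :: "nat \<Rightarrow> 'k"
    by (simp add: mat3_one_left mat3_one_right supp3_frame_cols)
  then show ?case by (intro exI[of _ "\<lambda>i j q r. mat3_one i j"]) (simp add: bipoly_const)
next
  case (gen k)
  \<comment> \<open>The structure constants of the cross product in the basis a, w \<times> a, w,
    where q = a\<cdot>a and r = w\<cdot>w: for example a \<times> (w \<times> a) = q w and (w
    \<times> a) \<times> w = r a.\<close>
  define \<gamma> :: "nat \<Rightarrow> nat \<Rightarrow> 'k \<Rightarrow> 'k \<Rightarrow> 'k" where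
    "\<gamma> i j = (\<lambda>q r. if k = 1 \<and> i = 3 \<and> j = 2 then q else if k = 1 \<and> i = 2 \<and> j = 3 then - 1
      else if k = 2 \<and> i = 3 \<and> j = 1 then - q else if k = 2 \<and> i = 1 \<and> j = 3 then r
      else if k = 3 \<and> i = 2 \<and> j = 1 then 1 else if k = 3 \<and> i = 1 \<and> j = 2 then - r else 0)" for i j
  have "bipoly (\<gamma> i j)" for i j
    unfolding \<gamma>_def by (intro bipoly_if bipoly_uminus bipoly_const bipoly_fst bipoly_snd)
  moreover have "mat3_mult (gen_skew k (of_rows (orth_frame a w))) (frame_cols a w)
      = mat3_mult (frame_cols a w) (\<lambda>i j. \<gamma> i j (dot3 a a) (dot3 w w))" if aw: "dot3 a w = 0" for a w
  proof (rule supp3_eqI)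
    show "supp3 (mat3_mult (gen_skew k (of_rows (orth_frame a w))) (frame_cols a w))"
      by (intro supp3_mult supp3_gen_skew supp3_frame_cols)
    have "supp3 (\<lambda>i j. \<gamma> i j (dot3 a a) (dot3 w w))" by (auto simp: supp3_def \<gamma>_def)
    then show "supp3 (mat3_mult (frame_cols a w) (\<lambda>i j. \<gamma> i j (dot3 a a) (dot3 w w)))"
      by (intro supp3_mult supp3_frame_cols)
    fix i j :: nat assume i: "i \<in> {1, 2, 3}" and j: "j \<in> {1, 2, 3}"
    have L: "mat3_mult (gen_skew k (of_rows (orth_frame a w))) (frame_cols a w) i j = cross3 (orth_frame a w k) (orth_frame a w j) i"
      unfolding skew_mult[OF i, symmetric] using j by (auto simp: gen_skew_of_rows mat3_mult_expand frame_cols_def)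
    have R: "mat3_mult (frame_cols a w) (\<lambda>i j. \<gamma> i j (dot3 a a) (dot3 w w)) i j
        = a i * \<gamma> 1 j (dot3 a a) (dot3 w w) + cross3 w a i * \<gamma> 2 j (dot3 a a) (dot3 w w) + w i * \<gamma> 3 j (dot3 a a) (dot3 w w)"
      using i by (auto simp: mat3_mult_expand frame_cols_def orth_frame_def)
    consider "k = 1" | "k = 2" | "k = 3" | "k \<noteq> 1 \<and> k \<noteq> 2 \<and> k \<noteq> 3" by blast
    then show "mat3_mult (gen_skew k (of_rows (orth_frame a w))) (frame_cols a w) i j
        = mat3_mult (frame_cols a w) (\<lambda>i j. \<gamma> i j (dot3 a a) (dot3 w w)) i j"
      unfolding L R using j
      by cases (elim insertE emptyE; simp add: orth_frame_def \<gamma>_def cross3_identities(1-3,5-8)[OF i] cross3_identities(4)[OF i, of a w] aw)+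
  qed
  ultimately show ?case by blast
next
  case (add F G)
  then obtain g h where "\<forall>i j. bipoly (g i j)" "\<forall>i j. bipoly (h i j)"
    "\<And>a w. dot3 a w = 0 \<Longrightarrow> mat3_mult (F (of_rows (orth_frame a w))) (frame_cols a w) = mat3_mult (frame_cols a w) (\<lambda>i j. g i j (dot3 a a) (dot3 w w))"
    "\<And>a w. dot3 a w = 0 \<Longrightarrow> mat3_mult (G (of_rows (orth_frame a w))) (frame_cols a w) = mat3_mult (frame_cols a w) (\<lambda>i j. h i j (dot3 a a) (dot3 w w))"
    by blast
  then show ?case
    by (intro exI[of _ "\<lambda>i j q r. g i j q r + h i j q r"]) (simp add: bipoly_add mat3_mult_add_left mat3_mult_add_right)
next
  case (smult F c)
  then obtain g where "\<forall>i j. bipoly (g i j)"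
    "\<And>a w. dot3 a w = 0 \<Longrightarrow> mat3_mult (F (of_rows (orth_frame a w))) (frame_cols a w) = mat3_mult (frame_cols a w) (\<lambda>i j. g i j (dot3 a a) (dot3 w w))"
    by blast
  then show ?case
    by (intro exI[of _ "\<lambda>i j q r. c * g i j q r"])
      (simp add: bipoly_mult bipoly_const mat3_mult_scale_left mat3_mult_scale_right)
next
  case (mult F G)
  then obtain g h where gh: "\<forall>i j. bipoly (g i j)" "\<forall>i j. bipoly (h i j)"
    "\<And>a w. dot3 a w = 0 \<Longrightarrow> mat3_mult (F (of_rows (orth_frame a w))) (frame_cols a w) = mat3_mult (frame_cols a w) (\<lambda>i j. g i j (dot3 a a) (dot3 w w))"
    "\<And>a w. dot3 a w = 0 \<Longrightarrow> mat3_mult (G (of_rows (orth_frame a w))) (frame_cols a w) = mat3_mult (frame_cols a w) (\<lambda>i j. h i j (dot3 a a) (dot3 w w))"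
    by blast
  have "mat3_mult (mat3_mult (F (of_rows (orth_frame a w))) (G (of_rows (orth_frame a w)))) (frame_cols a w)
      = mat3_mult (frame_cols a w) (mat3_mult (\<lambda>i j. g i j (dot3 a a) (dot3 w w)) (\<lambda>i j. h i j (dot3 a a) (dot3 w w)))"
    if "dot3 a w = 0" for a w
  proof -
    have "mat3_mult (mat3_mult (F (of_rows (orth_frame a w))) (G (of_rows (orth_frame a w)))) (frame_cols a w)
      = mat3_mult (mat3_mult (F (of_rows (orth_frame a w))) (frame_cols a w)) (\<lambda>i j. h i j (dot3 a a) (dot3 w w))"
      by (simp only: mat3_mult_assoc gh(4)[OF that])
    then show ?thesis by (simp only: gh(3)[OF that] mat3_mult_assoc)
  qed
  moreover have "bipoly (\<lambda>q r. mat3_mult (\<lambda>i j. g i j q r) (\<lambda>i j. h i j q r) i j)" for i j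
    unfolding mat3_mult_expand using gh(1,2) by (intro bipoly_add bipoly_mult) auto
  ultimately show ?case
    by (intro exI[of _ "\<lambda>i j q r. mat3_mult (\<lambda>i j. g i j q r) (\<lambda>i j. h i j q r) i j"]) simp
qed

definition stdE :: "nat \<Rightarrow> nat \<Rightarrow> 'k::comm_ring_1" where
  "stdE = (\<lambda>k c. if c = k \<and> k \<le> 3 then 1 else 0)"

text \<open>Since e3 \<times> e1 = e2, the frame has rows x e1, x y e2, y e3 and is a rescaling of
  the standard basis.\<close>

lemma hw_fun_frame_std:
  assumes F: "hw_fun p mu F" and p: "3 \<le> p"
  shows "F (of_rows (orth_frame (\<lambda>c. x * stdE 1 c) (\<lambda>c. y * stdE 3 c))) a b
    = x ^ mu 1 * ((x * y) ^ mu 2 * (y ^ mu 3 * F (of_rows stdE) a b))"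
proof -
  let ?u1 = "stdE(3 := \<lambda>c. y * stdE 3 c)"
  let ?u2 = "?u1(2 := \<lambda>c. (x * y) * ?u1 2 c)"
  let ?u3 = "?u2(1 := \<lambda>c. x * ?u2 1 c)"
  have "F (of_rows (orth_frame (\<lambda>c. x * stdE 1 c) (\<lambda>c. y * stdE 3 c))) = F (of_rows ?u3)"
    by (rule Fp_of_rows_cong[OF hw_fun_D(1)[OF F]]) (auto simp: orth_frame_def stdE_def cross3_def)
  moreover have "F (of_rows ?u3) a b = x ^ mu 1 * F (of_rows ?u2) a b" using p by (intro hw_fun_of_rows_scale[OF F]) auto
  moreover have "F (of_rows ?u2) a b = (x * y) ^ mu 2 * F (of_rows ?u1) a b" using p by (intro hw_fun_of_rows_scale[OF F]) auto
  moreover have "F (of_rows ?u1) a b = y ^ mu 3 * F (of_rows stdE) a b" using p by (intro hw_fun_of_rows_scale[OF F]) auto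
  ultimately show ?thesis by simp
qed

text \<open>The field may have isotropic vectors, so both norms must be nonzero for the orthogonal
  triple to be a basis.\<close>

lemma orthogonal_basis_zero:
  fixes f a w :: "nat \<Rightarrow> 'k::field"
  assumes aw: "dot3 a w = 0" and q: "dot3 a a \<noteq> 0" and r: "dot3 w w \<noteq> 0"
    and f: "dot3 f a = 0" "dot3 f (cross3 w a) = 0" "dot3 f w = 0" and c: "c \<in> {1, 2, 3}"
  shows "f c = 0"
proof -
  have "dot3 (cross3 w a) (cross3 w a) = dot3 a a * dot3 w w - dot3 a w * dot3 a w"
    "dot3 f (cross3 a (cross3 w a)) = dot3 a a * dot3 f w - dot3 a w * dot3 f a"
    "dot3 f (cross3 (cross3 w a) w) = dot3 w w * dot3 f a - dot3 a w * dot3 f w"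
    by (simp_all add: dot3_def cross3_simps algebra_simps)
  then have "dot3 a a * dot3 w w * f c = 0" using cramer[OF c, of w a "cross3 w a" f] f aw by simp
  then show ?thesis using q r by simp
qed

text \<open>Vanishing at the standard basis makes the coefficient matrix vanish at all pairs of
  nonzero squares, hence identically, hence at every orthogonal frame.\<close>

lemma hw_fun_frame_zero:
  fixes F :: "'k::field_char_0 matfun"
  assumes F: "hw_fun p mu F" and p: "3 \<le> p" and E: "F (of_rows stdE) = (\<lambda>i j. 0)"
    and aw: "dot3 a w = 0" "dot3 a a \<noteq> 0" "dot3 w w \<noteq> 0"
  shows "F (of_rows (orth_frame a w)) = (\<lambda>i j. 0)"
proof -
  note Fp = hw_fun_D(1)[OF F]
  obtain \<gamma> where \<gamma>: "\<And>i j. bipoly (\<gamma> i j)" "\<And>a w. dot3 a w = 0 \<Longrightarrow>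
    mat3_mult (F (of_rows (orth_frame a w))) (frame_cols a w) = mat3_mult (frame_cols a w) (\<lambda>i j. \<gamma> i j (dot3 a a) (dot3 w w))"
    using Fp_frame[OF Fp] by blast
  have zero: "\<gamma> i j q r = 0" if i: "i \<in> {1, 2, 3}" for i j q r
  proof (rule bipoly_zero_on_squares[OF \<gamma>(1)])
    fix x y :: 'k assume xy: "x \<noteq> 0" "y \<noteq> 0"
    let ?a = "\<lambda>c. x * stdE 1 c" and ?w = "\<lambda>c. y * stdE 3 c"
    have d: "dot3 ?a ?w = 0" "dot3 ?a ?a = x ^ 2" "dot3 ?w ?w = y ^ 2"
      by (simp_all add: dot3_def stdE_def power2_eq_square)
    have "F (of_rows (orth_frame ?a ?w)) = (\<lambda>i j. 0)"
      using hw_fun_frame_std[OF F p] E by (intro ext) simp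
    then have "mat3_mult (frame_cols ?a ?w) (\<lambda>i j. \<gamma> i j (x ^ 2) (y ^ 2)) = mat3_mult (\<lambda>i j. 0) (frame_cols ?a ?w)"
      using \<gamma>(2)[OF d(1)] d by simp
    then have z: "mat3_mult (frame_cols ?a ?w) (\<lambda>i j. \<gamma> i j (x ^ 2) (y ^ 2)) i j = 0"
      by (simp add: mat3_mult_expand)
    have "\<gamma> 1 j (x ^ 2) (y ^ 2) = 0" if "i = 1"
      using z xy that by (simp add: mat3_mult_expand frame_cols_def orth_frame_def stdE_def cross3_def)
    moreover have "\<gamma> 2 j (x ^ 2) (y ^ 2) = 0" if "i = 2"
      using z xy that by (simp add: mat3_mult_expand frame_cols_def orth_frame_def stdE_def cross3_def)
    moreover have "\<gamma> 3 j (x ^ 2) (y ^ 2) = 0" if "i = 3"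
      using z xy that by (simp add: mat3_mult_expand frame_cols_def orth_frame_def stdE_def cross3_def)
    ultimately show "\<gamma> i j (x ^ 2) (y ^ 2) = 0" using i by blast
  qed
  have z: "mat3_mult (F (of_rows (orth_frame a w))) (frame_cols a w) i j = 0" for i j
    unfolding \<gamma>(2)[OF aw(1)] by (simp add: mat3_mult_expand zero)
  show ?thesis
  proof (rule supp3_eqI[OF Fp_supp3[OF Fp]])
    fix i c :: nat assume i: "i \<in> {1, 2, 3}" and c: "c \<in> {1, 2, 3}"
    show "F (of_rows (orth_frame a w)) i c = 0"
    proof (rule orthogonal_basis_zero[OF aw _ _ _ c])
      show "dot3 (F (of_rows (orth_frame a w)) i) a = 0" using z[of i 1]
        by (simp add: dot3_def mat3_mult_expand frame_cols_def orth_frame_def)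
      show "dot3 (F (of_rows (orth_frame a w)) i) (cross3 w a) = 0" using z[of i 2]
        by (simp add: dot3_def mat3_mult_expand frame_cols_def orth_frame_def)
      show "dot3 (F (of_rows (orth_frame a w)) i) w = 0" using z[of i 3]
        by (simp add: dot3_def mat3_mult_expand frame_cols_def orth_frame_def)
    qed
  qed (simp add: supp3_def)
qed

section \<open>From orthogonal frames to all points\<close>

lemma dot3_commute: "dot3 v w = dot3 w v"
  by (simp add: dot3_def mult.commute)

lemma cross3_cross3: "c \<in> {1, 2, 3} \<Longrightarrow> cross3 (cross3 a b) a c = dot3 a a * b c - dot3 a b * a c"
  by (elim insertE emptyE) (simp_all add: dot3_def cross3_simps algebra_simps)

lemma dot3_cross3: "dot3 a (cross3 a b) = 0"
  by (simp add: dot3_def cross3_simps algebra_simps)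

text \<open>After dropping the rows beyond the third, the third row is turned into \<open>w\<close>
  and then the second into \<open>w \<times> a\<close>. Only nonzero scalings and additions of
  earlier rows occur, so the vanishing travels back.\<close>

lemma hw_fun_generic_zero:
  fixes F :: "'k::field_char_0 matfun"
  assumes F: "hw_fun p mu F" and p: "3 \<le> p" and E: "F (of_rows stdE) = (\<lambda>i j. 0)"
    and q: "dot3 (u 1) (u 1) \<noteq> 0" and r: "dot3 (cross3 (u 1) (u 2)) (cross3 (u 1) (u 2)) \<noteq> 0"
    and d: "dot3 (cross3 (u 1) (u 2)) (u 3) \<noteq> 0"
  shows "F (of_rows u) = (\<lambda>i j. 0)"
proof -
  note Fp = hw_fun_D(1)[OF F]
  define a where "a = u 1"
  define b where "b = u 2"
  define z where "z = u 3"
  define w where "w = cross3 a b"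
  note abz = a_def[symmetric] b_def[symmetric] z_def[symmetric]
  have scale: "F (of_rows u) = (\<lambda>i j. 0)" if "F (of_rows (u(i := \<lambda>c. t * u i c))) = (\<lambda>i j. 0)" "t \<noteq> 0" "i \<in> {1..p}" for u i t
  proof (intro ext)
    fix k l
    have "t ^ mu i * F (of_rows u) k l = 0"
      using hw_fun_of_rows_scale[OF F that(3), of u t k l] that(1) by simp
    then show "F (of_rows u) k l = 0" using that(2) by simp
  qed
  define v where "v = (\<lambda>k. if 3 < k then (\<lambda>_. 0) else u k)"
  \<comment> \<open>From Cramer's rule (w\<cdot>w) z = (z\<cdot>(b \<times> w)) a + (z\<cdot>(w
    \<times> a)) b + (z\<cdot>w) w, solved for \<open>w\<close>.\<close>
  define t where "t = dot3 w w / dot3 w z"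
  define al where "al = - dot3 z (cross3 b w) / dot3 w z"
  define be where "be = - dot3 z (cross3 w a) / dot3 w z"
  have dwz: "dot3 w z \<noteq> 0" using d by (simp add: w_def abz)
  have t0: "t \<noteq> 0" using r dwz by (simp add: t_def w_def abz)
  define v1 where "v1 = v(3 := \<lambda>c. t * v 3 c)"
  define v2 where "v2 = v1(3 := \<lambda>c. v1 3 c + al * v1 1 c)"
  define v3 where "v3 = v2(3 := \<lambda>c. v2 3 c + be * v2 2 c)"
  have w: "t * z c + al * a c + be * b c = w c" if c: "c \<in> {1, 2, 3}" for c
  proof -
    have td: "dot3 w z * t = dot3 w w" "dot3 w z * al = - dot3 z (cross3 b w)" "dot3 w z * be = - dot3 z (cross3 w a)"
      using dwz by (simp_all add: t_def al_def be_def)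
    have "dot3 w z * (t * z c + al * a c + be * b c) = dot3 w z * w c"
      by (simp only: distrib_left mult.assoc[symmetric] td)
        (use cramer[OF c, of a b w z] dot3_commute[of w z] in \<open>simp add: w_def\<close>)
    then show ?thesis using dwz by simp
  qed
  \<comment> \<open>Realises w \<times> a = (a\<cdot>a) b - (a\<cdot>b) a on the second row.\<close>
  define w1 where "w1 = v3(2 := \<lambda>c. dot3 a a * v3 2 c)"
  define w2 where "w2 = w1(2 := \<lambda>c. w1 2 c + (- dot3 a b) * w1 1 c)"
  note defs = w2_def w1_def v3_def v2_def v1_def v_def
  have "F (of_rows w2) = F (of_rows (orth_frame a w))"
  proof (rule Fp_of_rows_cong[OF Fp])
    fix k c :: nat assume c: "c \<in> {1, 2, 3}" and k: "k \<in> {1..p}"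
    consider "k = 1" | "k = 2" | "k = 3" | "3 < k" using k by force
    then show "w2 k c = orth_frame a w k c"
    proof cases
      case 1
      then show ?thesis by (simp add: defs orth_frame_def abz)
    next
      case 2
      then show ?thesis using cross3_cross3[OF c, of a b] by (simp add: defs orth_frame_def abz w_def)
    next
      case 3
      then show ?thesis using w[OF c] by (simp add: defs orth_frame_def abz)
    next
      case 4
      then show ?thesis by (simp add: defs orth_frame_def)
    qed
  qed
  also have "\<dots> = (\<lambda>i j. 0)"
    by (rule hw_fun_frame_zero[OF F p E]) (use q r in \<open>simp_all add: w_def dot3_cross3 abz\<close>)
  finally have "F (of_rows w2) = (\<lambda>i j. 0)" .
  moreover have "F (of_rows w2) = F (of_rows w1)" unfolding w2_def using p by (intro hw_fun_of_rows_add[OF F]) auto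
  ultimately have "F (of_rows w1) = (\<lambda>i j. 0)" by simp
  then have "F (of_rows v3) = (\<lambda>i j. 0)" using p q by (intro scale[of v3 2 "dot3 a a"]) (auto simp: abz w1_def)
  moreover have "F (of_rows v3) = F (of_rows v2)" unfolding v3_def using p by (intro hw_fun_of_rows_add[OF F]) auto
  moreover have "F (of_rows v2) = F (of_rows v1)" unfolding v2_def using p by (intro hw_fun_of_rows_add[OF F]) auto
  ultimately have "F (of_rows v1) = (\<lambda>i j. 0)" by simp
  then have "F (of_rows v) = (\<lambda>i j. 0)" using p t0 by (intro scale[of v 3 t]) (auto simp: v1_def)
  then show ?thesis using hw_fun_truncate[OF F p d] by (simp add: v_def)
qed

text \<open>Polynomial functions have no zero divisors: restrict both factors to the line from
  \<open>y\<close> to \<open>y0\<close> and argue in one variable.\<close>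

lemma Pol_mult_zero:
  assumes f: "f \<in> Pol p" and g: "g \<in> Pol p" and fg: "\<And>y. f y * g y = 0" and g0: "g y0 \<noteq> 0"
  shows "f y = 0"
proof -
  let ?z = "\<lambda>v. y0 v - y v"
  have "poly (line_poly f y ?z * line_poly g y ?z) t = poly 0 t" for t
    using fg by (simp add: poly_line_poly[OF f] poly_line_poly[OF g])
  then have "line_poly f y ?z * line_poly g y ?z = 0" by (simp add: poly_eq_poly_eq_iff[symmetric] fun_eq_iff)
  moreover have "poly (line_poly g y ?z) 1 = g y0" by (simp add: poly_line_poly[OF g])
  then have "line_poly g y ?z \<noteq> 0" using g0 by auto
  ultimately have "line_poly f y ?z = 0" by simp
  then show ?thesis using poly_line_poly[OF f, of y ?z 0] by simp
qed

lemma rows_Pol: "k \<in> {1..p} \<Longrightarrow> (\<lambda>x. rows x k c) \<in> Pol p"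
  by (cases "c = 1"; cases "c = 2") (simp_all add: rows_def Pol_uminus Pol.var)

lemma rows_of_rows: "c \<in> {1, 2, 3} \<Longrightarrow> rows (of_rows u) k c = u k c"
  by (auto simp: rows_def of_rows_def)

lemma dot3_Pol:
  "(\<And>c. (\<lambda>x. v x c) \<in> Pol p) \<Longrightarrow> (\<And>c. (\<lambda>x. w x c) \<in> Pol p) \<Longrightarrow> (\<lambda>x. dot3 (v x) (w x)) \<in> Pol p"
  unfolding dot3_def by (intro Pol.add Pol.mult)

lemma cross3_Pol:
  "(\<And>c. (\<lambda>x. v x c) \<in> Pol p) \<Longrightarrow> (\<And>c. (\<lambda>x. w x c) \<in> Pol p) \<Longrightarrow> (\<lambda>x. cross3 (v x) (w x) c) \<in> Pol p"
  unfolding cross3_def by (cases "c = 1"; cases "c = 2") (simp_all add: Pol_diff Pol.mult)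

theorem hw_fun_zero:
  fixes F :: "'k::field_char_0 matfun"
  assumes F: "hw_fun p mu F" and p: "3 \<le> p" and E: "F (of_rows stdE) = (\<lambda>i j. 0)"
  shows "F = (\<lambda>x i j. 0)"
proof (intro ext)
  fix x i j
  let ?w = "\<lambda>x :: 'k tpoint. cross3 (rows x 1) (rows x 2)"
  \<comment> \<open>The product of the three genericity conditions; it equals 1 at the standard
    basis, so a function that it annihilates is zero.\<close>
  let ?g = "\<lambda>x. dot3 (rows x 1) (rows x 1) * (dot3 (?w x) (?w x) * dot3 (?w x) (rows x 3))"
  note R = rows_Pol[of 1 p] rows_Pol[of 2 p] rows_Pol[of 3 p]
  have g: "?g \<in> Pol p"
    by (intro Pol.mult dot3_Pol cross3_Pol rows_Pol) (use p in auto)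
  have "F y i j * ?g y = 0" for y
  proof (cases "?g y = 0")
    case False
    then have "F (of_rows (rows y)) = (\<lambda>i j. 0)" by (intro hw_fun_generic_zero[OF F p E]) auto
    then show ?thesis by (simp add: Fp_of_rows_rows[OF hw_fun_D(1)[OF F]])
  qed simp
  moreover have "?g (of_rows stdE) = 1"
    by (simp add: dot3_def cross3_def rows_of_rows stdE_def)
  then have "?g (of_rows stdE) \<noteq> 0" by simp
  ultimately show "F x i j = 0"
    by (rule Pol_mult_zero[OF Fp_Pol[OF hw_fun_D(1)[OF F]] g])
qed

text \<open>Generically row \<open>k\<close> may be replaced by 0 without effect, whereas
  homogeneity of positive degree would then give the value 0.\<close>

lemma hw_fun_weight_zero:
  fixes F :: "'k::field_char_0 matfun"
  assumes F: "hw_fun p mu F" and nz: "F \<noteq> (\<lambda>x i j. 0)" and k: "k \<in> {1..p}" "3 < k"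
  shows "mu k = 0"
proof (rule ccontr)
  assume mu: "mu k \<noteq> 0"
  note Fp = hw_fun_D(1)[OF F]
  have p: "3 \<le> p" using k by simp
  let ?g = "\<lambda>x :: 'k tpoint. dot3 (cross3 (rows x 1) (rows x 2)) (rows x 3)"
  have g: "?g \<in> Pol p" by (intro dot3_Pol cross3_Pol rows_Pol) (use p in auto)
  have "F y i j * ?g y = 0" for y i j
  proof (cases "?g y = 0")
    case False
    let ?u = "rows y" and ?u' = "(rows y)(k := \<lambda>c. 0 * rows y k c)"
    have "F (of_rows ?u) = F (of_rows (\<lambda>k. if 3 < k then (\<lambda>_. 0) else ?u k))" by (rule hw_fun_truncate[OF F p False])
    also have "(\<lambda>k. if 3 < k then (\<lambda>_. 0) else ?u k) = (\<lambda>k. if 3 < k then (\<lambda>_. 0) else ?u' k)"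
      using k by (auto simp: fun_eq_iff)
    also have "F (of_rows (\<lambda>k. if 3 < k then (\<lambda>_. 0) else ?u' k)) = F (of_rows ?u')"
      by (rule hw_fun_truncate[OF F p, symmetric]) (use False k in simp)
    finally have "F (of_rows ?u) i j = F (of_rows ?u') i j" by (rule arg_cong)
    also have "\<dots> = 0 ^ mu k * F (of_rows ?u) i j" by (rule hw_fun_of_rows_scale[OF F k(1)])
    finally have "F (of_rows ?u) i j = 0" using mu by (simp add: power_0_left)
    then show ?thesis by (simp add: Fp_of_rows_rows[OF Fp])
  qed simp
  moreover have "?g (of_rows stdE) = 1" by (simp add: dot3_def cross3_def rows_of_rows stdE_def)
  then have "?g (of_rows stdE) \<noteq> 0" by simp
  ultimately have "F x i j = 0" for x i j by (rule Pol_mult_zero[OF Fp_Pol[OF Fp] g])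
  then show False using nz by (auto simp: fun_eq_iff)
qed

section \<open>Highest weight vectors from words\<close>

definition outer3 :: "(nat \<Rightarrow> 'k::comm_ring_1) \<Rightarrow> (nat \<Rightarrow> 'k) \<Rightarrow> nat \<Rightarrow> nat \<Rightarrow> 'k" where
  "outer3 v w = (\<lambda>i j. if i \<in> {1, 2, 3} \<and> j \<in> {1, 2, 3} then v i * w j else 0)"

primrec mpow :: "(nat \<Rightarrow> nat \<Rightarrow> 'k::comm_ring_1) \<Rightarrow> nat \<Rightarrow> nat \<Rightarrow> nat \<Rightarrow> 'k" where
  "mpow A 0 = mat3_one"
| "mpow A (Suc n) = mat3_mult A (mpow A n)"

lemma supp3_outer3: "supp3 (outer3 v w)"
  by (auto simp: supp3_def outer3_def)

lemma supp3_mpow: "supp3 A \<Longrightarrow> supp3 (mpow A n)"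
  by (induction n) (simp_all add: supp3_one supp3_mult)

lemma supp3_scale: "supp3 A \<Longrightarrow> supp3 (\<lambda>i j. c * A i j)"
  by (simp add: supp3_def)

lemma supp3_diff: "supp3 A \<Longrightarrow> supp3 B \<Longrightarrow> supp3 (\<lambda>i j. A i j - B i j)"
  by (simp add: supp3_def)

lemma supp3_add: "supp3 A \<Longrightarrow> supp3 B \<Longrightarrow> supp3 (\<lambda>i j. A i j + B i j)"
  by (simp add: supp3_def)

lemma mpow_scale: "mpow (\<lambda>i j. t * A i j) n = (\<lambda>i j. t ^ n * mpow A n i j)"
  by (induction n) (simp_all add: mat3_mult_scale_left mat3_mult_scale_right mult.assoc)

lemma skew_scale: "skew (\<lambda>c. t * v c) = (\<lambda>i j. t * skew v i j)"
  by (rule supp3_entries_eqI[OF supp3_skew supp3_scale[OF supp3_skew]]) (simp_all add: skew_def)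

lemma skew_add: "skew (\<lambda>c. v c + w c) = (\<lambda>i j. skew v i j + skew w i j)"
  by (rule supp3_entries_eqI[OF supp3_skew supp3_add[OF supp3_skew supp3_skew]]) (simp_all add: skew_def)

lemma skew_mult_left: "j \<in> {1, 2, 3} \<Longrightarrow> x 1 * skew v 1 j + x 2 * skew v 2 j + x 3 * skew v 3 j = cross3 x v j"
  by (elim insertE emptyE) (simp_all add: skew_def cross3_def algebra_simps)

lemma skew_outer3: "mat3_mult (skew v) (outer3 x y) = outer3 (cross3 v x) y"
proof (rule supp3_eqI[OF supp3_mult[OF supp3_skew supp3_outer3] supp3_outer3])
  fix i j :: nat assume ij: "i \<in> {1, 2, 3}" "j \<in> {1, 2, 3}"
  have "mat3_mult (skew v) (outer3 x y) i j = (skew v i 1 * x 1 + skew v i 2 * x 2 + skew v i 3 * x 3) * y j"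
    using ij by (simp add: mat3_mult_expand outer3_def algebra_simps)
  then show "mat3_mult (skew v) (outer3 x y) i j = outer3 (cross3 v x) y i j"
    unfolding skew_mult[OF ij(1)] using ij by (simp add: outer3_def)
qed

lemma outer3_skew: "mat3_mult (outer3 x y) (skew v) = outer3 x (cross3 y v)"
proof (rule supp3_eqI[OF supp3_mult[OF supp3_outer3 supp3_skew] supp3_outer3])
  fix i j :: nat assume ij: "i \<in> {1, 2, 3}" "j \<in> {1, 2, 3}"
  have "mat3_mult (outer3 x y) (skew v) i j = x i * (y 1 * skew v 1 j + y 2 * skew v 2 j + y 3 * skew v 3 j)"
    using ij by (simp add: mat3_mult_expand outer3_def algebra_simps)
  then show "mat3_mult (outer3 x y) (skew v) i j = outer3 x (cross3 y v) i j"
    unfolding skew_mult_left[OF ij(2)] using ij by (simp add: outer3_def)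
qed

lemma outer3_zero: "outer3 v (\<lambda>c. 0) = (\<lambda>i j. 0)" "outer3 (\<lambda>c. 0) v = (\<lambda>i j. 0)"
  by (auto simp: outer3_def fun_eq_iff)

text \<open>The identity v \<times> (w \<times> x) = (v\<cdot>x) w - (v\<cdot>w) x in matrix
  form.\<close>

lemma skew_skew: "mat3_mult (skew v) (skew w) = (\<lambda>i j. outer3 w v i j - dot3 v w * mat3_one i j)"
  by (rule supp3_entries_eqI[OF supp3_mult[OF supp3_skew supp3_skew] supp3_diff[OF supp3_outer3 supp3_scale[OF supp3_one]]])
    (simp_all add: mat3_mult_expand skew_def outer3_def dot3_def mat3_one_def algebra_simps)

lemma skew_commutator:
  "(\<lambda>i j. mat3_mult (skew v) (skew w) i j - mat3_mult (skew w) (skew v) i j) = skew (cross3 v w)"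
  by (rule supp3_entries_eqI[OF supp3_diff[OF supp3_mult[OF supp3_skew supp3_skew] supp3_mult[OF supp3_skew supp3_skew]] supp3_skew])
    (simp_all add: mat3_mult_expand skew_def cross3_def algebra_simps)

lemma cross3_self: "cross3 v v = (\<lambda>c. 0)"
  by (auto simp: cross3_def)

text \<open>Cayley-Hamilton for a skew-symmetric A: A^3 = - (a\<cdot>a) A, because a \<times> a =
  0.\<close>

lemma mpow_skew_odd: "mpow (skew a) (2 * k + 1) = (\<lambda>i j. (- dot3 a a) ^ k * skew a i j)"
proof (induction k)
  case 0
  then show ?case by (simp add: One_nat_def mat3_one_right supp3_skew)
next
  case (Suc k)
  have "mat3_mult (skew a) (mat3_mult (skew a) (skew a)) = (\<lambda>i j. - dot3 a a * skew a i j)"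
  proof -
    have "mat3_mult (skew a) (\<lambda>i j. outer3 a a i j - dot3 a a * mat3_one i j)
       = (\<lambda>i j. mat3_mult (skew a) (outer3 a a) i j + (- dot3 a a) * mat3_mult (skew a) mat3_one i j)"
      by (intro ext) (simp add: mat3_mult_expand algebra_simps)
    then show ?thesis
      unfolding skew_skew by (simp add: skew_outer3 cross3_self outer3_zero mat3_one_right supp3_skew)
  qed
  then have "mat3_mult (skew a) (mat3_mult (skew a) (\<lambda>i j. (- dot3 a a) ^ k * skew a i j))
      = (\<lambda>i j. (- dot3 a a) ^ Suc k * skew a i j)"
    by (simp only: mat3_mult_scale_right) (simp add: mult_ac)
  moreover have "2 * Suc k + 1 = Suc (Suc (2 * k + 1))" by simp
  ultimately show ?case by (simp only: mpow.simps Suc)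
qed

lemma mpow_skew_even:
  "mpow (skew a) (2 * k + 2) = (\<lambda>i j. (- dot3 a a) ^ k * (outer3 a a i j - dot3 a a * mat3_one i j))"
proof -
  have "2 * k + 2 = Suc (2 * k + 1)" by simp
  then show ?thesis
    by (simp only: mpow.simps mpow_skew_odd mat3_mult_scale_right skew_skew)
qed

text \<open>Orthogonality makes \<open>skew a\<close> times \<open>skew w\<close> the rank one
  matrix \<open>outer3 w a\<close>, which \<open>skew w\<close> annihilates. This is what makes
  \<open>uwz_word\<close> invariant.\<close>

lemma skew_odd_skew_zero:
  assumes "dot3 a w = 0"
  shows "mat3_mult (skew w) (mat3_mult (mpow (skew a) (2 * k + 1)) (skew w)) = (\<lambda>i j. 0)"
proof -
  have "mat3_mult (skew w) (mat3_mult (skew a) (skew w)) = (\<lambda>i j. 0)"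
    unfolding skew_skew using assms by (simp add: skew_outer3 cross3_self outer3_zero)
  then show ?thesis unfolding mpow_skew_odd by (simp add: mat3_mult_scale_left mat3_mult_scale_right)
qed

section \<open>Words in the generators and the scalars available in the algebra\<close>

definition w_vec :: "'k::field_char_0 tpoint \<Rightarrow> nat \<Rightarrow> 'k" where
  "w_vec x = cross3 (rows x 1) (rows x 2)"

definition z_vec :: "'k::field_char_0 tpoint \<Rightarrow> nat \<Rightarrow> 'k" where
  "z_vec x = cross3 (rows x 1) (rows x 3)"

definition sqnorm_w :: "'k::field_char_0 tpoint \<Rightarrow> 'k" where
  "sqnorm_w x = dot3 (w_vec x) (w_vec x)"

definition vol :: "'k::field_char_0 tpoint \<Rightarrow> 'k" where
  "vol x = dot3 (w_vec x) (rows x 3)"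

definition uw_word :: "nat \<Rightarrow> nat \<Rightarrow> nat \<Rightarrow> 'k::field_char_0 matfun" where
  "uw_word al m be x = mat3_mult (mpow (skew (w_vec x)) al) (mat3_mult (mpow (skew (rows x 1)) m) (mpow (skew (w_vec x)) be))"

definition uwz_word :: "nat \<Rightarrow> 'k::field_char_0 matfun" where
  "uwz_word m x = mat3_mult (skew (w_vec x)) (mat3_mult (mpow (skew (rows x 1)) (m - 1)) (skew (z_vec x)))"

lemma Fp_skew_row: "1 \<le> k \<Longrightarrow> k \<le> p \<Longrightarrow> (\<lambda>x. skew (rows x k)) \<in> Fp p"
proof -
  assume "1 \<le> k" "k \<le> p"
  then have "gen_skew k \<in> Fp p" by (rule Fp.gen)
  also have "gen_skew k = (\<lambda>x. skew (rows x k))" by (rule ext) (rule gen_skew_rows)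
  finally show ?thesis .
qed

lemma Fp_skew_cross3:
  "(\<lambda>x. skew (v x)) \<in> Fp p \<Longrightarrow> (\<lambda>x. skew (w x)) \<in> Fp p \<Longrightarrow> (\<lambda>x. skew (cross3 (v x) (w x))) \<in> Fp p"
  unfolding skew_commutator[symmetric] by (intro Fp_diff Fp.mult)

lemma Fp_skew_w_vec: "2 \<le> p \<Longrightarrow> (\<lambda>x. skew (w_vec x)) \<in> Fp p"
  unfolding w_vec_def by (intro Fp_skew_cross3 Fp_skew_row) auto

lemma Fp_skew_z_vec: "3 \<le> p \<Longrightarrow> (\<lambda>x. skew (z_vec x)) \<in> Fp p"
  unfolding z_vec_def by (intro Fp_skew_cross3 Fp_skew_row) auto

lemma Fp_mpow: "n = 0 \<or> (\<lambda>x. A x) \<in> Fp p \<Longrightarrow> (\<lambda>x. mpow (A x) n) \<in> Fp p"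
  by (induction n) (auto intro: Fp.one Fp.mult)

text \<open>The scalar r = w\<cdot>w is an element of the algebra: with U, V, W the matrices of v_1,
  v_2, w, the product U W V is \<open>outer3 w w\<close>, and W W is \<open>outer3 w w\<close> minus
  r.\<close>

lemma Fp_sqnorm_w:
  fixes F :: "'k::field_char_0 matfun"
  assumes "2 \<le> p" "F \<in> Fp p"
  shows "(\<lambda>x i j. sqnorm_w x * F x i j) \<in> Fp p"
proof -
  have W: "(\<lambda>x :: 'k tpoint. skew (w_vec x)) \<in> Fp p" and U: "(\<lambda>x :: 'k tpoint. skew (rows x 1)) \<in> Fp p"
    and V: "(\<lambda>x :: 'k tpoint. skew (rows x 2)) \<in> Fp p"
    using assms(1) by (auto intro!: Fp_skew_w_vec Fp_skew_row)
  let ?R = "\<lambda>(x :: 'k tpoint) i j. mat3_mult (mat3_mult (skew (rows x 1)) (skew (w_vec x))) (skew (rows x 2)) i j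
      - mat3_mult (skew (w_vec x)) (skew (w_vec x)) i j"
  have R: "?R x = (\<lambda>i j. sqnorm_w x * mat3_one i j)" for x
  proof -
    have "dot3 (rows x 1) (w_vec x) = 0" by (simp add: w_vec_def dot3_cross3)
    then have "mat3_mult (skew (rows x 1)) (skew (w_vec x)) = outer3 (w_vec x) (rows x 1)"
      by (simp add: skew_skew)
    moreover have "mat3_mult (outer3 (w_vec x) (rows x 1)) (skew (rows x 2)) = outer3 (w_vec x) (w_vec x)"
      by (simp add: outer3_skew w_vec_def)
    ultimately show ?thesis by (simp add: skew_skew sqnorm_w_def)
  qed
  have "(\<lambda>x. mat3_mult (?R x) (F x)) \<in> Fp p"
    by (intro Fp.mult Fp_diff W U V assms(2))
  also have "(\<lambda>x. mat3_mult (?R x) (F x)) = (\<lambda>x i j. sqnorm_w x * F x i j)"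
    unfolding R by (simp add: mat3_mult_scale_left mat3_one_left[OF Fp_supp3[OF assms(2)]])
  finally show ?thesis .
qed

text \<open>The three rank one parts add up to the determinant times the identity, by duality of the
  two bases, and the scalar parts subtract it three times; hence - 2.\<close>

lemma triple_sum:
  "(\<lambda>i j. mat3_mult (skew a) (skew (cross3 b z)) i j + mat3_mult (skew b) (skew (cross3 z a)) i j
    + mat3_mult (skew z) (skew (cross3 a b)) i j) = (\<lambda>i j. (- 2 * dot3 (cross3 a b) z) * mat3_one i j)"
  by (rule supp3_entries_eqI[OF supp3_add[OF supp3_add[OF supp3_mult[OF supp3_skew supp3_skew] supp3_mult[OF supp3_skew supp3_skew]]
        supp3_mult[OF supp3_skew supp3_skew]] supp3_scale[OF supp3_one]])
    (simp_all add: mat3_mult_expand skew_def cross3_def dot3_def mat3_one_def algebra_simps)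

lemma Fp_vol:
  fixes F :: "'k::field_char_0 matfun"
  assumes "3 \<le> p" "F \<in> Fp p"
  shows "(\<lambda>x i j. vol x * F x i j) \<in> Fp p"
proof -
  have S: "(\<lambda>x :: 'k tpoint. skew (rows x k)) \<in> Fp p" if "k \<in> {1, 2, 3}" for k
    using assms(1) that by (auto intro!: Fp_skew_row)
  let ?R = "\<lambda>(x :: 'k tpoint) i j. mat3_mult (skew (rows x 1)) (skew (cross3 (rows x 2) (rows x 3))) i j
      + mat3_mult (skew (rows x 2)) (skew (cross3 (rows x 3) (rows x 1))) i j
      + mat3_mult (skew (rows x 3)) (skew (cross3 (rows x 1) (rows x 2))) i j"
  have "(\<lambda>x. mat3_mult (\<lambda>i j. (- 1 / 2) * ?R x i j) (F x)) \<in> Fp p"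
    by (intro Fp.mult[OF Fp.smult[OF Fp.add[OF Fp.add]]] Fp.mult Fp_skew_cross3 S assms(2)) simp_all
  also have "(\<lambda>x. mat3_mult (\<lambda>i j. (- 1 / 2) * ?R x i j) (F x)) = (\<lambda>x i j. vol x * F x i j)"
  proof
    fix x
    have "(\<lambda>i j. (- 1 / 2) * ?R x i j) = (\<lambda>i j. vol x * mat3_one i j)"
      using fun_cong[OF fun_cong[OF triple_sum[of "rows x 1" "rows x 2" "rows x 3"]]]
      by (intro ext) (simp add: vol_def w_vec_def)
    then show "mat3_mult (\<lambda>i j. (- 1 / 2) * ?R x i j) (F x) = (\<lambda>i j. vol x * F x i j)"
      by (simp only: mat3_mult_scale_left mat3_one_left[OF Fp_supp3[OF assms(2)]])
  qed
  finally show ?thesis .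
qed

lemma Fp_sqnorm_w_power: "n = 0 \<or> 2 \<le> p \<Longrightarrow> F \<in> Fp p \<Longrightarrow> (\<lambda>x i j. sqnorm_w x ^ n * F x i j) \<in> Fp p"
proof (induction n)
  case (Suc n)
  then have "(\<lambda>x i j. sqnorm_w x * (sqnorm_w x ^ n * F x i j)) \<in> Fp p" by (intro Fp_sqnorm_w) blast+
  then show ?case by (simp only: power_Suc mult.assoc)
qed simp

lemma Fp_vol_power: "n = 0 \<or> 3 \<le> p \<Longrightarrow> F \<in> Fp p \<Longrightarrow> (\<lambda>x i j. vol x ^ n * F x i j) \<in> Fp p"
proof (induction n)
  case (Suc n)
  then have "(\<lambda>x i j. vol x * (vol x ^ n * F x i j)) \<in> Fp p" by (intro Fp_vol) blast+
  then show ?case by (simp only: power_Suc mult.assoc)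
qed simp

lemma uw_word_Fp:
  assumes "al = 0 \<or> 2 \<le> p" "be = 0 \<or> 2 \<le> p" "m = 0 \<or> 1 \<le> p"
  shows "uw_word al m be \<in> Fp p"
proof -
  have "(\<lambda>x. uw_word al m be x) \<in> Fp p"
    unfolding uw_word_def using assms by (intro Fp.mult Fp_mpow) (auto intro: Fp_skew_w_vec Fp_skew_row)
  then show ?thesis by simp
qed

lemma uwz_word_Fp: "3 \<le> p \<Longrightarrow> uwz_word m \<in> Fp p"
proof -
  assume "3 \<le> p"
  then have "(\<lambda>x. uwz_word m x) \<in> Fp p"
    unfolding uwz_word_def by (intro Fp.mult Fp_mpow Fp_skew_w_vec Fp_skew_z_vec disjI2 Fp_skew_row) auto
  then show ?thesis by simp
qed

section \<open>Invariance and homogeneity of the words\<close>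

lemma rows_addrow: "rows (\<lambda>v. x v + t * shift i j x v) k = (if k = j then (\<lambda>c. rows x k c + t * rows x i c) else rows x k)"
  by (auto simp: rows_def shift_def fun_eq_iff)

lemma rows_rowscale: "rows (rowscale i t x) k = (if k = i then (\<lambda>c. t * rows x k c) else rows x k)"
  by (auto simp: rows_def rowscale_def fun_eq_iff)

lemma cross3_add_right: "cross3 v (\<lambda>c. w c + t * u c) = (\<lambda>c. cross3 v w c + t * cross3 v u c)"
  by (auto simp: cross3_def fun_eq_iff algebra_simps)

lemma cross3_scale: "cross3 (\<lambda>c. t * v c) w = (\<lambda>c. t * cross3 v w c)" "cross3 v (\<lambda>c. t * w c) = (\<lambda>c. t * cross3 v w c)"
  by (auto simp: cross3_def fun_eq_iff algebra_simps)

lemma dot3_scale: "dot3 (\<lambda>c. t * v c) w = t * dot3 v w" "dot3 v (\<lambda>c. t * w c) = t * dot3 v w"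
  by (auto simp: dot3_def algebra_simps)

lemma dot3_add_right: "dot3 v (\<lambda>c. w c + t * u c) = dot3 v w + t * dot3 v u"
  by (auto simp: dot3_def algebra_simps)

lemma w_vec_addrow: "1 \<le> i \<Longrightarrow> i < j \<Longrightarrow> w_vec (\<lambda>v. x v + t * shift i j x v) = w_vec x"
proof -
  assume "1 \<le> i" "i < j"
  then have "j = 2 \<Longrightarrow> i = 1" "j \<noteq> 1" by auto
  then show ?thesis unfolding w_vec_def rows_addrow by (cases "j = 2") (auto simp: cross3_add_right cross3_self)
qed

lemma vol_addrow: "1 \<le> i \<Longrightarrow> i < j \<Longrightarrow> vol (\<lambda>v. x v + t * shift i j x v) = vol x"
proof -
  assume ij: "1 \<le> i" "i < j"
  have "dot3 (w_vec x) (rows x i) = 0" if "j = 3"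
  proof -
    have "i = 1 \<or> i = 2" using ij that by auto
    then show ?thesis by (auto simp: w_vec_def dot3_def cross3_def algebra_simps)
  qed
  then show ?thesis
    unfolding vol_def w_vec_addrow[OF ij] rows_addrow by (auto simp: dot3_add_right)
qed

lemma uw_word_addrow: "1 \<le> i \<Longrightarrow> i < j \<Longrightarrow> uw_word al m be (\<lambda>v. x v + t * shift i j x v) = uw_word al m be x"
  unfolding uw_word_def by (simp add: w_vec_addrow rows_addrow)

lemma sqnorm_w_addrow: "1 \<le> i \<Longrightarrow> i < j \<Longrightarrow> sqnorm_w (\<lambda>v. x v + t * shift i j x v) = sqnorm_w x"
  unfolding sqnorm_w_def by (simp add: w_vec_addrow)

text \<open>Only adding row 2 to row 3 matters: it changes \<open>z_vec\<close> by a multiple of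
  \<open>w_vec\<close>, and the extra term W U^(m-1) W is zero because m - 1 is odd.\<close>

lemma uwz_word_addrow:
  assumes ij: "1 \<le> i" "i < j" and m: "even m" "m \<noteq> 0"
  shows "uwz_word m (\<lambda>v. x v + t * shift i j x v) = uwz_word m x"
proof -
  obtain k where k: "m - 1 = 2 * k + 1"
  proof -
    obtain l where "m = 2 * l" using m(1) by blast
    then show ?thesis using m(2) that[of "l - 1"] by (cases l) auto
  qed
  consider "j \<noteq> 3" | "j = 3" "i = 1" | "j = 3" "i = 2" using ij by force
  then have "uwz_word m (\<lambda>v. x v + t * shift i j x v) i' j' = uwz_word m x i' j'" for i' j'
  proof cases
    case 3
    have "z_vec (\<lambda>v. x v + t * shift i j x v) = (\<lambda>c. z_vec x c + t * w_vec x c)"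
      using 3 by (simp add: z_vec_def w_vec_def rows_addrow cross3_add_right)
    then have "skew (z_vec (\<lambda>v. x v + t * shift i j x v)) = (\<lambda>i j. skew (z_vec x) i j + t * skew (w_vec x) i j)"
      by (simp add: skew_add skew_scale)
    moreover have "mat3_mult (skew (w_vec x)) (mat3_mult (mpow (skew (rows x 1)) (m - 1)) (skew (w_vec x))) = (\<lambda>i j. 0)"
      unfolding k by (rule skew_odd_skew_zero) (simp add: w_vec_def dot3_cross3)
    ultimately show ?thesis using 3 ij
      by (simp add: uwz_word_def w_vec_addrow rows_addrow mat3_mult_add_right mat3_mult_scale_right)
  qed (use ij in \<open>simp_all add: uwz_word_def w_vec_addrow rows_addrow z_vec_def cross3_add_right cross3_self\<close>)
  then show ?thesis by (intro ext)
qed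

lemma w_vec_rowscale: "w_vec (rowscale i t x) = (\<lambda>c. (if i = 1 \<or> i = 2 then t else 1) * w_vec x c)"
  unfolding w_vec_def rows_rowscale by (auto simp: cross3_scale)

lemma sqnorm_w_rowscale: "sqnorm_w (rowscale i t x) = (if i = 1 \<or> i = 2 then t ^ 2 else 1) * sqnorm_w x"
  unfolding sqnorm_w_def w_vec_rowscale dot3_scale by (simp add: power2_eq_square)

lemma vol_rowscale: "vol (rowscale i t x) = (if i \<in> {1, 2, 3} then t else 1) * vol x"
  unfolding vol_def w_vec_rowscale dot3_scale rows_rowscale by (auto simp: dot3_scale)

lemma uw_word_rowscale:
  "uw_word al m be (rowscale i t x) a b = t ^ (if i = 1 then al + m + be else if i = 2 then al + be else 0) * uw_word al m be x a b"
proof -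
  let ?s = "if i = 1 \<or> i = 2 then t else 1" and ?u = "if i = 1 then t else 1"
  have r: "rows (rowscale i t x) 1 = (\<lambda>c. ?u * rows x 1 c)" by (simp add: rows_rowscale)
  have "uw_word al m be (rowscale i t x) a b = ?s ^ al * (?u ^ m * (?s ^ be * uw_word al m be x a b))"
    unfolding uw_word_def w_vec_rowscale r skew_scale mpow_scale mat3_mult_scale_left mat3_mult_scale_right ..
  then show ?thesis by (auto simp: power_add)
qed

lemma uwz_word_rowscale:
  assumes "m \<noteq> 0"
  shows "uwz_word m (rowscale i t x) a b = t ^ (if i = 1 then m + 1 else if i = 2 \<or> i = 3 then 1 else 0) * uwz_word m x a b"
proof -
  have "z_vec (rowscale i t x) = (\<lambda>c. (if i = 1 \<or> i = 3 then t else 1) * z_vec x c)"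
    unfolding z_vec_def rows_rowscale by (auto simp: cross3_scale)
  note z = this
  let ?s = "if i = 1 \<or> i = 2 then t else 1" and ?u = "if i = 1 then t else 1" and ?v = "if i = 1 \<or> i = 3 then t else 1"
  have r: "rows (rowscale i t x) 1 = (\<lambda>c. ?u * rows x 1 c)" by (simp add: rows_rowscale)
  obtain k where "m = Suc k" using assms by (cases m) auto
  moreover have "uwz_word m (rowscale i t x) a b = ?s * (?u ^ (m - 1) * (?v * uwz_word m x a b))"
    unfolding uwz_word_def w_vec_rowscale r z skew_scale mpow_scale mat3_mult_scale_left mat3_mult_scale_right ..
  ultimately show ?thesis by (auto simp: power_add)
qed

text \<open>For a partition \<open>(a, b, c)\<close> the words are \<open>D\<^sup>c r\<^sup>j W\<^sup>\<alpha> U\<^sup>m W\<^sup>\<beta>\<close> with \<open>U = t\<^sub>1\<close>, \<open>W = [t\<^sub>1, t\<^sub>2]\<close>, \<open>r = w\<cdot>w\<close>,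
  \<open>D\<close> the determinant of \<open>v\<^sub>1, v\<^sub>2, v\<^sub>3\<close>, \<open>m = a - b\<close>, \<open>n = b - c = 2 * j + \<alpha> + \<beta>\<close>; the function \<open>expo\<close> lists the
  pairs \<open>(\<alpha>, \<beta>)\<close>. Only for \<open>m\<close> even and \<open>n = 0\<close> such words do not suffice, and the second vector is
  \<open>D\<^sup>c\<^sup>-\<^sup>1 W U\<^sup>m\<^sup>-\<^sup>1 [t\<^sub>1, t\<^sub>3]\<close>.\<close>

definition expo :: "nat \<Rightarrow> nat \<Rightarrow> nat \<Rightarrow> nat \<times> nat" where
  "expo m n i = (if n = 0 then (0, 0)
     else if even n then (if even m then (if i = 0 then (0, 0) else if i = 1 then (1, 1) else (2, 0))
       else (if i = 0 then (0, 2) else (2, 0)))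
     else (if i = 0 then (0, 1) else (1, 0)))"

lemma expo_sum:
  obtains j where "n = 2 * j + (fst (expo m n i) + snd (expo m n i))"
proof (cases "n = 0")
  case True
  then show ?thesis using that[of 0] by (simp add: expo_def)
next
  case False
  show ?thesis
  proof (cases "even n")
    case True
    then obtain l where "n = 2 * Suc l" using False by (metis dvdE mult_0_right not0_implies_Suc)
    then show ?thesis using that[of "Suc l"] that[of l]
      by (cases "even m"; cases "i = 0"; cases "i = 1") (auto simp: expo_def)
  next
    case False
    then obtain l where "n = 2 * l + 1" by (elim oddE)
    then show ?thesis using that[of l] by (auto simp: expo_def)
  qed
qed

definition hw_word :: "(nat \<times> nat \<times> nat) \<times> nat \<Rightarrow> 'k::field_char_0 matfun" where
  "hw_word key = (case key of ((a, b, c), i) \<Rightarrow>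
     if even (a - b) \<and> b = c \<and> i = 1 then (\<lambda>x r s. vol x ^ (c - 1) * uwz_word (a - b) x r s)
     else (\<lambda>x r s. vol x ^ c * (sqnorm_w x ^ ((b - c - (fst (expo (a - b) (b - c) i) + snd (expo (a - b) (b - c) i))) div 2)
       * uw_word (fst (expo (a - b) (b - c) i)) (a - b) (snd (expo (a - b) (b - c) i)) x r s)))"

lemma hw_word_hw_fun:
  assumes ok: "summand_ok p key"
  shows "hw_fun p (part_wt (fst key)) (hw_word key)"
proof -
  obtain a b c i where key: "key = ((a, b, c), i)" by (metis prod_cases4 surj_pair)
  have ord: "b \<le> a" "c \<le> b" using summand_okD(1)[OF ok] by (auto simp: key is_part3_def)
  have "nparts (a, b, c) \<le> p" "is_part3 (a, b, c)" using summand_okD[OF ok] by (simp_all add: key)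
  then have np: "c = 0 \<or> 3 \<le> p" "b = 0 \<or> 2 \<le> p" "a = 0 \<or> 1 \<le> p"
    by (auto simp: nparts_eq split: if_splits)
  show ?thesis
  proof (cases "even (a - b) \<and> b = c \<and> i = 1")
    case True
    \<comment> \<open>A second copy with b = c excludes both a = b = c and the exceptional one-row
      partitions, so \<open>c - 1\<close> and \<open>a - b - 1\<close> are genuine
      differences.\<close>
    have "mult_so3 (a, b, c) > 1" using summand_okD(3)[OF ok] True by (simp add: key)
    then have nz: "a - b \<noteq> 0" "c \<noteq> 0"
      using True ord by (auto simp: mult_so3_def m_nu_def split: if_splits) (use odd_pos[of c] in linarith)+
    have w: "hw_word key = (\<lambda>x r s. vol x ^ (c - 1) * uwz_word (a - b) x r s)"
      unfolding hw_word_def key prod.case if_P[OF True] ..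
    have bc: "b = Suc (c - 1)" using True nz by simp
    have ab: "a = Suc (c - 1 + (a - b))" using bc ord by linarith
    show ?thesis unfolding hw_fun_def w
    proof (intro conjI ballI impI allI)
      show "(\<lambda>x r s. vol x ^ (c - 1) * uwz_word (a - b) x r s) \<in> Fp p"
        using np nz by (intro Fp_vol_power uwz_word_Fp) auto
      fix i j t x assume "i \<in> {1..p}"
      show "(\<lambda>r s. vol (\<lambda>v. x v + t * shift i j x v) ^ (c - 1) * uwz_word (a - b) (\<lambda>v. x v + t * shift i j x v) r s)
          = (\<lambda>r s. vol x ^ (c - 1) * uwz_word (a - b) x r s)" if "i < j"
      proof -
        have i: "1 \<le> i" using \<open>i \<in> {1..p}\<close> by simp
        show ?thesis unfolding vol_addrow[OF i that] uwz_word_addrow[OF i that conjunct1[OF True] nz(1)] ..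
      qed
      fix r s
      have "part_wt (fst key) i = (if i \<in> {1, 2, 3} then c - 1 else 0)
          + (if i = 1 then (a - b) + 1 else if i = 2 \<or> i = 3 then 1 else 0)"
        using ab bc True nz by (simp add: key part_wt_def)
      then show "vol (rowscale i t x) ^ (c - 1) * uwz_word (a - b) (rowscale i t x) r s
          = t ^ part_wt (fst key) i * (vol x ^ (c - 1) * uwz_word (a - b) x r s)"
        unfolding vol_rowscale uwz_word_rowscale[OF nz(1)] by (simp add: power_add power_mult_distrib mult_ac)
    qed
  next
    case False
    define al where "al = fst (expo (a - b) (b - c) i)"
    define be where "be = snd (expo (a - b) (b - c) i)"
    obtain j where j: "b - c = 2 * j + (al + be)" using expo_sum unfolding al_def be_def by blast
    have w: "hw_word key = (\<lambda>x r s. vol x ^ c * (sqnorm_w x ^ j * uw_word al (a - b) be x r s))"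
    proof -
      have e: "(b - c - (al + be)) div 2 = j" using j by simp
      show ?thesis
        unfolding hw_word_def key prod.case if_not_P[OF False] al_def[symmetric] be_def[symmetric] e ..
    qed
    show ?thesis unfolding hw_fun_def w
    proof (intro conjI ballI impI allI)
      show "(\<lambda>x r s. vol x ^ c * (sqnorm_w x ^ j * uw_word al (a - b) be x r s)) \<in> Fp p"
        using np j ord by (intro Fp_vol_power Fp_sqnorm_w_power uw_word_Fp) auto
      fix i k t x assume "i \<in> {1..p}"
      show "(\<lambda>r s. vol (\<lambda>v. x v + t * shift i k x v) ^ c * (sqnorm_w (\<lambda>v. x v + t * shift i k x v) ^ j
            * uw_word al (a - b) be (\<lambda>v. x v + t * shift i k x v) r s))
          = (\<lambda>r s. vol x ^ c * (sqnorm_w x ^ j * uw_word al (a - b) be x r s))" if "i < k"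
      proof -
        have i: "1 \<le> i" using \<open>i \<in> {1..p}\<close> by simp
        show ?thesis unfolding vol_addrow[OF i that] sqnorm_w_addrow[OF i that] uw_word_addrow[OF i that] ..
      qed
      fix r s
      have "part_wt (fst key) i = (if i \<in> {1, 2, 3} then c else 0) + ((if i = 1 \<or> i = 2 then 2 * j else 0)
          + (if i = 1 then al + (a - b) + be else if i = 2 then al + be else 0))"
        using ord j by (simp add: key part_wt_def, arith)
      then show "vol (rowscale i t x) ^ c * (sqnorm_w (rowscale i t x) ^ j * uw_word al (a - b) be (rowscale i t x) r s)
          = t ^ part_wt (fst key) i * (vol x ^ c * (sqnorm_w x ^ j * uw_word al (a - b) be x r s))"
        unfolding vol_rowscale sqnorm_w_rowscale uw_word_rowscale
        by (simp add: power_add power_mult_distrib power2_eq_square mult_2 mult_2_right mult_ac)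
    qed
  qed
qed

section \<open>Constraints on values at the standard frame\<close>

lemma skew_zero: "(\<And>c. v c = 0) \<Longrightarrow> skew v = (\<lambda>i j. 0)"
  by (rule supp3_entries_eqI[OF supp3_skew]) (simp_all add: skew_def supp3_def)

lemma Fp_value_intertwine:
  fixes F :: "'k::field_char_0 matfun"
  assumes "F \<in> Fp p" "supp3 R" "\<And>k. k \<in> {1, 2, 3} \<Longrightarrow> mat3_mult R (skew (stdE k)) = mat3_mult (skew (u k)) R"
    "\<And>k c. 3 < k \<Longrightarrow> u k c = 0"
  shows "mat3_mult R (F (of_rows stdE)) = mat3_mult (F (of_rows u)) R"
proof (rule Fp_intertwine[OF assms(1,2)])
  fix k assume k: "k \<in> {1..p}"
  show "mat3_mult R (gen_skew k (of_rows stdE)) = mat3_mult (gen_skew k (of_rows u)) R"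
  proof (cases "3 < k")
    case True
    have "skew (stdE k) = (\<lambda>i j. 0 :: 'k)" "skew (u k) = (\<lambda>i j. 0)"
      using True assms(4)[OF True] by (intro skew_zero; simp add: stdE_def)+
    then show ?thesis by (intro ext) (simp add: gen_skew_of_rows mat3_mult_expand)
  next
    case False
    then have "k \<in> {1, 2, 3}" using k by auto
    then show ?thesis unfolding gen_skew_of_rows by (rule assms(3))
  qed
qed

definition diag3 :: "(nat \<Rightarrow> 'k::comm_ring_1) \<Rightarrow> nat \<Rightarrow> nat \<Rightarrow> 'k" where
  "diag3 d = (\<lambda>i j. if i = j \<and> i \<in> {1, 2, 3} then d i else 0)"

text \<open>The product conditions say that the diagonal matrix preserves the cross product. In the
  application its entries are signs, and it is a half turn sending e_k to d_k e_k: conjugation of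
  the value must agree with rescaling by the weight.\<close>

lemma hw_fun_parity:
  fixes F :: "'k::field_char_0 matfun" and d :: "nat \<Rightarrow> 'k"
  assumes F: "hw_fun p mu F" and p: "3 \<le> p" and d: "d 1 * d 2 = d 3" "d 2 * d 3 = d 1" "d 3 * d 1 = d 2"
    and ij: "i \<in> {1, 2, 3}" "j \<in> {1, 2, 3}"
  shows "d i * F (of_rows stdE) i j = d 1 ^ mu 1 * (d 2 ^ mu 2 * (d 3 ^ mu 3 * F (of_rows stdE) i j)) * d j"
proof -
  let ?u1 = "stdE(3 := \<lambda>c. d 3 * stdE 3 c)"
  let ?u2 = "?u1(2 := \<lambda>c. d 2 * ?u1 2 c)"
  let ?u3 = "?u2(1 := \<lambda>c. d 1 * ?u2 1 c)"
  have "F (of_rows ?u3) i j = d 1 ^ mu 1 * F (of_rows ?u2) i j" using p by (intro hw_fun_of_rows_scale[OF F]) auto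
  moreover have "F (of_rows ?u2) i j = d 2 ^ mu 2 * F (of_rows ?u1) i j" using p by (intro hw_fun_of_rows_scale[OF F]) auto
  moreover have "F (of_rows ?u1) i j = d 3 ^ mu 3 * F (of_rows stdE) i j" using p by (intro hw_fun_of_rows_scale[OF F]) auto
  ultimately have u3: "F (of_rows ?u3) i j = d 1 ^ mu 1 * (d 2 ^ mu 2 * (d 3 ^ mu 3 * F (of_rows stdE) i j))" by simp
  have m3d: "supp3 (diag3 d)" by (auto simp: supp3_def diag3_def)
  have "mat3_mult (diag3 d) (F (of_rows stdE)) = mat3_mult (F (of_rows ?u3)) (diag3 d)"
  proof (rule Fp_value_intertwine[OF hw_fun_D(1)[OF F] m3d])
    fix k :: nat assume "k \<in> {1, 2, 3}"
    then show "mat3_mult (diag3 d) (skew (stdE k)) = mat3_mult (skew (?u3 k)) (diag3 d)"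
    proof (intro supp3_entries_eqI supp3_mult m3d supp3_skew)
    qed (use d in \<open>elim insertE emptyE; simp add: mat3_mult_expand diag3_def skew_def stdE_def mult.commute\<close>)+
  qed (auto simp: stdE_def)
  from fun_cong[OF fun_cong[OF this, of i], of j]
  show ?thesis using ij u3 by (auto simp: mat3_mult_expand diag3_def)
qed

text \<open>The half turns about e1 and e3 act on entry (i, j) by a sign, which must equal the sign
  coming from the weight unless the entry is zero.\<close>

lemma hw_fun_parity_entries:
  fixes F :: "'k::field_char_0 matfun"
  assumes F: "hw_fun p mu F" and p: "3 \<le> p" and ij: "i \<in> {1, 2, 3}" "j \<in> {1, 2, 3}"
  shows "even (mu 2 + mu 3) \<noteq> (i = 1 \<longleftrightarrow> j = 1) \<Longrightarrow> F (of_rows stdE) i j = 0"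
    "even (mu 1 + mu 2) \<noteq> (i = 3 \<longleftrightarrow> j = 3) \<Longrightarrow> F (of_rows stdE) i j = 0"
proof -
  have self: "x = 0" if "x = - x" for x :: 'k
    using that by simp
  define d :: "nat \<Rightarrow> 'k" where "d = (\<lambda>i. if i = 1 then 1 else - 1)"
  have d: "d 1 = 1" "d 2 = -1" "d 3 = -1" by (simp_all add: d_def)
  have "d i * F (of_rows stdE) i j = d 1 ^ mu 1 * (d 2 ^ mu 2 * (d 3 ^ mu 3 * F (of_rows stdE) i j)) * d j"
    by (rule hw_fun_parity[OF F p _ _ _ ij]) (simp_all add: d)
  then have "d i * F (of_rows stdE) i j = (-1) ^ (mu 2 + mu 3) * F (of_rows stdE) i j * d j"
    by (simp add: d power_add mult.assoc)
  then show "even (mu 2 + mu 3) \<noteq> (i = 1 \<longleftrightarrow> j = 1) \<Longrightarrow> F (of_rows stdE) i j = 0"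
    by (cases "even (mu 2 + mu 3)"; cases "i = 1"; cases "j = 1")
      (simp_all add: d_def self del: even_add)
  define e :: "nat \<Rightarrow> 'k" where "e = (\<lambda>i. if i = 3 then 1 else - 1)"
  have e: "e 1 = -1" "e 2 = -1" "e 3 = 1" by (simp_all add: e_def)
  have "e i * F (of_rows stdE) i j = e 1 ^ mu 1 * (e 2 ^ mu 2 * (e 3 ^ mu 3 * F (of_rows stdE) i j)) * e j"
    by (rule hw_fun_parity[OF F p _ _ _ ij]) (simp_all add: e)
  then have "e i * F (of_rows stdE) i j = (-1) ^ (mu 1 + mu 2) * F (of_rows stdE) i j * e j"
    by (simp add: e power_add mult.assoc)
  then show "even (mu 1 + mu 2) \<noteq> (i = 3 \<longleftrightarrow> j = 3) \<Longrightarrow> F (of_rows stdE) i j = 0"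
    by (cases "even (mu 1 + mu 2)"; cases "i = 3"; cases "j = 3")
      (simp_all add: e_def self del: even_add)
qed

text \<open>A quarter turn is a product of three shears. The two that add the later row to the
  earlier one are permitted by equality of the two weight entries.\<close>

lemma hw_fun_rotate:
  assumes F: "hw_fun p mu F" and ij: "i \<in> {1..p}" "j \<in> {1..p}" "i < j" "mu i = mu j"
  shows "F (of_rows (u(i := u j, j := \<lambda>c. - u i c))) = F (of_rows u)"
proof -
  have flat: "F (of_rows (u(i := \<lambda>c. u i c + t * u j c))) = F (of_rows u)" for u t
    using hw_fun_flat[OF F ij] by (simp add: of_rows_addrow)
  let ?u1 = "u(i := \<lambda>c. u i c + 1 * u j c)"
  let ?u2 = "?u1(j := \<lambda>c. ?u1 j c + (- 1) * ?u1 i c)"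
  let ?u3 = "?u2(i := \<lambda>c. ?u2 i c + 1 * ?u2 j c)"
  have "?u3 = u(i := u j, j := \<lambda>c. - u i c)" using ij(3) by (auto simp: fun_eq_iff)
  moreover have "F (of_rows ?u3) = F (of_rows ?u2)" by (rule flat)
  moreover have "F (of_rows ?u2) = F (of_rows ?u1)" using ij by (intro hw_fun_of_rows_add[OF F])
  moreover have "F (of_rows ?u1) = F (of_rows u)" by (rule flat)
  ultimately show ?thesis by simp
qed

text \<open>The value commutes with the quarter turn e1 to e2, e2 to - e1, as the highest weight
  vector does not notice this change of rows.\<close>

lemma hw_fun_rot12:
  fixes F :: "'k::field_char_0 matfun"
  assumes F: "hw_fun p mu F" and p: "3 \<le> p" and eq: "mu 1 = mu 2"
  shows "F (of_rows stdE) 1 1 = F (of_rows stdE) 2 2" "F (of_rows stdE) 1 2 = - F (of_rows stdE) 2 1"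
proof -
  let ?u = "stdE(1 := stdE 2, 2 := \<lambda>c. - stdE 1 c)"
  let ?R = "\<lambda>i j. if i = 2 \<and> j = 1 then 1 else if i = 1 \<and> j = 2 then - 1 else if i = 3 \<and> j = 3 then 1 else (0 :: 'k)"
  have mR: "supp3 ?R" by (auto simp: supp3_def)
  have "mat3_mult ?R (F (of_rows stdE)) = mat3_mult (F (of_rows ?u)) ?R"
  proof (rule Fp_value_intertwine[OF hw_fun_D(1)[OF F] mR])
    fix k :: nat assume "k \<in> {1, 2, 3}"
    then show "mat3_mult ?R (skew (stdE k)) = mat3_mult (skew (?u k)) ?R"
    proof (intro supp3_entries_eqI supp3_mult mR supp3_skew)
    qed (elim insertE emptyE; simp add: mat3_mult_expand skew_def stdE_def)+
  qed (auto simp: stdE_def)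
  also have "F (of_rows ?u) = F (of_rows stdE)" using p eq by (intro hw_fun_rotate[OF F]) auto
  finally have *: "mat3_mult ?R (F (of_rows stdE)) i j = mat3_mult (F (of_rows stdE)) ?R i j" for i j by simp
  show "F (of_rows stdE) 1 1 = F (of_rows stdE) 2 2" using *[of 2 1] by (simp add: mat3_mult_expand)
  show "F (of_rows stdE) 1 2 = - F (of_rows stdE) 2 1" using *[of 2 2] by (simp add: mat3_mult_expand)
qed

lemma hw_fun_rot23:
  fixes F :: "'k::field_char_0 matfun"
  assumes F: "hw_fun p mu F" and p: "3 \<le> p" and eq: "mu 2 = mu 3"
  shows "F (of_rows stdE) 2 2 = F (of_rows stdE) 3 3" "F (of_rows stdE) 2 3 = - F (of_rows stdE) 3 2"
proof -
  let ?u = "stdE(2 := stdE 3, 3 := \<lambda>c. - stdE 2 c)"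
  let ?R = "\<lambda>i j. if i = 3 \<and> j = 2 then 1 else if i = 2 \<and> j = 3 then - 1 else if i = 1 \<and> j = 1 then 1 else (0 :: 'k)"
  have mR: "supp3 ?R" by (auto simp: supp3_def)
  have "mat3_mult ?R (F (of_rows stdE)) = mat3_mult (F (of_rows ?u)) ?R"
  proof (rule Fp_value_intertwine[OF hw_fun_D(1)[OF F] mR])
    fix k :: nat assume "k \<in> {1, 2, 3}"
    then show "mat3_mult ?R (skew (stdE k)) = mat3_mult (skew (?u k)) ?R"
    proof (intro supp3_entries_eqI supp3_mult mR supp3_skew)
    qed (elim insertE emptyE; simp add: mat3_mult_expand skew_def stdE_def)+
  qed (auto simp: stdE_def)
  also have "F (of_rows ?u) = F (of_rows stdE)" using p eq by (intro hw_fun_rotate[OF F]) auto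
  finally have *: "mat3_mult ?R (F (of_rows stdE)) i j = mat3_mult (F (of_rows stdE)) ?R i j" for i j by simp
  show "F (of_rows stdE) 2 2 = F (of_rows stdE) 3 3" using *[of 3 2] by (simp add: mat3_mult_expand)
  show "F (of_rows stdE) 2 3 = - F (of_rows stdE) 3 2" using *[of 3 3] by (simp add: mat3_mult_expand)
qed

text \<open>With only the vector e1 left, the value is a polynomial in one matrix whose first row is
  zero, so the (1,1) entry is the constant term.\<close>

lemma Fp_single_row:
  fixes F :: "'k::field_char_0 matfun"
  assumes "F \<in> Fp p"
  shows "(\<forall>j\<in>{2, 3}. F (of_rows (stdE(2 := \<lambda>_. 0, 3 := \<lambda>_. 0))) 1 j = 0 \<and> F (of_rows (\<lambda>_ _. 0)) 1 j = 0)
    \<and> F (of_rows (stdE(2 := \<lambda>_. 0, 3 := \<lambda>_. 0))) 1 1 = F (of_rows (\<lambda>_ _. 0)) 1 1"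
  using assms
proof (induction rule: Fp.induct)
  case (gen k)
  then show ?case by (auto simp: gen_skew_of_rows skew_def stdE_def)
qed (auto simp: mat3_one_def mat3_mult_expand)

text \<open>The source of the exceptional multiplicity. Rows of weight 0 may be set to zero, as 0^0
  = 1; the (1,1) entry is then the constant term, which positive degree in the first row
  kills.\<close>

lemma hw_fun_single_row:
  fixes F :: "'k::field_char_0 matfun"
  assumes F: "hw_fun p mu F" and p: "3 \<le> p" and mu: "mu 1 \<noteq> 0" "mu 2 = 0" "mu 3 = 0"
  shows "F (of_rows stdE) 1 1 = 0"
proof -
  note Fp = hw_fun_D(1)[OF F]
  let ?u1 = "stdE(2 := \<lambda>c. 0 * stdE 2 c)"
  let ?u2 = "?u1(3 := \<lambda>c. 0 * ?u1 3 c)"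
  let ?u3 = "?u2(1 := \<lambda>c. 0 * ?u2 1 c)"
  have "F (of_rows ?u1) 1 1 = F (of_rows stdE) 1 1" using hw_fun_of_rows_scale[OF F, of 2 stdE 0 1 1] p mu by simp
  moreover have "F (of_rows ?u2) 1 1 = F (of_rows ?u1) 1 1" using hw_fun_of_rows_scale[OF F, of 3 ?u1 0 1 1] p mu by simp
  moreover have "F (of_rows ?u3) 1 1 = 0" using hw_fun_of_rows_scale[OF F, of 1 ?u2 0 1 1] p mu by (simp add: power_0_left)
  moreover have "F (of_rows ?u2) = F (of_rows (stdE(2 := \<lambda>_. 0, 3 := \<lambda>_. 0)))" "F (of_rows ?u3) = F (of_rows (\<lambda>_ _. 0))"
    by (rule Fp_of_rows_cong[OF Fp]; simp add: stdE_def)+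
  ultimately show ?thesis using Fp_single_row[OF Fp] by simp
qed

section \<open>Multiplicities\<close>

definition unit3 :: "nat \<Rightarrow> nat \<Rightarrow> nat \<Rightarrow> nat \<Rightarrow> 'k::comm_ring_1" where
  "unit3 a b = (\<lambda>i j. if i = a \<and> j = b then 1 else 0)"

lemma supp3_unit3: "a \<in> {1, 2, 3} \<Longrightarrow> b \<in> {1, 2, 3} \<Longrightarrow> supp3 (unit3 a b)"
  by (auto simp: supp3_def unit3_def)

lemma skew_std:
  "skew (rows (of_rows stdE) 1) = (\<lambda>i j. unit3 3 2 i j - unit3 2 3 i j)"
  "skew (w_vec (of_rows stdE)) = (\<lambda>i j. unit3 2 1 i j - unit3 1 2 i j)"
  "skew (z_vec (of_rows stdE)) = (\<lambda>i j. unit3 3 1 i j - unit3 1 3 i j)"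
  by (rule supp3_entries_eqI[OF supp3_skew supp3_diff[OF supp3_unit3 supp3_unit3]];
      simp add: skew_def rows_def of_rows_def stdE_def w_vec_def z_vec_def cross3_def unit3_def)+

lemma sqnorm_w_vol_std: "sqnorm_w (of_rows stdE) = 1" "vol (of_rows stdE) = 1"
  by (simp_all add: sqnorm_w_def vol_def w_vec_def dot3_def cross3_def rows_def of_rows_def stdE_def)

text \<open>At the standard basis a\<cdot>a = 1, and both U^(2k+1) = (-1)^k U and U^(2k+2) = (-1)^k
  U^2.\<close>

definition alt_sign :: "nat \<Rightarrow> 'k::comm_ring_1" where
  "alt_sign m = (- 1) ^ ((m - 1) div 2)"

lemma alt_sign_square: "alt_sign m * alt_sign m = 1"
  by (simp add: alt_sign_def power_add[symmetric] flip: mult_2)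

lemma mpow_std_odd: "odd m \<Longrightarrow> mpow (skew (rows (of_rows stdE) 1)) m = (\<lambda>i j. alt_sign m * (unit3 3 2 i j - unit3 2 3 i j))"
proof -
  assume "odd m"
  then obtain k where k: "m = 2 * k + 1" by (elim oddE)
  have "dot3 (rows (of_rows stdE) 1) (rows (of_rows stdE) 1) = (1 :: 'a)"
    by (simp add: dot3_def rows_def of_rows_def stdE_def)
  then show ?thesis unfolding k mpow_skew_odd unfolding skew_std(1) by (simp add: alt_sign_def)
qed

lemma mpow_std_even:
  "even m \<Longrightarrow> m \<noteq> 0 \<Longrightarrow> mpow (skew (rows (of_rows stdE) 1)) m = (\<lambda>i j. - alt_sign m * (unit3 2 2 i j + unit3 3 3 i j))"
proof -
  assume m: "even m" "m \<noteq> 0"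
  then obtain l where "m = 2 * l" by blast
  then obtain k where k: "m = 2 * k + 2" using m(2) by (cases l) auto
  have d: "dot3 (rows (of_rows stdE) 1) (rows (of_rows stdE) 1) = (1 :: 'a)"
    by (simp add: dot3_def rows_def of_rows_def stdE_def)
  have "(\<lambda>i j. outer3 (rows (of_rows stdE) 1) (rows (of_rows stdE) 1) i j - 1 * mat3_one i j)
      = (\<lambda>i j. - 1 * (unit3 2 2 i j + unit3 3 3 i j) :: 'a)"
    by (rule supp3_entries_eqI[OF supp3_diff[OF supp3_outer3 supp3_scale[OF supp3_one]] supp3_scale[OF supp3_add[OF supp3_unit3 supp3_unit3]]])
      (simp_all add: outer3_def rows_def of_rows_def stdE_def mat3_one_def unit3_def)
  note e = fun_cong[OF fun_cong[OF this]]
  show ?thesis unfolding k mpow_skew_even d e by (intro ext) (simp add: alt_sign_def algebra_simps)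
qed

lemma mpow_1_2: "supp3 A \<Longrightarrow> mpow A 1 = A" "supp3 A \<Longrightarrow> mpow A 2 = mat3_mult A A"
  by (simp_all add: One_nat_def numeral_2_eq_2 mat3_one_right)

lemma mpow_w_std:
  "mpow (skew (w_vec (of_rows stdE :: 'k::field_char_0 tpoint))) 1 = (\<lambda>i j. unit3 2 1 i j - unit3 1 2 i j)"
  "mpow (skew (w_vec (of_rows stdE :: 'k::field_char_0 tpoint))) 2 = (\<lambda>i j. - (unit3 1 1 i j + unit3 2 2 i j))"
proof -
  show "mpow (skew (w_vec (of_rows stdE))) 1 = (\<lambda>i j. unit3 2 1 i j - unit3 1 2 i j :: 'k)"
    unfolding mpow_1_2(1)[OF supp3_skew] by (rule skew_std(2))
  show "mpow (skew (w_vec (of_rows stdE))) 2 = (\<lambda>i j. - (unit3 1 1 i j + unit3 2 2 i j) :: 'k)"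
    unfolding mpow_1_2(2)[OF supp3_skew] unfolding skew_std(2)
    by (intro ext) (simp add: mat3_mult_expand unit3_def)
qed

lemma uw_word_supp3: "supp3 (uw_word al m be x)"
  unfolding uw_word_def by (intro supp3_mult supp3_mpow supp3_skew)

lemma uwz_word_supp3: "supp3 (uwz_word m x)"
  unfolding uwz_word_def by (intro supp3_mult supp3_mpow supp3_skew)

lemma uw_word_std_0:
  "uw_word 0 0 0 (of_rows stdE :: 'k::field_char_0 tpoint) = mat3_one"
  "uw_word 0 0 1 (of_rows stdE :: 'k::field_char_0 tpoint) = (\<lambda>i j. unit3 2 1 i j - unit3 1 2 i j)"
  "uw_word 1 0 1 (of_rows stdE :: 'k::field_char_0 tpoint) = (\<lambda>i j. - (unit3 1 1 i j + unit3 2 2 i j))"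
proof -
  have W: "supp3 (\<lambda>i j. unit3 2 1 i j - unit3 1 2 i j :: 'k)" by (intro supp3_diff supp3_unit3) auto
  show "uw_word 0 0 0 (of_rows stdE) = (mat3_one :: nat \<Rightarrow> nat \<Rightarrow> 'k)"
    "uw_word 0 0 1 (of_rows stdE) = (\<lambda>i j. unit3 2 1 i j - unit3 1 2 i j :: 'k)"
    unfolding uw_word_def mpow_w_std mpow.simps(1) by (simp_all add: mat3_one_left supp3_one W)
  show "uw_word 1 0 1 (of_rows stdE) = (\<lambda>i j. - (unit3 1 1 i j + unit3 2 2 i j) :: 'k)"
    unfolding uw_word_def mpow_w_std mpow.simps(1) mat3_one_left[OF W]
    by (intro ext) (simp add: mat3_mult_expand unit3_def)
qed

lemma uw_word_std_even:
  fixes m :: nat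
  assumes m: "even m" "m \<noteq> 0"
  shows "uw_word 0 m 0 (of_rows stdE :: 'k::field_char_0 tpoint) = (\<lambda>i j. - alt_sign m * (unit3 2 2 i j + unit3 3 3 i j))"
    "uw_word 1 m 1 (of_rows stdE :: 'k::field_char_0 tpoint) = (\<lambda>i j. alt_sign m * unit3 1 1 i j)"
    "uw_word 2 m 0 (of_rows stdE :: 'k::field_char_0 tpoint) = (\<lambda>i j. alt_sign m * unit3 2 2 i j)"
    "uw_word 0 m 1 (of_rows stdE :: 'k::field_char_0 tpoint) = (\<lambda>i j. - alt_sign m * unit3 2 1 i j)"
    "uw_word 1 m 0 (of_rows stdE :: 'k::field_char_0 tpoint) = (\<lambda>i j. alt_sign m * unit3 1 2 i j)"
    "uwz_word m (of_rows stdE :: 'k::field_char_0 tpoint) = (\<lambda>i j. alt_sign m * unit3 1 1 i j)"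
proof -
  have e: "supp3 (\<lambda>i j. - alt_sign m * (unit3 2 2 i j + unit3 3 3 i j) :: 'k)" "supp3 (\<lambda>i j. unit3 2 1 i j - unit3 1 2 i j :: 'k)"
    by (intro supp3_scale supp3_add supp3_diff supp3_unit3; simp)+
  show "uw_word 0 m 0 (of_rows stdE) = (\<lambda>i j. - alt_sign m * (unit3 2 2 i j + unit3 3 3 i j) :: 'k)"
    unfolding uw_word_def mpow_std_even[OF m] mpow.simps(1) by (simp only: mat3_one_left mat3_one_right e)
  show "uw_word 1 m 1 (of_rows stdE) = (\<lambda>i j. alt_sign m * unit3 1 1 i j :: 'k)"
    "uw_word 2 m 0 (of_rows stdE) = (\<lambda>i j. alt_sign m * unit3 2 2 i j :: 'k)"
    "uw_word 0 m 1 (of_rows stdE) = (\<lambda>i j. - alt_sign m * unit3 2 1 i j :: 'k)"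
    "uw_word 1 m 0 (of_rows stdE) = (\<lambda>i j. alt_sign m * unit3 1 2 i j :: 'k)"
    by (rule supp3_entries_eqI[OF uw_word_supp3 supp3_scale[OF supp3_unit3]];
      simp add: uw_word_def mpow_std_even[OF m] mpow_w_std mat3_mult_expand mat3_one_def unit3_def)+
  have o: "odd (m - 1)" "alt_sign (m - 1) = (alt_sign m :: 'k)"
  proof -
    obtain l where l: "m = 2 * l" using m(1) by blast
    then obtain k where "m = 2 * k + 2" using m(2) by (cases l) auto
    then show "odd (m - 1)" "alt_sign (m - 1) = (alt_sign m :: 'k)" by (simp_all add: alt_sign_def)
  qed
  show "uwz_word m (of_rows stdE) = (\<lambda>i j. alt_sign m * unit3 1 1 i j :: 'k)"
    by (rule supp3_entries_eqI[OF uwz_word_supp3 supp3_scale[OF supp3_unit3]])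
      (simp_all add: uwz_word_def mpow_std_odd[OF o(1)] o(2) skew_std(2,3) mat3_mult_expand mat3_one_def unit3_def)
qed

lemma uw_word_std_odd:
  fixes m :: nat
  assumes m: "odd m"
  shows "uw_word 0 m 0 (of_rows stdE :: 'k::field_char_0 tpoint) = (\<lambda>i j. alt_sign m * (unit3 3 2 i j - unit3 2 3 i j))"
    "uw_word 0 m 1 (of_rows stdE :: 'k::field_char_0 tpoint) = (\<lambda>i j. alt_sign m * unit3 3 1 i j)"
    "uw_word 1 m 0 (of_rows stdE :: 'k::field_char_0 tpoint) = (\<lambda>i j. alt_sign m * unit3 1 3 i j)"
    "uw_word 0 m 2 (of_rows stdE :: 'k::field_char_0 tpoint) = (\<lambda>i j. - alt_sign m * unit3 3 2 i j)"
    "uw_word 2 m 0 (of_rows stdE :: 'k::field_char_0 tpoint) = (\<lambda>i j. alt_sign m * unit3 2 3 i j)"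
proof -
  have e: "supp3 (\<lambda>i j. alt_sign m * (unit3 3 2 i j - unit3 2 3 i j) :: 'k)" "supp3 (\<lambda>i j. unit3 2 1 i j - unit3 1 2 i j :: 'k)"
     "supp3 (\<lambda>i j. - (unit3 1 1 i j + unit3 2 2 i j) :: 'k)"
    by (intro supp3_scale supp3_add supp3_diff supp3_unit3; simp)+ (auto simp: supp3_def unit3_def)
  show "uw_word 0 m 0 (of_rows stdE) = (\<lambda>i j. alt_sign m * (unit3 3 2 i j - unit3 2 3 i j) :: 'k)"
    unfolding uw_word_def mpow_std_odd[OF m] mpow.simps(1) by (simp only: mat3_one_left mat3_one_right e)
  show "uw_word 0 m 1 (of_rows stdE) = (\<lambda>i j. alt_sign m * unit3 3 1 i j :: 'k)"
    "uw_word 1 m 0 (of_rows stdE) = (\<lambda>i j. alt_sign m * unit3 1 3 i j :: 'k)"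
    "uw_word 0 m 2 (of_rows stdE) = (\<lambda>i j. - alt_sign m * unit3 3 2 i j :: 'k)"
    "uw_word 2 m 0 (of_rows stdE) = (\<lambda>i j. alt_sign m * unit3 2 3 i j :: 'k)"
    by (rule supp3_entries_eqI[OF uw_word_supp3 supp3_scale[OF supp3_unit3]];
      simp add: uw_word_def mpow_std_odd[OF m] mpow_w_std mat3_mult_expand mat3_one_def unit3_def)+
qed

lemma hw_word_std:
  "hw_word ((a, b, c), i) (of_rows stdE) = (if even (a - b) \<and> b = c \<and> i = 1 then uwz_word (a - b) (of_rows stdE)
     else uw_word (fst (expo (a - b) (b - c) i)) (a - b) (snd (expo (a - b) (b - c) i)) (of_rows stdE))"
proof (cases "even (a - b) \<and> b = c \<and> i = 1")
  case True
  show ?thesis unfolding hw_word_def prod.case if_P[OF True] by (simp only: sqnorm_w_vol_std power_one mult_1)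
next
  case False
  show ?thesis unfolding hw_word_def prod.case if_not_P[OF False] by (simp only: sqnorm_w_vol_std power_one mult_1)
qed

text \<open>The parity classes of the multiplicity formula, refined by equal parts:
  \<open>ev\<close> has all parities equal, \<open>eo\<close> has c apart, \<open>oo\<close> has b
  apart, \<open>oe\<close> has a apart; \<open>row\<close> is the exceptional family. In each case
  the values shown form a basis of the matrices satisfying the constraints at the standard
  basis.\<close>

lemma hw_word_std_cases:
  assumes "is_part3 (a, b, c)"
  obtains
    (eq) "a = b" "b = c" "mult_so3 (a, b, c) = 1" "hw_word ((a, b, c), 0) (of_rows stdE) = (mat3_one :: nat \<Rightarrow> nat \<Rightarrow> 'k::field_char_0)"
  | (row) "even (a + b)" "a \<noteq> 0" "b = 0" "c = 0" "mult_so3 (a, b, c) = 1"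
      "hw_word ((a, b, c), 0) (of_rows stdE) = (\<lambda>i j. - alt_sign (a - b) * (unit3 2 2 i j + unit3 3 3 i j :: 'k))"
  | (ev0) "even (a + b)" "b = c" "mult_so3 (a, b, c) = 2"
      "hw_word ((a, b, c), 0) (of_rows stdE) = (\<lambda>i j. - alt_sign (a - b) * (unit3 2 2 i j + unit3 3 3 i j :: 'k))"
      "hw_word ((a, b, c), 1) (of_rows stdE) = (\<lambda>i j. alt_sign (a - b) * (unit3 1 1 i j :: 'k))"
  | (ev1) "a = b" "even (b + c)" "mult_so3 (a, b, c) = 2"
      "hw_word ((a, b, c), 0) (of_rows stdE) = (mat3_one :: nat \<Rightarrow> nat \<Rightarrow> 'k)"
      "hw_word ((a, b, c), 1) (of_rows stdE) = (\<lambda>i j. - (unit3 1 1 i j + unit3 2 2 i j :: 'k))"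
  | (ev2) "even (a + b)" "even (b + c)" "mult_so3 (a, b, c) = 3"
      "hw_word ((a, b, c), 0) (of_rows stdE) = (\<lambda>i j. - alt_sign (a - b) * (unit3 2 2 i j + unit3 3 3 i j :: 'k))"
      "hw_word ((a, b, c), 1) (of_rows stdE) = (\<lambda>i j. alt_sign (a - b) * (unit3 1 1 i j :: 'k))"
      "hw_word ((a, b, c), 2) (of_rows stdE) = (\<lambda>i j. alt_sign (a - b) * (unit3 2 2 i j :: 'k))"
  | (eo0) "a = b" "odd (b + c)" "mult_so3 (a, b, c) = 1"
      "hw_word ((a, b, c), 0) (of_rows stdE) = (\<lambda>i j. unit3 2 1 i j - unit3 1 2 i j :: 'k)"
  | (eo1) "even (a + b)" "odd (b + c)" "mult_so3 (a, b, c) = 2"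
      "hw_word ((a, b, c), 0) (of_rows stdE) = (\<lambda>i j. - alt_sign (a - b) * (unit3 2 1 i j :: 'k))"
      "hw_word ((a, b, c), 1) (of_rows stdE) = (\<lambda>i j. alt_sign (a - b) * (unit3 1 2 i j :: 'k))"
  | (oo) "odd (a + b)" "odd (b + c)" "mult_so3 (a, b, c) = 2"
      "hw_word ((a, b, c), 0) (of_rows stdE) = (\<lambda>i j. alt_sign (a - b) * (unit3 3 1 i j :: 'k))"
      "hw_word ((a, b, c), 1) (of_rows stdE) = (\<lambda>i j. alt_sign (a - b) * (unit3 1 3 i j :: 'k))"
  | (oe0) "odd (a + b)" "b = c" "mult_so3 (a, b, c) = 1"
      "hw_word ((a, b, c), 0) (of_rows stdE) = (\<lambda>i j. alt_sign (a - b) * (unit3 3 2 i j - unit3 2 3 i j :: 'k))"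
  | (oe1) "odd (a + b)" "even (b + c)" "mult_so3 (a, b, c) = 2"
      "hw_word ((a, b, c), 0) (of_rows stdE) = (\<lambda>i j. - alt_sign (a - b) * (unit3 3 2 i j :: 'k))"
      "hw_word ((a, b, c), 1) (of_rows stdE) = (\<lambda>i j. alt_sign (a - b) * (unit3 2 3 i j :: 'k))"
proof -
  have ord: "b \<le> a" "c \<le> b" using assms by (auto simp: is_part3_def)
  have par: "even (a - b) \<longleftrightarrow> even (a + b)" "even (b - c) \<longleftrightarrow> even (b + c)"
    using ord by simp_all
  define m where "m = a - b"
  define n where "n = b - c"
  have w: "hw_word ((a, b, c), i) (of_rows stdE) = (if even m \<and> b = c \<and> i = 1 then uwz_word m (of_rows stdE)
     else uw_word (fst (expo m n i)) m (snd (expo m n i)) (of_rows stdE) :: nat \<Rightarrow> nat \<Rightarrow> 'k)" for i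
    unfolding hw_word_std m_def n_def ..
  have mz: "m = 0 \<longleftrightarrow> a = b" "n = 0 \<longleftrightarrow> b = c" using ord by (auto simp: m_def n_def)
  have pm: "even m \<longleftrightarrow> even (a + b)" "even n \<longleftrightarrow> even (b + c)" unfolding m_def n_def by (fact par)+
  note mdef = m_def[symmetric]
  consider "a = b" "b = c" | "a \<noteq> b" "even (a + b)" "b = c" "c = 0" | "a \<noteq> b" "even (a + b)" "b = c" "c \<noteq> 0"
    | "a = b" "b \<noteq> c" "even (b + c)" | "a \<noteq> b" "b \<noteq> c" "even (a + b)" "even (b + c)"
    | "a = b" "odd (b + c)" | "a \<noteq> b" "even (a + b)" "odd (b + c)"
    | "odd (a + b)" "odd (b + c)" | "odd (a + b)" "b = c" | "odd (a + b)" "b \<noteq> c" "even (b + c)"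
    by blast
  then show ?thesis
  proof cases
    case 1
    then show ?thesis using mz pm
      by (intro eq; (subst w)?; simp add: mult_so3_def m_nu_def expo_def uw_word_std_0)
  next
    case 2
    then have m: "even m" "m \<noteq> 0" using mz pm by auto
    have "even a" using 2 by simp
    then have "2 \<le> a" "m = a" using 2 m by (auto simp: m_def elim!: evenE)
    then show ?thesis using 2 mz pm ord m unfolding mdef
      by (intro row; (subst w)?; simp add: mult_so3_def m_nu_def expo_def uw_word_std_even[of a] mdef)
  next
    case 3
    then have m: "even m" "m \<noteq> 0" using mz pm by auto
    have "a - c = m" using 3 by (simp add: m_def)
    then show ?thesis using 3 mz pm ord m
      by (intro ev0; (subst w)?; simp add: mult_so3_def m_nu_def expo_def uw_word_std_even[OF m] mdef)
  next
    case 4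
    then show ?thesis using mz pm ord
      by (intro ev1; (subst w)?; simp add: mult_so3_def m_nu_def expo_def uw_word_std_0)
  next
    case 5
    then have m: "even m" "m \<noteq> 0" using mz pm by auto
    show ?thesis using 5 mz pm ord m
      by (intro ev2; (subst w)?; simp add: mult_so3_def m_nu_def expo_def uw_word_std_even[OF m] mdef)
  next
    case 6
    then have "b \<noteq> c" by auto
    then show ?thesis using 6 mz pm ord
      by (intro eo0; (subst w)?; simp add: mult_so3_def m_nu_def expo_def uw_word_std_0)
  next
    case 7
    then have m: "even m" "m \<noteq> 0" using mz pm by auto
    have "b \<noteq> c" using 7 by auto
    then show ?thesis using 7 mz pm ord m
      by (intro eo1; (subst w)?; simp add: mult_so3_def m_nu_def expo_def uw_word_std_even[OF m] mdef)
  next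
    case 8
    then have m: "odd m" using pm by auto
    have "b \<noteq> c" using 8 by auto
    then show ?thesis using 8 mz pm ord m
      by (intro oo; (subst w)?; simp add: mult_so3_def m_nu_def expo_def uw_word_std_odd[OF m] mdef)
  next
    case 9
    then have m: "odd m" using pm by auto
    have "a - c = m" using 9 by (simp add: m_def)
    then show ?thesis using 9 mz pm ord m
      by (intro oe0; (subst w)?; simp add: mult_so3_def m_nu_def expo_def uw_word_std_odd[OF m] mdef)
  next
    case 10
    then have m: "odd m" using pm by auto
    show ?thesis using 10 mz pm ord m
      by (intro oe1; (subst w)?; simp add: mult_so3_def m_nu_def expo_def uw_word_std_odd[OF m] mdef)
  qed
qed

lemma hw_word_std_independent:
  fixes co :: "nat \<Rightarrow> 'k::field_char_0"
  assumes "is_part3 \<nu>" and z: "\<And>i j. (\<Sum>l<mult_so3 \<nu>. co l * hw_word (\<nu>, l) (of_rows stdE) i j) = 0"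
    and l: "l < mult_so3 \<nu>"
  shows "co l = 0"
proof -
  obtain a b c where nu: "\<nu> = (a, b, c)" by (cases \<nu>)
  have sg0: "alt_sign (a - b) \<noteq> (0 :: 'k)" using alt_sign_square[of "a - b", where ?'a = 'k] by auto
  note z' = z[unfolded nu] and l' = l[unfolded nu]
  have sums: "(\<Sum>l<1. f l) = f 0" "(\<Sum>l<2. f l) = f 0 + f 1" "(\<Sum>l<3. f l) = f 0 + f 1 + f 2"
    for f :: "nat \<Rightarrow> 'k"
    by (simp_all add: numeral_2_eq_2 numeral_3_eq_3 One_nat_def)
  have l3: "x < 1 \<longleftrightarrow> x = 0" "x < 2 \<longleftrightarrow> x = 0 \<or> x = 1" "x < 3 \<longleftrightarrow> x = 0 \<or> x = 1 \<or> x = 2" for x :: nat by auto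
  show ?thesis
  proof (rule hw_word_std_cases[OF assms(1)[unfolded nu], where ?'k = 'k], goal_cases)
    case 1
    then show ?thesis using z'[of 1 1] l' by (simp add: sums l3 mat3_one_def)
  next
    case 2
    then show ?thesis using z'[of 2 2] l' sg0 by (simp add: sums l3 unit3_def)
  next
    case 3
    then show ?thesis using z'[of 1 1] z'[of 2 2] l' sg0 by (auto simp: sums l3 unit3_def)
  next
    case 4
    then show ?thesis using z'[of 1 1] z'[of 3 3] l' by (auto simp: sums l3 unit3_def mat3_one_def)
  next
    case 5
    then show ?thesis using z'[of 1 1] z'[of 2 2] z'[of 3 3] l' sg0 by (auto simp: sums l3 unit3_def)
  next
    case 6
    then show ?thesis using z'[of 2 1] l' by (simp add: sums l3 unit3_def)
  next
    case 7
    then show ?thesis using z'[of 2 1] z'[of 1 2] l' sg0 by (auto simp: sums l3 unit3_def)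
  next
    case 8
    then show ?thesis using z'[of 3 1] z'[of 1 3] l' sg0 by (auto simp: sums l3 unit3_def)
  next
    case 9
    then show ?thesis using z'[of 3 2] l' sg0 by (simp add: sums l3 unit3_def)
  next
    case 10
    then show ?thesis using z'[of 3 2] z'[of 2 3] l' sg0 by (auto simp: sums l3 unit3_def)
  qed
qed

text \<open>The upper bound for the multiplicity: parity, quarter turns and the one-row vanishing
  leave as many free entries as there are words, and the coefficients can be read off.\<close>

lemma hw_word_std_span:
  fixes F :: "'k::field_char_0 matfun"
  assumes F: "hw_fun p mu F" and p: "3 \<le> p" and part: "is_part3 \<nu>"
    and mu: "\<And>i. i \<in> {1, 2, 3} \<Longrightarrow> mu i = part_wt \<nu> i"
  shows "\<exists>co. F (of_rows stdE) = (\<lambda>i j. \<Sum>l<mult_so3 \<nu>. co l * hw_word (\<nu>, l) (of_rows stdE) i j)"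
proof -
  obtain a b c where nu: "\<nu> = (a, b, c)" by (cases \<nu>)
  have mu123: "mu 1 = a" "mu 2 = b" "mu 3 = c" using mu by (simp_all add: nu part_wt_def)
  define M where "M = F (of_rows stdE)"
  have mM: "supp3 M" unfolding M_def by (rule Fp_supp3[OF hw_fun_D(1)[OF F]])
  have p1: "M i j = 0" if "i \<in> {1, 2, 3}" "j \<in> {1, 2, 3}" "even (b + c) \<noteq> (i = 1 \<longleftrightarrow> j = 1)" for i j
    using hw_fun_parity_entries(1)[OF F p that(1,2)] that(3) by (simp add: mu123 M_def)
  have p2: "M i j = 0" if "i \<in> {1, 2, 3}" "j \<in> {1, 2, 3}" "even (a + b) \<noteq> (i = 3 \<longleftrightarrow> j = 3)" for i j
    using hw_fun_parity_entries(2)[OF F p that(1,2)] that(3) by (simp add: mu123 M_def)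
  have r12: "M 1 1 = M 2 2" "M 1 2 = - M 2 1" if "a = b"
    using hw_fun_rot12[OF F p] that by (simp_all add: mu123 M_def)
  have r23: "M 2 2 = M 3 3" "M 2 3 = - M 3 2" if "b = c"
    using hw_fun_rot23[OF F p] that by (simp_all add: mu123 M_def)
  have s1: "M 1 1 = 0" if "a \<noteq> 0" "b = 0" "c = 0"
    using hw_fun_single_row[OF F p] that by (simp add: mu123 M_def)
  have zs: "even (b + c) \<Longrightarrow> M 1 2 = 0" "even (b + c) \<Longrightarrow> M 1 3 = 0" "even (b + c) \<Longrightarrow> M 2 1 = 0" "even (b + c) \<Longrightarrow> M 3 1 = 0"
    "odd (b + c) \<Longrightarrow> M 1 1 = 0" "odd (b + c) \<Longrightarrow> M 2 2 = 0" "odd (b + c) \<Longrightarrow> M 2 3 = 0" "odd (b + c) \<Longrightarrow> M 3 2 = 0"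
    "odd (b + c) \<Longrightarrow> M 3 3 = 0" "even (a + b) \<Longrightarrow> M 1 3 = 0" "even (a + b) \<Longrightarrow> M 2 3 = 0" "even (a + b) \<Longrightarrow> M 3 1 = 0"
    "even (a + b) \<Longrightarrow> M 3 2 = 0" "odd (a + b) \<Longrightarrow> M 1 1 = 0" "odd (a + b) \<Longrightarrow> M 1 2 = 0" "odd (a + b) \<Longrightarrow> M 2 1 = 0"
    "odd (a + b) \<Longrightarrow> M 2 2 = 0" "odd (a + b) \<Longrightarrow> M 3 3 = 0"
    by (rule p1 p2; simp)+
  \<comment> \<open>The sign is its own inverse, so multiplying an entry by \<open>?s\<close> undoes
    the sign of the word.\<close>
  let ?s = "alt_sign (a - b) :: 'k"
  have ss: "?s * (?s * x) = x" for x by (simp add: mult.assoc[symmetric] alt_sign_square)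
  have sums: "(\<Sum>l<1. f l) = f 0" "(\<Sum>l<2. f l) = f 0 + f 1" "(\<Sum>l<3. f l) = f 0 + f 1 + f 2"
    for f :: "nat \<Rightarrow> 'k"
    by (simp_all add: numeral_2_eq_2 numeral_3_eq_3 One_nat_def)
  note base = sums unit3_def mat3_one_def ss alt_sign_square
  have concl: "\<exists>co. M = (\<lambda>i j. \<Sum>l<mult_so3 (a, b, c). co l * hw_word ((a, b, c), l) (of_rows stdE) i j)"
    if "\<And>i j. i \<in> {1, 2, 3} \<Longrightarrow> j \<in> {1, 2, 3} \<Longrightarrow> M i j = (\<Sum>l<mult_so3 (a, b, c). co l * hw_word ((a, b, c), l) (of_rows stdE) i j)" for co
  proof (intro exI[of _ co] supp3_eqI[OF mM])
    have "supp3 (hw_word ((a, b, c), l) (of_rows stdE) :: nat \<Rightarrow> nat \<Rightarrow> 'k)" for l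
      unfolding hw_word_std using uw_word_supp3 uwz_word_supp3 by auto
    then show "supp3 (\<lambda>i j. \<Sum>l<mult_so3 (a, b, c). co l * hw_word ((a, b, c), l) (of_rows stdE) i j)"
      by (simp add: supp3_def)
  qed (rule that)
  have "\<exists>co. M = (\<lambda>i j. \<Sum>l<mult_so3 (a, b, c). co l * hw_word ((a, b, c), l) (of_rows stdE) i j)"
  proof (rule hw_word_std_cases[OF part[unfolded nu], where ?'k = 'k], goal_cases)
    case 1
    have bc: "even (b + c)" and ab: "even (a + b)" using 1 by simp_all
    show ?thesis
      by (intro concl[of "\<lambda>_. M 1 1"]; elim insertE emptyE;
        simp add: 1(3,4) base zs(1-4)[OF bc] zs(10-13)[OF ab] r12[OF 1(1)] r23[OF 1(2)])
  next
    case 2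
    have bc: "even (b + c)" and ab: "even (a + b)" using 2 by simp_all
    have bc2: "b = c" using 2 by simp
    show ?thesis
      by (intro concl[of "\<lambda>_. - ?s * M 2 2"]; elim insertE emptyE;
        simp add: 2(5,6) base zs(1-4)[OF bc] zs(10-13)[OF ab] r23[OF bc2] s1[OF 2(2,3,4)] mult.commute mult.left_commute)
  next
    case 3
    have bc: "even (b + c)" and ab: "even (a + b)" using 3 by simp_all
    show ?thesis
      by (intro concl[of "\<lambda>l. if l = 0 then - ?s * M 2 2 else ?s * M 1 1"]; elim insertE emptyE;
        simp add: 3(3-5) base zs(1-4)[OF bc] zs(10-13)[OF ab] r23[OF 3(2)] mult.commute mult.left_commute)
  next
    case 4
    have bc: "even (b + c)" and ab: "even (a + b)" using 4 by simp_all
    show ?thesis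
      \<comment> \<open>Entry (3,3) occurs only in the identity; the second word must then correct
        entries (1,1) and (2,2) from M 3 3 to M 1 1.\<close>
      by (intro concl[of "\<lambda>l. if l = 0 then M 3 3 else M 3 3 - M 1 1"]; elim insertE emptyE;
        simp add: 4(3-5) base zs(1-4)[OF bc] zs(10-13)[OF ab] r12[OF 4(1)])
  next
    case 5
    have bc: "even (b + c)" and ab: "even (a + b)" using 5 by simp_all
    show ?thesis
      \<comment> \<open>The first word fixes entry (3,3) and puts the same value at (2,2), which the
        third word adjusts.\<close>
      by (intro concl[of "\<lambda>l. if l = 0 then - ?s * M 3 3 else if l = 1 then ?s * M 1 1 else ?s * (M 2 2 - M 3 3)"]; elim insertE emptyE;
        simp add: 5(3-6) base zs(1-4)[OF bc] zs(10-13)[OF ab] right_diff_distrib mult.commute mult.left_commute)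
  next
    case 6
    have bc: "odd (b + c)" and ab: "even (a + b)" using 6 by simp_all
    show ?thesis
      by (intro concl[of "\<lambda>_. M 2 1"]; elim insertE emptyE;
        simp add: 6(3,4) base zs(5-9)[OF bc] zs(10-13)[OF ab] r12(2)[OF 6(1)])
  next
    case 7
    have bc: "odd (b + c)" and ab: "even (a + b)" using 7 by simp_all
    show ?thesis
      by (intro concl[of "\<lambda>l. if l = 0 then - ?s * M 2 1 else ?s * M 1 2"]; elim insertE emptyE;
        simp add: 7(3-5) base zs(5-9)[OF bc] zs(10-13)[OF ab] mult.commute mult.left_commute)
  next
    case 8
    have bc: "odd (b + c)" and ab: "odd (a + b)" using 8 by simp_all
    show ?thesis
      by (intro concl[of "\<lambda>l. if l = 0 then ?s * M 3 1 else ?s * M 1 3"]; elim insertE emptyE;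
        simp add: 8(3-5) base zs(5-9)[OF bc] zs(14-18)[OF ab] mult.commute mult.left_commute)
  next
    case 9
    have bc: "even (b + c)" and ab: "odd (a + b)" using 9 by simp_all
    show ?thesis
      by (intro concl[of "\<lambda>_. ?s * M 3 2"]; elim insertE emptyE;
        simp add: 9(3,4) base zs(1-4)[OF bc] zs(14-18)[OF ab] r23(2)[OF 9(2)] mult.commute mult.left_commute)
  next
    case 10
    have bc: "even (b + c)" and ab: "odd (a + b)" using 10 by simp_all
    show ?thesis
      by (intro concl[of "\<lambda>l. if l = 0 then - ?s * M 3 2 else ?s * M 2 3"]; elim insertE emptyE;
        simp add: 10(3-5) base zs(1-4)[OF bc] zs(14-18)[OF ab] mult.commute mult.left_commute)
  qed
  then show ?thesis by (simp only: M_def nu)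
qed

section \<open>A basis of highest weight vectors in the algebra\<close>

lemma hw_fun_cong: "hw_fun p mu F \<Longrightarrow> (\<And>i. i \<in> {1..p} \<Longrightarrow> mu i = nu i) \<Longrightarrow> hw_fun p nu F"
  unfolding hw_fun_def by simp

lemma hw_fun_diff_sum:
  assumes "hw_fun p mu F" "\<And>l. l < N \<Longrightarrow> hw_fun p mu (W l)"
  shows "hw_fun p mu (\<lambda>x i j. F x i j - (\<Sum>l<N. co l * W l x i j))"
  unfolding hw_fun_def
proof (intro conjI ballI impI allI)
  show "(\<lambda>x i j. F x i j - (\<Sum>l<N. co l * W l x i j)) \<in> Fp p"
    using assms hw_fun_D(1) by (intro Fp_diff Fp_sum Fp.smult) auto
  fix i t x assume i: "i \<in> {1..p}"
  show "(\<lambda>a b. F (\<lambda>v. x v + t * shift i j x v) a b - (\<Sum>l<N. co l * W l (\<lambda>v. x v + t * shift i j x v) a b))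
      = (\<lambda>a b. F x a b - (\<Sum>l<N. co l * W l x a b))" if "j \<in> {1..p}" "i < j" for j
    using hw_fun_D(2)[OF assms(1) i that] hw_fun_D(2)[OF assms(2) i that] by (intro ext) simp
  fix a b
  show "F (rowscale i t x) a b - (\<Sum>l<N. co l * W l (rowscale i t x) a b)
      = t ^ mu i * (F x a b - (\<Sum>l<N. co l * W l x a b))"
    using hw_fun_D(3)[OF assms(1) i] hw_fun_D(3)[OF assms(2) i]
    by (simp add: right_diff_distrib sum_distrib_left mult_ac)
qed

text \<open>Subtract the combination of words with the same value at the standard basis. The
  difference is a highest weight vector vanishing there, hence zero everywhere.\<close>

lemma Fp_hw_span:
  fixes F :: "'k::field_char_0 matfun"
  assumes F: "F \<in> Fp p" "PMG.hw p mu (entry_fun F)"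
  shows "entry_fun F \<in> FS.span ((\<lambda>key. entry_fun (hw_word key)) ` {key. summand_ok p key})"
proof (cases "F = (\<lambda>x i j. 0)")
  case True
  have "entry_fun F = 0"
  proof (intro ext)
    fix a x show "entry_fun F a x = 0 a x" by (cases a) (simp add: True entry_fun_apply)
  qed
  then show ?thesis by (simp only: FS.span_zero)
next
  case False
  \<comment> \<open>At least three vectors are needed to evaluate at the standard basis. The weight
    is set to 0 beyond \<open>p\<close>, so the resulting partition has at most \<open>p\<close>
    parts.\<close>
  define P where "P = max p 3"
  define nu where "nu = (\<lambda>i. if i \<le> p then nat (mu i) else 0)"
  have P: "p \<le> P" "3 \<le> P" by (auto simp: P_def)
  have H: "hw_fun P nu F" unfolding nu_def by (rule hw_fun_extend[OF hw_fun_of_hw[OF F] P(1)])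
  let ?\<nu> = "(nu 1, nu 2, nu 3)"
  have part: "is_part3 ?\<nu>"
    using hw_fun_dominant[OF H False, of 1 2] hw_fun_dominant[OF H False, of 2 3] P by (auto simp: is_part3_def)
  have np: "nparts ?\<nu> \<le> p"
    using part unfolding nparts_eq[OF part] by (auto simp: nu_def is_part3_def split: if_splits)
  have nuw: "nu i = part_wt ?\<nu> i" if "i \<in> {1..P}" for i
    using hw_fun_weight_zero[OF H False that] that by (auto simp: part_wt_def not_less)
  have ok: "summand_ok p (?\<nu>, l)" "summand_ok P (?\<nu>, l)" if "l < mult_so3 ?\<nu>" for l
    using part np that P by (auto simp: summand_ok_def)
  have nu3: "nu i = part_wt ?\<nu> i" if "i \<in> {1, 2, 3}" for i
    using that P(2) by (intro nuw) auto
  have "\<exists>co. F (of_rows stdE) = (\<lambda>i j. \<Sum>l<mult_so3 ?\<nu>. co l * hw_word (?\<nu>, l) (of_rows stdE) i j)"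
    by (rule hw_word_std_span[OF H P(2) part nu3])
  then obtain co where co: "F (of_rows stdE) = (\<lambda>i j. \<Sum>l<mult_so3 ?\<nu>. co l * hw_word (?\<nu>, l) (of_rows stdE) i j)"
    by (elim exE)
  have W: "hw_fun P nu (hw_word (?\<nu>, l))" if "l < mult_so3 ?\<nu>" for l
    by (rule hw_fun_cong[OF hw_word_hw_fun[OF ok(2)[OF that]]]) (simp only: nuw fst_conv)
  let ?G = "\<lambda>x i j. F x i j - (\<Sum>l<mult_so3 ?\<nu>. co l * hw_word (?\<nu>, l) x i j)"
  have "?G = (\<lambda>x i j. 0)"
    by (rule hw_fun_zero[OF hw_fun_diff_sum[OF H W] P(2)]) (simp_all add: co)
  then have eq: "F x i j = (\<Sum>l<mult_so3 ?\<nu>. co l * hw_word (?\<nu>, l) x i j)" for x i j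
    by (simp add: fun_eq_iff)
  have "entry_fun F = (\<Sum>l<mult_so3 ?\<nu>. fscale (co l) (entry_fun (hw_word (?\<nu>, l))))"
  proof (intro ext)
    fix a x show "entry_fun F a x = (\<Sum>l<mult_so3 ?\<nu>. fscale (co l) (entry_fun (hw_word (?\<nu>, l)))) a x"
      by (cases a) (simp add: entry_fun_apply sum_fun_apply fscale_apply eq)
  qed
  also have "\<dots> \<in> FS.span ((\<lambda>key. entry_fun (hw_word key)) ` {key. summand_ok p key})"
    using ok(1) by (intro FS.span_sum FS.span_scale FS.span_base) auto
  finally show ?thesis .
qed

text \<open>Only the first \<open>p\<close> entries are compared; beyond \<open>p\<close> both
  partitions have zero parts.\<close>

lemma part_wt_inj:
  assumes "summand_ok p k" "summand_ok p k'" "\<forall>i\<in>{1..p}. part_wt (fst k) i = part_wt (fst k') i"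
  shows "fst k = fst k'"
proof -
  obtain a b c where k: "fst k = (a, b, c)" by (cases "fst k")
  obtain a' b' c' where k': "fst k' = (a', b', c')" by (cases "fst k'")
  have n: "(a = 0 \<or> 1 \<le> p) \<and> (b = 0 \<or> 2 \<le> p) \<and> (c = 0 \<or> 3 \<le> p)"
    using summand_okD(1,2)[OF assms(1)] unfolding k by (auto simp: nparts_eq is_part3_def split: if_splits)
  have n': "(a' = 0 \<or> 1 \<le> p) \<and> (b' = 0 \<or> 2 \<le> p) \<and> (c' = 0 \<or> 3 \<le> p)"
    using summand_okD(1,2)[OF assms(2)] unfolding k' by (auto simp: nparts_eq is_part3_def split: if_splits)
  have w: "i \<in> {1..p} \<Longrightarrow> part_wt (a, b, c) i = part_wt (a', b', c') i" for i using assms(3) k k' by auto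
  have "a = a'" using w[of 1] n n' by (cases "1 \<le> p") (auto simp: part_wt_def)
  moreover have "b = b'" using w[of 2] n n' by (cases "2 \<le> p") (auto simp: part_wt_def)
  moreover have "c = c'" using w[of 3] n n' by (cases "3 \<le> p") (auto simp: part_wt_def)
  ultimately show ?thesis by (simp add: k k')
qed

text \<open>The diagonal operators separate different partitions; within one partition the values at
  the standard basis decide.\<close>

lemma hw_word_independent:
  fixes c :: "(nat \<times> nat \<times> nat) \<times> nat \<Rightarrow> 'k::field_char_0"
  assumes J: "finite J" "J \<subseteq> {key. summand_ok p key}" and z: "(\<Sum>k\<in>J. fscale (c k) (entry_fun (hw_word k))) = 0"
  shows "\<forall>k\<in>J. c k = 0"
proof
  fix k0 assume k0: "k0 \<in> J"
  let ?f = "\<lambda>k. fscale (c k) (entry_fun (hw_word k))"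
  let ?lam = "\<lambda>k i. of_nat (part_wt (fst k) i) :: 'k"
  have hw: "PMG.hw p (\<lambda>i. int (part_wt (fst k) i)) (entry_fun (hw_word k :: 'k matfun))" if "k \<in> J" for k
    using J(2) that by (intro hw_of_hw_fun hw_word_hw_fun) auto
  have "(\<Sum>k | k \<in> J \<and> (\<forall>i\<in>{1..p}. ?lam k i = ?lam k0 i). ?f k) \<in> {0}"
  proof (rule FS.eigen_sum_component[OF subspace_PM, where T = "\<lambda>i. Eop i i" and J = "{1..p}"])
    show "Eop i i (x + y) = Eop i i x + Eop i i y" if "i \<in> {1..p}" "x \<in> PM p" "y \<in> PM p" for i and x y :: "nat \<times> nat \<Rightarrow> 'k tpoint \<Rightarrow> 'k"
      using that by (intro PMG.E_add)
    show "Eop i i (fscale c x) = fscale c (Eop i i x)" if "i \<in> {1..p}" "x \<in> PM p" for i c and x :: "nat \<times> nat \<Rightarrow> 'k tpoint \<Rightarrow> 'k"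
      using that by (intro PMG.E_scale)
    show "Eop i i x \<in> {0}" if "i \<in> {1..p}" "x \<in> {0}" for i and x :: "nat \<times> nat \<Rightarrow> 'k tpoint \<Rightarrow> 'k"
      using that PMG.E_zero[of i p i] by simp
    show "{0 :: nat \<times> nat \<Rightarrow> 'k tpoint \<Rightarrow> 'k} \<subseteq> PM p" using FS.subspace_0[OF subspace_PM] by simp
    show "?f k \<in> PM p" if "k \<in> J" for k
      by (rule FS.subspace_scale[OF subspace_PM PMG.hwD(2)[OF hw[OF that]]])
    show "Eop i i (?f k) = fscale (?lam k i) (?f k)" if "k \<in> J" "i \<in> {1..p}" for k i
    proof -
      have "Eop i i (?f k) = fscale (c k) (Eop i i (entry_fun (hw_word k :: 'k matfun)))"
        by (rule PMG.E_scale[OF that(2) that(2) PMG.hwD(2)[OF hw[OF that(1)]]])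
      also have "Eop i i (entry_fun (hw_word k :: 'k matfun)) = fscale (of_int (int (part_wt (fst k) i))) (entry_fun (hw_word k))"
        by (rule PMG.hwD(3)[OF hw[OF that(1)] that(2)])
      finally show ?thesis by (simp only: FS.scale_left_commute of_int_of_nat_eq)
    qed
    show "sum ?f J \<in> {0}" using z by (simp only: singleton_iff)
  qed (use J in simp_all)
  also have "{k. k \<in> J \<and> (\<forall>i\<in>{1..p}. ?lam k i = ?lam k0 i)} = {k \<in> J. fst k = fst k0}"
    using J(2) k0 by (auto intro!: part_wt_inj)
  finally have S: "(\<Sum>k | k \<in> J \<and> fst k = fst k0. ?f k) = 0" by (simp only: singleton_iff)
  let ?N = "mult_so3 (fst k0)"
  define co where "co l = (if (fst k0, l) \<in> J then c (fst k0, l) else 0)" for l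
  have ok: "summand_ok p k" if "k \<in> J" for k using that J(2) by blast
  have "(\<Sum>l<?N. co l * hw_word (fst k0, l) (of_rows stdE) i j) = 0" for i j
  proof -
    have "0 = (\<Sum>k | k \<in> J \<and> fst k = fst k0. ?f k) (i, j) (of_rows stdE)" by (simp only: S zero_fun_apply)
    also have "\<dots> = (\<Sum>k | k \<in> J \<and> fst k = fst k0. c k * hw_word k (of_rows stdE) i j)"
      by (simp add: sum_fun_apply fscale_apply entry_fun_apply)
    also have "\<dots> = (\<Sum>l | l < ?N \<and> (fst k0, l) \<in> J. c (fst k0, l) * hw_word (fst k0, l) (of_rows stdE) i j)"
    proof (rule sum.reindex_bij_witness[of _ "\<lambda>l. (fst k0, l)" snd])
      fix k assume k: "k \<in> {k. k \<in> J \<and> fst k = fst k0}"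
      then show "(fst k0, snd k) = k" by (cases k) auto
      have "snd k < mult_so3 (fst k)" using summand_okD(3)[OF ok] k by blast
      then show "snd k \<in> {l. l < ?N \<and> (fst k0, l) \<in> J}" using k by (cases k) auto
      show "c (fst k0, snd k) * hw_word (fst k0, snd k) (of_rows stdE) i j = c k * hw_word k (of_rows stdE) i j"
        using k by (cases k) auto
    qed auto
    also have "\<dots> = (\<Sum>l<?N. co l * hw_word (fst k0, l) (of_rows stdE) i j)"
      by (rule sum.mono_neutral_cong_left) (auto simp: co_def)
    finally show ?thesis by simp
  qed
  then have "co (snd k0) = 0"
    using summand_okD[OF ok[OF k0]] by (intro hw_word_std_independent[of "fst k0" co]) auto
  then show "c k0 = 0" using k0 by (simp add: co_def)
qed

theorem theorem4p1:
  fixes p :: nat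
  assumes "p \<ge> 1"
  shows "\<exists>\<Psi> :: ('k::field_char_0) matfun \<Rightarrow> ((nat \<times> nat \<times> nat) \<times> nat \<Rightarrow> 'k yfun). GL_iso p \<Psi>"
proof -
  let ?A = "FM p :: (nat \<times> nat \<Rightarrow> 'k tpoint \<Rightarrow> 'k) set"
  let ?B = "DSum p :: ((nat \<times> nat \<times> nat) \<times> nat \<Rightarrow> 'k yfun) set"
  interpret GP: gl_pair fscale p Eop ?A fscale Eop ?B
    unfolding gl_pair_def by (intro conjI gl_space_FM gl_space_DSum)
  let ?I = "{key. summand_ok p key}"
  let ?cop = "\<lambda>g. PMG.cop p (\<lambda>i j. g i j - (if i = j then 1 else 0))"
  have "\<exists>\<Theta>. bij_betw \<Theta> ?A ?B \<and> (\<forall>x\<in>?A. \<forall>y\<in>?A. \<Theta> (x + y) = \<Theta> x + \<Theta> y)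
    \<and> (\<forall>c. \<forall>x\<in>?A. \<Theta> (fscale c x) = fscale c (\<Theta> x)) \<and> (\<forall>X n. \<forall>x\<in>?A. \<Theta> (GP.A.cop X n x) = GP.B.cop X n (\<Theta> x))"
  proof (rule GP.iso_of_matching_hw[where I = ?I and w = "\<lambda>key i. int (part_wt (fst key) i)"
      and a = "\<lambda>key. entry_fun (hw_word key)" and b = hw_summand])
    fix key assume "key \<in> ?I"
    then have ok: "summand_ok p key" by blast
    show "GP.A.hw (\<lambda>i. int (part_wt (fst key) i)) (entry_fun (hw_word key))"
      unfolding hw_subspace_iff[OF gl_space_FM FM_PM]
      using hw_of_hw_fun[OF hw_word_hw_fun[OF ok]] hw_fun_D(1)[OF hw_word_hw_fun[OF ok]] by (auto simp: FM_def)
    show "GP.B.hw (\<lambda>i. int (part_wt (fst key) i)) (hw_summand key)"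
      unfolding hw_subspace_iff[OF gl_space_DSum DSum_PM]
      using hw_summand_hw[OF ok] hw_summand_DSum[OF ok] by blast
  next
    fix J and c :: "(nat \<times> nat \<times> nat) \<times> nat \<Rightarrow> 'k" assume J: "finite J" "J \<subseteq> ?I"
    show "\<forall>k\<in>J. c k = 0" if "(\<Sum>k\<in>J. fscale (c k) (entry_fun (hw_word k))) = 0"
      by (rule hw_word_independent[OF J that])
    show "\<forall>k\<in>J. c k = 0" if "(\<Sum>k\<in>J. fscale (c k) (hw_summand k)) = 0"
      by (rule hw_summand_independent[OF J(1) that])
  next
    fix mu x assume "GP.A.hw mu x"
    then have "x \<in> FM p" "PMG.hw p mu x" unfolding hw_subspace_iff[OF gl_space_FM FM_PM] by blast+
    then show "x \<in> FS.span ((\<lambda>key. entry_fun (hw_word key)) ` ?I)"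
      unfolding FM_def using Fp_hw_span by blast
  next
    fix mu x assume "GP.B.hw mu x"
    then have "x \<in> DSum p" "PMG.hw p mu x" unfolding hw_subspace_iff[OF gl_space_DSum DSum_PM] by blast+
    then show "x \<in> FS.span (hw_summand ` ?I)" by (rule DSum_hw_span)
  qed
  then obtain \<Theta> where bij: "bij_betw \<Theta> ?A ?B"
    and add: "\<And>x y. x \<in> ?A \<Longrightarrow> y \<in> ?A \<Longrightarrow> \<Theta> (x + y) = \<Theta> x + \<Theta> y"
    and scale: "\<And>c x. x \<in> ?A \<Longrightarrow> \<Theta> (fscale c x) = fscale c (\<Theta> x)"
    and cop: "\<And>X n x. x \<in> ?A \<Longrightarrow> \<Theta> (GP.A.cop X n x) = GP.B.cop X n (\<Theta> x)"
    by blast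
  have hA: "entry_fun F \<in> ?A" if "F \<in> Fp p" for F using that by (simp add: FM_def)
  have A0: "0 \<in> ?A" by (rule FS.subspace_0[OF subspace_FM])
  have \<Theta>0: "\<Theta> 0 = 0" using scale[OF A0, of 0] by (simp only: FS.scale_zero_left)
  have \<Theta>sum: "\<Theta> (sum f S) = (\<Sum>s\<in>S. \<Theta> (f s))" if "finite S" "\<And>s. s \<in> S \<Longrightarrow> f s \<in> ?A" for f and S :: "nat set"
    using that
  proof (induction S rule: finite_induct)
    case (insert s S)
    have S: "sum f S \<in> ?A" by (rule FS.subspace_sum[OF subspace_FM]) (rule insert.prems, rule insertI2)
    show ?case
      by (simp only: sum.insert[OF insert.hyps] add[OF insert.prems[OF insertI1] S]
          insert.IH[OF insert.prems[OF insertI2]])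
  qed (simp only: sum.empty \<Theta>0)
  have \<Theta>B: "\<Theta> x \<in> ?B" if "x \<in> ?A" for x using bij that by (rule bij_betwE[THEN bspec])
  \<comment> \<open>Both group actions are finite sums of the operators with which \<Theta>
    commutes; the maximum of the two cut-offs makes the sums run over the same range.\<close>
  have equiv: "\<Theta> (gactp p g x) = gactp p g (\<Theta> x)" if x: "x \<in> ?A" for g x
  proof -
    obtain d where d: "\<And>D. d \<le> D \<Longrightarrow> gactp p g x = (\<Sum>n\<le>D. ?cop g n x)"
      using gactp_cop[OF subsetD[OF FM_PM x]] by blast
    obtain e where e: "\<And>D. e \<le> D \<Longrightarrow> gactp p g (\<Theta> x) = (\<Sum>n\<le>D. ?cop g n (\<Theta> x))"
      using gactp_cop[OF subsetD[OF DSum_PM \<Theta>B[OF x]]] by blast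
    have "\<Theta> (gactp p g x) = \<Theta> (\<Sum>n\<le>max d e. ?cop g n x)" by (subst d[of "max d e"]) simp_all
    also have "\<dots> = (\<Sum>n\<le>max d e. \<Theta> (?cop g n x))"
      by (rule \<Theta>sum) (auto intro!: GP.A.cop_mem[OF GP.A.submod_M x])
    also have "\<dots> = (\<Sum>n\<le>max d e. ?cop g n (\<Theta> x))" by (intro sum.cong refl cop[OF x])
    also have "\<dots> = gactp p g (\<Theta> x)" by (rule e[symmetric]) simp
    finally show ?thesis .
  qed
  have "GL_iso p (\<lambda>F. \<Theta> (entry_fun F))"
    unfolding GL_iso_def
  proof (intro conjI ballI allI)
    have "bij_betw entry_fun (Fp p) ?A" unfolding FM_def
      by (rule inj_on_imp_bij_betw[OF inj_on_subset[OF inj_entry_fun]]) simp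
    from bij_betw_trans[OF this bij] show "bij_betw (\<lambda>F. \<Theta> (entry_fun F)) (Fp p) ?B" by (simp add: o_def)
    show "\<Theta> (entry_fun (\<lambda>x i j. F x i j + G x i j)) = (\<lambda>key y. \<Theta> (entry_fun F) key y + \<Theta> (entry_fun G) key y)"
      if "F \<in> Fp p" "G \<in> Fp p" for F G
    proof -
      have "entry_fun (\<lambda>x i j. F x i j + G x i j) = entry_fun F + entry_fun G"
      proof (intro ext)
        fix a x show "entry_fun (\<lambda>x i j. F x i j + G x i j) a x = (entry_fun F + entry_fun G) a x"
          by (cases a) (simp add: entry_fun_apply)
      qed
      then have "\<Theta> (entry_fun (\<lambda>x i j. F x i j + G x i j)) = \<Theta> (entry_fun F) + \<Theta> (entry_fun G)"
        using add[OF hA hA, OF that] by (simp only:)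
      then show ?thesis by (simp only: plus_fun_def)
    qed
    show "\<Theta> (entry_fun (\<lambda>x i j. c * F x i j)) = (\<lambda>key y. c * \<Theta> (entry_fun F) key y)" if "F \<in> Fp p" for F c
    proof -
      have "entry_fun (\<lambda>x i j. c * F x i j) = fscale c (entry_fun F)"
      proof (intro ext)
        fix a x show "entry_fun (\<lambda>x i j. c * F x i j) a x = fscale c (entry_fun F) a x"
          by (cases a) (simp add: entry_fun_apply fscale_apply)
      qed
      then show ?thesis using scale[OF hA[OF that], of c] by (simp add: fscale_def)
    qed
    show "\<Theta> (entry_fun (gact_F p g F)) = gact_D p g (\<Theta> (entry_fun F))" if "F \<in> Fp p" for g F
      using equiv[OF hA[OF that], of g] by (simp add: gactp_entry_fun gact_D_eq)
  qed
  then show ?thesis by blast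
qed

end
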